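(* Let $n=3$, let $\Omega\Subset\mathbb R^3$ be open, and let $(u_\varepsilon)$, $\mu_\varepsilon,\mu,\alpha_\varepsilon,\alpha,\bar\mu,\bar\alpha$ be as in the context, satisfying the standing assumptions (A1)--(A4) listed there. Let $\tau>0$ and let $x\in\Omega$ be a point for which there exists a sequence $x_\varepsilon\to x$ such that $\limsup_{\varepsilon\to0}|u_\varepsilon(x_\varepsilon)|\ge1+\tau$. Then there exists $\bar\theta>0$ depending only on $\bar\alpha$, $\bar\mu$ and $\tau$ such that $\alpha(\{x\})\ge\bar\theta$. In particular, there are only finitely many such points $x$.
   Context: $A\Subset B$ means that $\overline A$ is compact and contained in $B$. Let $W(u)=\frac14(u^2-1)^2$ and $c_0=\int_{-1}^1\sqrt{2W(s)}\,ds=\frac{2\sqrt2}{3}$. For $u\in W^{2,2}(\Omega)$ put $$S_\varepsilon(u)=\frac1{c_0}\int_\Omega\frac\varepsilon2|\nabla u|^2+\frac1\varepsilon W(u)\,dx,\qquad \mathcal W_\varepsilon(u)=\frac1{c_0}\int_\Omega\frac1\varepsilon\Big(\varepsilon\Delta u-\frac1\varepsilon W'(u)\Big)^2dx,\qquad \mathcal E_\varepsilon=\mathcal W_\varepsilon+S_\varepsilon .$$ Throughout, $(u_\varepsilon)$ is a family $u_\varepsilon\in W^{2,2}(\Omega)$ indexed by a sequence $\varepsilon\to0$, $\varepsilon>0$, with associated Radon measures on $\mathbb R^n$ given on open sets $U\subset\mathbb R^n$ by $$\mu_\varepsilon(U)=\frac1{c_0}\int_{U\cap\Omega}\frac\varepsilon2|\nabla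 u_\varepsilon|^2+\frac1\varepsilon W(u_\varepsilon)\,dx,\qquad \alpha_\varepsilon(U)=\frac1{c_0}\int_{U\cap\Omega}\frac1\varepsilon\Big(\varepsilon\Delta u_\varepsilon-\frac1\varepsilon W'(u_\varepsilon)\Big)^2dx .$$ Standing assumptions: (A1) $\limsup_{\varepsilon\to0}\mathcal E_\varepsilon(u_\varepsilon)<\infty$. (A2) $u_\varepsilon\to u$ in $L^2(\Omega)$, and $\mu_\varepsilon\rightharpoonup\mu$, $\alpha_\varepsilon\rightharpoonup\alpha$ weakly-* as Radon measures on $\mathbb R^n$, where $\mu,\alpha$ are finite Radon measures supported in $\overline\Omega$. (A3) $\bar\mu:=\mu(\mathbb R^n)$, $\bar\alpha:=\alpha(\mathbb R^n)$, and all $\varepsilon$ considered are small enough that $\mu_\varepsilon(\mathbb R^n)\le\bar\mu+1$ and $\alpha_\varepsilon(\mathbb R^n)\le\bar\alpha+1$. (A4) On $\partial\Omega$, either $|u_\varepsilon|\le\theta$ for all $\varepsilon$ and some fixed $\theta\ge1$, or $\partial_\nu u_\varepsilon=0$ for all $\varepsilon$. For $u_\varepsilon$ the continuous representative on $\Omega$ is used. *)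

theory Defs
  imports "HOL-Analysis.Analysis"
begin

definition partial_deriv :: "'a::euclidean_space \<Rightarrow> ('a \<Rightarrow> real) \<Rightarrow> 'a \<Rightarrow> real" where
  "partial_deriv i f x = frechet_derivative f (at x) i"

text \<open>All iterated partial derivatives exist and are differentiable (hence continuous).\<close>

definition smooth :: "('a::euclidean_space \<Rightarrow> real) \<Rightarrow> bool" where
  "smooth f \<longleftrightarrow>
     (\<forall>is. set is \<subseteq> Basis \<longrightarrow> foldr partial_deriv is f differentiable_on UNIV)"

definition test_function :: "'a::euclidean_space set \<Rightarrow> ('a \<Rightarrow> real) \<Rightarrow> bool" where
  "test_function \<Omega> \<phi> \<longleftrightarrow>
     smooth \<phi> \<and> compact (closure {x. \<phi> x \<noteq> 0}) \<and> closure {x. \<phi> x \<noteq> 0} \<subseteq> \<Omega>"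

definition L2 :: "'a::euclidean_space set \<Rightarrow> ('a \<Rightarrow> real) set" where
  "L2 \<Omega> = {f \<in> borel_measurable (lebesgue_on \<Omega>). integrable (lebesgue_on \<Omega>) (\<lambda>x. (f x)\<^sup>2)}"

definition locally_integrable :: "'a::euclidean_space set \<Rightarrow> ('a \<Rightarrow> real) \<Rightarrow> bool" where
  "locally_integrable \<Omega> f \<longleftrightarrow> (\<forall>K. compact K \<and> K \<subseteq> \<Omega> \<longrightarrow> f absolutely_integrable_on K)"

definition has_weak_partial ::
    "'a::euclidean_space set \<Rightarrow> 'a \<Rightarrow> ('a \<Rightarrow> real) \<Rightarrow> ('a \<Rightarrow> real) \<Rightarrow> bool" where
  "has_weak_partial \<Omega> i f g \<longleftrightarrow>
     locally_integrable \<Omega> f \<and> locally_integrable \<Omega> g \<and>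
     (\<forall>\<phi>. test_function \<Omega> \<phi> \<longrightarrow>
        (LINT x|lebesgue_on \<Omega>. f x * partial_deriv i \<phi> x) =
        - (LINT x|lebesgue_on \<Omega>. g x * \<phi> x))"

text \<open>
  Weak derivatives are unique up to null sets; the choice below fixes a representative, and is
  used only under integrals.
\<close>

definition weak_partial ::
    "'a::euclidean_space set \<Rightarrow> 'a \<Rightarrow> ('a \<Rightarrow> real) \<Rightarrow> 'a \<Rightarrow> real" where
  "weak_partial \<Omega> i f = (SOME g. has_weak_partial \<Omega> i f g)"

definition weak_grad :: "'a::euclidean_space set \<Rightarrow> ('a \<Rightarrow> real) \<Rightarrow> 'a \<Rightarrow> 'a" where
  "weak_grad \<Omega> f x = (\<Sum>i\<in>Basis. weak_partial \<Omega> i f x *\<^sub>R i)"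

definition weak_laplacian :: "'a::euclidean_space set \<Rightarrow> ('a \<Rightarrow> real) \<Rightarrow> 'a \<Rightarrow> real" where
  "weak_laplacian \<Omega> f x = (\<Sum>i\<in>Basis. weak_partial \<Omega> i (weak_partial \<Omega> i f) x)"

definition W12 :: "'a::euclidean_space set \<Rightarrow> ('a \<Rightarrow> real) set" where
  "W12 \<Omega> = {f \<in> L2 \<Omega>. \<forall>i\<in>Basis. \<exists>g\<in>L2 \<Omega>. has_weak_partial \<Omega> i f g}"

definition W22 :: "'a::euclidean_space set \<Rightarrow> ('a \<Rightarrow> real) set" where
  "W22 \<Omega> = {f \<in> L2 \<Omega>. \<forall>i\<in>Basis. \<exists>g\<in>W12 \<Omega>. has_weak_partial \<Omega> i f g}"

definition W12_0 :: "'a::euclidean_space set \<Rightarrow> ('a \<Rightarrow> real) set" where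
  "W12_0 \<Omega> = {f \<in> W12 \<Omega>. \<exists>\<phi> :: nat \<Rightarrow> 'a \<Rightarrow> real.
     (\<forall>k. test_function \<Omega> (\<phi> k)) \<and>
     (\<lambda>k. LINT x|lebesgue_on \<Omega>. (f x - \<phi> k x)\<^sup>2) \<longlonglongrightarrow> 0 \<and>
     (\<forall>i\<in>Basis.
        (\<lambda>k. LINT x|lebesgue_on \<Omega>. (weak_partial \<Omega> i f x - partial_deriv i (\<phi> k) x)\<^sup>2)
          \<longlonglongrightarrow> 0)}"

text \<open>
  The boundary of \<open>\<Omega>\<close> is not assumed to be regular, so there are no pointwise traces or normals.
  As usual in that situation, an inequality on the boundary is understood in the sense of
  \<open>W12_0\<close>, and a homogeneous Neumann condition through Green's identity. On Lipschitz domains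
  these agree with the conditions in the sense of traces.
\<close>

definition abs_le_on_boundary :: "'a::euclidean_space set \<Rightarrow> ('a \<Rightarrow> real) \<Rightarrow> real \<Rightarrow> bool" where
  "abs_le_on_boundary \<Omega> u \<theta> \<longleftrightarrow> (\<lambda>x. max 0 (\<bar>u x\<bar> - \<theta>)) \<in> W12_0 \<Omega>"

definition zero_normal_deriv :: "'a::euclidean_space set \<Rightarrow> ('a \<Rightarrow> real) \<Rightarrow> bool" where
  "zero_normal_deriv \<Omega> u \<longleftrightarrow>
     (\<forall>\<phi>\<in>W12 \<Omega>.
        (LINT x|lebesgue_on \<Omega>.
           weak_laplacian \<Omega> u x * \<phi> x + weak_grad \<Omega> u x \<bullet> weak_grad \<Omega> \<phi> x) = 0)"

definition W :: "real \<Rightarrow> real" where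
  "W s = 1 / 4 * (s\<^sup>2 - 1)\<^sup>2"

definition c0 :: real where
  "c0 = integral {-1..1} (\<lambda>s. sqrt (2 * W s))"

definition area_density ::
    "'a::euclidean_space set \<Rightarrow> real \<Rightarrow> ('a \<Rightarrow> real) \<Rightarrow> 'a \<Rightarrow> real" where
  "area_density \<Omega> \<epsilon> u x =
     1 / c0 * (\<epsilon> / 2 * (norm (weak_grad \<Omega> u x))\<^sup>2 + 1 / \<epsilon> * W (u x))"

definition willmore_density ::
    "'a::euclidean_space set \<Rightarrow> real \<Rightarrow> ('a \<Rightarrow> real) \<Rightarrow> 'a \<Rightarrow> real" where
  "willmore_density \<Omega> \<epsilon> u x =
     1 / c0 * (1 / \<epsilon> * (\<epsilon> * weak_laplacian \<Omega> u x - 1 / \<epsilon> * deriv W (u x))\<^sup>2)"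

text \<open>
  The energies take the value \<open>\<infinity>\<close> if the (non-negative) integrand is not integrable, which may
  happen in \<open>W22\<close> over an irregular domain.
\<close>

definition area_energy ::
    "'a::euclidean_space set \<Rightarrow> real \<Rightarrow> ('a \<Rightarrow> real) \<Rightarrow> ennreal" where
  "area_energy \<Omega> \<epsilon> u = (\<integral>\<^sup>+x. ennreal (area_density \<Omega> \<epsilon> u x) \<partial>lebesgue_on \<Omega>)"

definition willmore_energy ::
    "'a::euclidean_space set \<Rightarrow> real \<Rightarrow> ('a \<Rightarrow> real) \<Rightarrow> ennreal" where
  "willmore_energy \<Omega> \<epsilon> u = (\<integral>\<^sup>+x. ennreal (willmore_density \<Omega> \<epsilon> u x) \<partial>lebesgue_on \<Omega>)"

definition total_energy ::
    "'a::euclidean_space set \<Rightarrow> real \<Rightarrow> ('a \<Rightarrow> real) \<Rightarrow> ennreal" where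
  "total_energy \<Omega> \<epsilon> u = willmore_energy \<Omega> \<epsilon> u + area_energy \<Omega> \<epsilon> u"

text \<open>
  Borel measures on the whole space: \<open>distr \<dots> borel id\<close> extends by zero outside \<open>\<Omega>\<close> and
  restricts from Lebesgue to Borel sets.
\<close>

definition area_measure ::
    "'a::euclidean_space set \<Rightarrow> real \<Rightarrow> ('a \<Rightarrow> real) \<Rightarrow> 'a measure" where
  "area_measure \<Omega> \<epsilon> u =
     distr (density (lebesgue_on \<Omega>) (\<lambda>x. ennreal (area_density \<Omega> \<epsilon> u x))) borel id"

definition willmore_measure ::
    "'a::euclidean_space set \<Rightarrow> real \<Rightarrow> ('a \<Rightarrow> real) \<Rightarrow> 'a measure" where
  "willmore_measure \<Omega> \<epsilon> u =
     distr (density (lebesgue_on \<Omega>) (\<lambda>x. ennreal (willmore_density \<Omega> \<epsilon> u x))) borel id"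

definition weak_star_conv ::
    "(nat \<Rightarrow> 'a::euclidean_space measure) \<Rightarrow> 'a measure \<Rightarrow> bool" where
  "weak_star_conv M N \<longleftrightarrow>
     (\<forall>f :: 'a \<Rightarrow> real. continuous_on UNIV f \<and> compact (closure {x. f x \<noteq> 0}) \<longrightarrow>
        (\<lambda>k. LINT x|M k. f x) \<longlonglongrightarrow> (LINT x|N. f x))"

text \<open>
  The family is indexed by a sequence \<open>eps\<close> of parameters, and \<open>u k\<close> is the function belonging to
  \<open>eps k\<close>. A finite Borel measure on a Euclidean space is automatically Radon.
\<close>

locale phase_field_family =
  fixes \<Omega> :: "'a::euclidean_space set"
    and eps :: "nat \<Rightarrow> real"
    and u :: "nat \<Rightarrow> 'a \<Rightarrow> real"
    and u0 :: "'a \<Rightarrow> real"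
    and \<mu> \<alpha> :: "'a measure"
  assumes open_domain: "open \<Omega>"
    and compact_closure_domain: "compact (closure \<Omega>)"
    and eps_pos: "\<And>k. 0 < eps k"
    and eps_tendsto: "eps \<longlonglongrightarrow> 0"
    and u_Sobolev: "\<And>k. u k \<in> W22 \<Omega>"
    and u_continuous: "\<And>k. continuous_on \<Omega> (u k)"
    and energy_bound: "limsup (\<lambda>k. total_energy \<Omega> (eps k) (u k)) < \<infinity>"
    and u0_L2: "u0 \<in> L2 \<Omega>"
    and u_tendsto: "(\<lambda>k. LINT x|lebesgue_on \<Omega>. (u k x - u0 x)\<^sup>2) \<longlonglongrightarrow> 0"
    and sets_mu: "sets \<mu> = sets borel"
    and finite_mu: "finite_measure \<mu>"
    and supp_mu: "emeasure \<mu> (- closure \<Omega>) = 0"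
    and sets_alpha: "sets \<alpha> = sets borel"
    and finite_alpha: "finite_measure \<alpha>"
    and supp_alpha: "emeasure \<alpha> (- closure \<Omega>) = 0"
    and conv_mu: "weak_star_conv (\<lambda>k. area_measure \<Omega> (eps k) (u k)) \<mu>"
    and conv_alpha: "weak_star_conv (\<lambda>k. willmore_measure \<Omega> (eps k) (u k)) \<alpha>"
    and mass_mu: "\<And>k. emeasure (area_measure \<Omega> (eps k) (u k)) UNIV \<le> emeasure \<mu> UNIV + 1"
    and mass_alpha:
      "\<And>k. emeasure (willmore_measure \<Omega> (eps k) (u k)) UNIV \<le> emeasure \<alpha> UNIV + 1"
    and boundary:
      "(\<exists>\<theta>\<ge>1. \<forall>k. abs_le_on_boundary \<Omega> (u k) \<theta>) \<or> (\<forall>k. zero_normal_deriv \<Omega> (u k))"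

definition overshoot_points ::
    "'a::euclidean_space set \<Rightarrow> (nat \<Rightarrow> 'a \<Rightarrow> real) \<Rightarrow> real \<Rightarrow> 'a set" where
  "overshoot_points \<Omega> u \<tau> =
     {x \<in> \<Omega>. \<exists>xs. (\<forall>k. xs k \<in> \<Omega>) \<and> xs \<longlonglongrightarrow> x \<and>
        limsup (\<lambda>k. ereal \<bar>u k (xs k)\<bar>) \<ge> ereal (1 + \<tau>)}"

end

theory Submission imports Defs begin

text \<open>
  A phase field cannot exceed the wells \<open>\<plusminus> 1\<close> by a fixed amount without paying a fixed amount of
  Willmore energy on every ball around the point. The reason is that the reaction term \<open>W'(u)\<close> pushes
  values outside \<open>[-1, 1]\<close> back exponentially fast on the length scale \<open>\<epsilon>\<close>, so only the forcing
  \<open>F = \<epsilon> \<Delta>u - W'(u) / \<epsilon>\<close> can sustain them; and in dimension three the resulting relation between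
  values and Willmore energy is invariant under scaling.
  
  In detail, let \<open>\<beta>(s) = sqrt (1 + s\<^sup>2) - sqrt 2\<close>. It is convex, \<open>\<bar>\<beta>'\<bar> \<le> 1\<close>,
  \<open>\<beta>' W' \<ge> 2 \<beta>\<close> and \<open>\<beta>\<^sup>2 \<le> W\<close>. Kato's inequality \<open>\<Delta>(\<beta>(u)) \<ge> \<beta>'(u) \<Delta>u\<close> therefore gives
  \<open>(l\<^sup>2 - \<Delta>) \<beta>(u) \<le> \<bar>F\<bar> / \<epsilon>\<close> for \<open>l = sqrt 2 / \<epsilon>\<close>. The fundamental solution of
  \<open>l\<^sup>2 - \<Delta>\<close> is the Yukawa kernel, a multiple of \<open>exp (- l \<bar>x - p\<bar>) / \<bar>x - p\<bar>\<close>. A regularised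
  and truncated version \<open>\<phi>\<close> of it, supported in the ball \<open>B\<close> with centre \<open>p\<close> and radius \<open>r\<close>, is
  used as test function (\<open>yukawa_kernel\<close>). Up to constants the result is
  \<open>\<beta>(u(p)) \<le> (1 / \<epsilon>) \<integral> \<bar>F\<bar> \<phi> + r\<^sup>-\<^sup>2 \<integral> \<bar>\<beta>(u)\<bar> K\<close>, with integrals over \<open>B\<close>, where \<open>K\<close> is a slightly larger
  Yukawa kernel and the second integral is due to the truncation. Now the integral of \<open>K\<^sup>2\<close> is of order
  \<open>\<epsilon>\<close> (\<open>yukawa_square_integral\<close>), that of \<open>F\<^sup>2\<close> is
  \<open>c0 \<epsilon>\<close> times the Willmore energy in \<open>B\<close>, and that of \<open>\<beta>(u)\<^sup>2 \<le> W(u)\<close> is of order \<open>\<epsilon>\<close> by the area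
  bound. Hence \<open>\<beta>(u(p))\<close> is at most a constant times the square root of the Willmore energy in \<open>B\<close>, plus
  \<open>O(\<epsilon>)\<close> for fixed \<open>r\<close> (\<open>interior_estimate\<close>). At a point where \<open>\<bar>u\<bar> \<ge> 1 + \<tau> / 2\<close> the left hand
  side is bounded below, and letting first \<open>\<epsilon>\<close> and then \<open>r\<close> tend to zero produces an atom of
  \<open>\<alpha>\<close>. Since \<open>\<alpha>\<close> is finite, it has only finitely many atoms of that size.
  
  As \<open>u\<close> is only in \<open>W22\<close>, Kato's inequality (\<open>kato_inequality\<close>) is proved for a mollification of \<open>u\<close> and with
  second differences in place of the Laplacian. The pointwise inequality is then mere convexity, and
  integration by parts is translation invariance.
\<close>

section \<open>Smooth compactly supported mollifiers\<close>

text \<open>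
  Smoothness on the real line is expressed as differentiability to every finite order: in this form the
  product and chain rules are inductions on the order.
\<close>

primrec differentiable_upto :: "nat \<Rightarrow> (real \<Rightarrow> real) \<Rightarrow> bool" where
  "differentiable_upto 0 f = True"
| "differentiable_upto (Suc n) f =
     (\<exists>f'. (\<forall>x. (f has_real_derivative f' x) (at x)) \<and> differentiable_upto n f')"

lemma differentiable_upto_Suc_D: "differentiable_upto (Suc n) f \<Longrightarrow> differentiable_upto n f"
proof (induction n arbitrary: f)
  case (Suc n)
  from Suc.prems obtain f' where d: "\<And>x. (f has_real_derivative f' x) (at x)" "differentiable_upto (Suc n) f'"
    unfolding differentiable_upto.simps(2)[of "Suc n"] by blast
  show ?case unfolding differentiable_upto.simps(2)[of n]
    by (intro exI[of _ f'] conjI allI d Suc.IH)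
qed simp

lemma differentiable_upto_add:
  "differentiable_upto n f \<Longrightarrow> differentiable_upto n g \<Longrightarrow> differentiable_upto n (\<lambda>x. f x + g x)"
proof (induction n arbitrary: f g)
  case (Suc n)
  then obtain f' g' where d:
    "\<And>x. (f has_real_derivative f' x) (at x)" "differentiable_upto n f'"
    "\<And>x. (g has_real_derivative g' x) (at x)" "differentiable_upto n g'"
    by auto
  show ?case unfolding differentiable_upto.simps
    by (rule exI[of _ "\<lambda>x. f' x + g' x"]) (intro conjI allI DERIV_add Suc.IH d)
qed simp

lemma differentiable_upto_mult:
  "differentiable_upto n f \<Longrightarrow> differentiable_upto n g \<Longrightarrow> differentiable_upto n (\<lambda>x. f x * g x)"
proof (induction n arbitrary: f g)
  case (Suc n)
  then obtain f' g' where d: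
    "\<And>x. (f has_real_derivative f' x) (at x)" "differentiable_upto n f'"
    "\<And>x. (g has_real_derivative g' x) (at x)" "differentiable_upto n g'"
    by auto
  have "differentiable_upto n (\<lambda>x. f' x * g x + f x * g' x)"
    by (intro differentiable_upto_add Suc.IH d differentiable_upto_Suc_D[OF Suc.prems(1)]
        differentiable_upto_Suc_D[OF Suc.prems(2)])
  moreover have "((\<lambda>x. f x * g x) has_real_derivative f' x * g x + f x * g' x) (at x)" for x
    using d(1)[of x] d(3)[of x] by (auto intro!: derivative_eq_intros)
  ultimately show ?case unfolding differentiable_upto.simps
    by (intro exI[of _ "\<lambda>x. f' x * g x + f x * g' x"] conjI allI)
qed simp

lemma differentiable_upto_const: "differentiable_upto n (\<lambda>x. c)"
proof (induction n arbitrary: c)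
  case (Suc n)
  then show ?case unfolding differentiable_upto.simps
    by (intro exI[of _ "\<lambda>x. 0"] conjI allI DERIV_const Suc)
qed simp

lemma differentiable_upto_affine:
  "differentiable_upto n f \<Longrightarrow> differentiable_upto n (\<lambda>x. f (a * x + b))"
proof (induction n arbitrary: f)
  case (Suc n)
  then obtain f' where d: "\<And>x. (f has_real_derivative f' x) (at x)" "differentiable_upto n f'"
    by auto
  have "differentiable_upto n (\<lambda>x. a * f' (a * x + b))"
    by (intro differentiable_upto_mult differentiable_upto_const Suc.IH d)
  moreover have "((\<lambda>x. f (a * x + b)) has_real_derivative a * f' (a * x + b)) (at x)" for x
  proof -
    have "((\<lambda>x. a * x + b) has_real_derivative a) (at x)"
      by (auto intro!: derivative_eq_intros)
    from DERIV_chain2[OF d(1) this] show ?thesis by (simp add: mult.commute)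
  qed
  ultimately show ?case unfolding differentiable_upto.simps
    by (intro exI[of _ "\<lambda>x. a * f' (a * x + b)"] conjI allI)
qed simp

text \<open>
  Up to an extra power of \<open>1 / t\<close>, this is the standard flat function \<open>exp (- 1 / t)\<close>. The powers
  make the family closed under differentiation, so that its smoothness is an induction.
\<close>

definition flat_exp :: "nat \<Rightarrow> real \<Rightarrow> real" where
  "flat_exp n t = (if t > 0 then (1 / t) ^ n * exp (- (1 / t)) else 0)"

lemma flat_exp_deriv:
  "(flat_exp n has_real_derivative - real n * flat_exp (Suc n) t + flat_exp (n + 2) t) (at t)"
proof -
  consider "t > 0" | "t < 0" | "t = 0" by linarith
  then show ?thesis
  proof cases
    case 1
    define p where "p = 1 / t"
    have inv: "((\<lambda>t. 1 / t) has_real_derivative - ((1 / t) * (1 / t))) (at t)"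
      using 1 by (auto intro!: derivative_eq_intros)
    have "((\<lambda>t. (1 / t) ^ n) has_real_derivative - real n * (1 / t) ^ Suc n) (at t)"
      by (rule DERIV_cong[OF DERIV_power[OF inv]], unfold p_def[symmetric], cases n)
        (simp_all add: algebra_simps)
    note pow = this
    have ex: "((\<lambda>t. exp (- (1 / t))) has_real_derivative exp (- (1 / t)) * ((1 / t) * (1 / t))) (at t)"
      by (rule derivative_eq_intros inv refl | simp)+
    have "((\<lambda>t. (1 / t) ^ n * exp (- (1 / t))) has_real_derivative
        - real n * flat_exp (Suc n) t + flat_exp (n + 2) t) (at t)"
      by (rule DERIV_cong[OF DERIV_mult[OF pow ex]])
        (use 1 in \<open>simp add: flat_exp_def p_def[symmetric] algebra_simps del: power_one_over\<close>)
    then show ?thesis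
      by (rule has_field_derivative_transform_within_open[where S = "{0<..}"])
        (use 1 in \<open>auto simp: flat_exp_def\<close>)
  next
    case 2
    have "((\<lambda>t::real. 0::real) has_real_derivative
        - real n * flat_exp (Suc n) t + flat_exp (n + 2) t) (at t)"
      using 2 by (auto simp: flat_exp_def)
    then show ?thesis
      by (rule has_field_derivative_transform_within_open[where S = "{..<0}"])
        (use 2 in \<open>auto simp: flat_exp_def\<close>)
  next
    case 3
    have "((\<lambda>h. flat_exp n h / h) \<longlongrightarrow> 0) (at_left 0)"
      by (rule tendsto_eventually) (auto simp: eventually_at_left_field flat_exp_def intro!: exI[of _ "-1"])
    moreover have "((\<lambda>h. flat_exp n h / h) \<longlongrightarrow> 0) (at_right 0)"
    proof (rule Lim_transform_eventually)
      have "filterlim (\<lambda>h::real. inverse h) at_top (at_right 0)"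
        by (rule filterlim_inverse_at_top_right)
      from filterlim_compose[OF tendsto_power_div_exp_0[of "Suc n"] this]
      show "((\<lambda>h::real. inverse h ^ Suc n / exp (inverse h)) \<longlongrightarrow> 0) (at_right 0)" .
      show "\<forall>\<^sub>F h in at_right 0. inverse h ^ Suc n / exp (inverse h) = flat_exp n h / h"
        by (auto simp: eventually_at_right_field flat_exp_def field_simps exp_minus intro!: exI[of _ 1])
    qed
    ultimately have "((\<lambda>h. flat_exp n h / h) \<longlongrightarrow> 0) (at 0)"
      by (rule filterlim_split_at)
    then show ?thesis using 3 by (simp add: DERIV_def flat_exp_def)
  qed
qed

lemma differentiable_upto_flat_exp: "differentiable_upto k (flat_exp n)"
proof (induction k arbitrary: n)
  case (Suc k)
  have "differentiable_upto k (\<lambda>t. - real n * flat_exp (Suc n) t + flat_exp (n + 2) t)"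
    using Suc by (intro differentiable_upto_add differentiable_upto_mult differentiable_upto_const)
  then show ?case unfolding differentiable_upto.simps
    by (intro exI[of _ "\<lambda>t. - real n * flat_exp (Suc n) t + flat_exp (n + 2) t"] conjI allI flat_exp_deriv)
qed simp

lemma smooth_1d_deriv:
  assumes "\<And>n. differentiable_upto n f"
  shows "(f has_real_derivative deriv f x) (at x)" "differentiable_upto n (deriv f)"
proof -
  obtain f' where d: "\<And>x. (f has_real_derivative f' x) (at x)" "differentiable_upto n f'"
    using assms[of "Suc n"] by auto
  have "f' = deriv f" using DERIV_imp_deriv[OF d(1)] by auto
  with d show "(f has_real_derivative deriv f x) (at x)" "differentiable_upto n (deriv f)" by auto
qed

lemma has_derivative_prod_coordinates:
  fixes c :: "'a::euclidean_space \<Rightarrow> real \<Rightarrow> real"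
  assumes "\<And>i n. differentiable_upto n (c i)"
  shows "((\<lambda>x. \<Prod>i\<in>Basis. c i (x \<bullet> i)) has_derivative
     (\<lambda>y. \<Sum>j\<in>Basis. (y \<bullet> j) * (\<Prod>i\<in>Basis. (c(j := deriv (c j))) i (x \<bullet> i)))) (at x)"
proof -
  have c: "((\<lambda>x. c i (x \<bullet> i)) has_derivative (\<lambda>y. (y \<bullet> i) * deriv (c i) (x \<bullet> i))) (at x)" for i
  proof -
    have "(c i has_derivative (\<lambda>y. y * deriv (c i) (x \<bullet> i))) (at (x \<bullet> i))"
      using smooth_1d_deriv(1)[OF assms, of i "x \<bullet> i"]
      by (simp add: has_field_derivative_def mult.commute[of _ "deriv (c i) (x \<bullet> i)"])
    moreover have "((\<lambda>x. x \<bullet> i) has_derivative (\<lambda>y. y \<bullet> i)) (at x)"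
      by (auto intro!: derivative_eq_intros)
    ultimately show ?thesis
      using has_derivative_compose by fastforce
  qed
  have "((\<lambda>x. \<Prod>i\<in>Basis. c i (x \<bullet> i)) has_derivative
     (\<lambda>y. \<Sum>j\<in>Basis. ((y \<bullet> j) * deriv (c j) (x \<bullet> j)) * (\<Prod>i\<in>Basis - {j}. c i (x \<bullet> i)))) (at x)"
    by (rule has_derivative_prod) (rule c)
  moreover have "((y \<bullet> j) * deriv (c j) (x \<bullet> j)) * (\<Prod>i\<in>Basis - {j}. c i (x \<bullet> i)) =
    (y \<bullet> j) * (\<Prod>i\<in>Basis. (c(j := deriv (c j))) i (x \<bullet> i))" if "j \<in> Basis" for j y
    using that by (subst (2) prod.remove[of _ j]) (auto simp: mult.assoc intro!: prod.cong)
  ultimately show ?thesis by simp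
qed

text \<open>
  Differentiating a product of one-variable functions of the coordinates replaces one factor by its
  derivative. Products of this shape are therefore stable under all iterated partial derivatives.
\<close>

lemma smooth_prod_coordinates:
  fixes c :: "'a::euclidean_space \<Rightarrow> real \<Rightarrow> real"
  assumes "\<And>i n. differentiable_upto n (c i)"
  shows "smooth (\<lambda>x. \<Prod>i\<in>Basis. c i (x \<bullet> i))"
proof -
  have *: "\<exists>c'. (\<forall>i n. differentiable_upto n (c' i)) \<and>
      foldr partial_deriv is (\<lambda>x. \<Prod>i\<in>Basis. c i (x \<bullet> i)) = (\<lambda>x. \<Prod>i\<in>Basis. c' i (x \<bullet> i))"
    if "set is \<subseteq> Basis" for "is"
    using that
  proof (induction "is")
    case Nil
    then show ?case using assms by (auto intro!: exI[of _ c])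
  next
    case (Cons j js)
    then obtain c' where c': "\<And>i n. differentiable_upto n (c' i)"
      "foldr partial_deriv js (\<lambda>x. \<Prod>i\<in>Basis. c i (x \<bullet> i)) = (\<lambda>x. \<Prod>i\<in>Basis. c' i (x \<bullet> i))"
      by auto
    have "partial_deriv j (\<lambda>x. \<Prod>i\<in>Basis. c' i (x \<bullet> i)) =
        (\<lambda>x. \<Prod>i\<in>Basis. (c'(j := deriv (c' j))) i (x \<bullet> i))"
    proof
      fix x
      have "partial_deriv j (\<lambda>x. \<Prod>i\<in>Basis. c' i (x \<bullet> i)) x =
        (\<Sum>k\<in>Basis. (j \<bullet> k) * (\<Prod>i\<in>Basis. (c'(k := deriv (c' k))) i (x \<bullet> i)))"
        unfolding partial_deriv_def
        using frechet_derivative_at[OF has_derivative_prod_coordinates[of c', OF c'(1)], symmetric] by simp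
      also have "\<dots> = (\<Sum>k\<in>Basis. if k = j then (\<Prod>i\<in>Basis. (c'(j := deriv (c' j))) i (x \<bullet> i)) else 0)"
        using Cons.prems by (intro sum.cong) (auto simp: inner_Basis)
      finally show "partial_deriv j (\<lambda>x. \<Prod>i\<in>Basis. c' i (x \<bullet> i)) x =
        (\<Prod>i\<in>Basis. (c'(j := deriv (c' j))) i (x \<bullet> i))"
        using Cons.prems by simp
    qed
    then show ?case
      using c' smooth_1d_deriv(2)[OF c'(1)] by (auto intro!: exI[of _ "c'(j := deriv (c' j))"])
  qed
  show ?thesis
    unfolding smooth_def
  proof (intro allI impI)
    fix "is" :: "'a list"
    assume "set is \<subseteq> Basis"
    from *[OF this] obtain c' where c': "\<And>i n. differentiable_upto n (c' i)"
      "foldr partial_deriv is (\<lambda>x. \<Prod>i\<in>Basis. c i (x \<bullet> i)) = (\<lambda>x. \<Prod>i\<in>Basis. c' i (x \<bullet> i))"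
      by auto
    show "foldr partial_deriv is (\<lambda>x. \<Prod>i\<in>Basis. c i (x \<bullet> i)) differentiable_on UNIV"
      unfolding c'(2) differentiable_on_def differentiable_def
      using has_derivative_prod_coordinates[of c', OF c'(1)] by blast
  qed
qed

text \<open>
  Needed in order to apply the definition of a weak derivative twice.
\<close>

lemma test_function_partial_deriv:
  assumes "test_function V \<psi>" "i \<in> Basis"
  shows "test_function V (partial_deriv i \<psi>)"
proof -
  have "smooth (partial_deriv i \<psi>)"
    unfolding smooth_def
  proof (intro allI impI)
    fix "is" :: "'a list"
    assume "set is \<subseteq> Basis"
    then have "set (is @ [i]) \<subseteq> Basis" using assms(2) by simp
    moreover have "smooth \<psi>" using assms(1) unfolding test_function_def by (rule conjunct1)
    ultimately have "foldr partial_deriv (is @ [i]) \<psi> differentiable_on UNIV"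
      unfolding smooth_def by (blast)
    then show "foldr partial_deriv is (partial_deriv i \<psi>) differentiable_on UNIV" by simp
  qed
  moreover have "{x. partial_deriv i \<psi> x \<noteq> 0} \<subseteq> closure {x. \<psi> x \<noteq> 0}"
  proof (rule ccontr)
    assume "\<not> ?thesis"
    then obtain x where x: "partial_deriv i \<psi> x \<noteq> 0" "x \<in> - closure {x. \<psi> x \<noteq> 0}" by auto
    have "((\<lambda>x. 0) has_derivative (\<lambda>_. 0)) (at x)" by simp
    then have "(\<psi> has_derivative (\<lambda>_. 0)) (at x)"
    proof (rule has_derivative_transform_within_open)
      show "open (- closure {x. \<psi> x \<noteq> 0})" by (simp only: open_Compl closed_closure)
      show "x \<in> - closure {x. \<psi> x \<noteq> 0}" by (rule x(2))
      show "0 = \<psi> y" if "y \<in> - closure {x. \<psi> x \<noteq> 0}" for y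
        using that closure_subset[of "{x. \<psi> x \<noteq> 0}"] by auto
    qed
    then show False using x(1) unfolding partial_deriv_def
      by (metis frechet_derivative_at)
  qed
  then have "closure {x. partial_deriv i \<psi> x \<noteq> 0} \<subseteq> closure {x. \<psi> x \<noteq> 0}"
    by (simp add: closure_minimal)
  ultimately show ?thesis
    using assms(1) unfolding test_function_def
    by (auto simp: compact_eq_bounded_closed intro: bounded_subset)
qed

text \<open>
  A product of one-variable bumps; it is positive exactly on the cube with half side length \<open>1 / M\<close>.
\<close>

definition bump :: "real \<Rightarrow> 'a::euclidean_space \<Rightarrow> real" where
  "bump M x = (\<Prod>i\<in>Basis. flat_exp 0 (1 + M * (x \<bullet> i)) * flat_exp 0 (1 - M * (x \<bullet> i)))"

lemma smooth_bump: "smooth (\<lambda>y. a * bump M (y - x))"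
proof -
  obtain j :: 'a where j: "j \<in> Basis" using nonempty_Basis by blast
  let ?f = "\<lambda>i t. flat_exp 0 (M * t + (1 - M * (x \<bullet> i))) * flat_exp 0 ((- M) * t + (1 + M * (x \<bullet> i)))"
  let ?c = "\<lambda>i t. (if i = j then a else 1) * ?f i t"
  have "smooth (\<lambda>y. \<Prod>i\<in>Basis. ?c i (y \<bullet> i))"
    by (rule smooth_prod_coordinates)
      (intro differentiable_upto_mult differentiable_upto_const
        differentiable_upto_affine[OF differentiable_upto_flat_exp])
  moreover have "(\<Prod>i\<in>Basis. ?c i (y \<bullet> i)) = a * bump M (y - x)" for y
  proof -
    have "(\<Prod>i\<in>Basis. ?c i (y \<bullet> i)) = (\<Prod>i\<in>Basis. if i = j then a else 1) * (\<Prod>i\<in>Basis. ?f i (y \<bullet> i))"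
      by (simp only: prod.distrib)
    also have "(\<Prod>i\<in>Basis. if i = j then a else 1) = a" using j by simp
    also have "(\<Prod>i\<in>Basis. ?f i (y \<bullet> i)) = bump M (y - x)"
      unfolding bump_def by (intro prod.cong) (auto simp: algebra_simps)
    finally show ?thesis .
  qed
  ultimately show ?thesis by simp
qed

lemma smooth_imp_continuous: "smooth (f :: 'a::euclidean_space \<Rightarrow> real) \<Longrightarrow> continuous_on UNIV f"
proof -
  assume "smooth f"
  then have "set [] \<subseteq> (Basis :: 'a set) \<longrightarrow> foldr partial_deriv [] f differentiable_on UNIV"
    unfolding smooth_def by blast
  then show ?thesis by (simp add: differentiable_imp_continuous_on)
qed

text \<open>
  The mollifiers are even, which makes convolution with them a symmetric operator.
\<close>

lemma exists_mollifier:
  assumes "e > 0"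
  obtains \<rho> :: "'a::euclidean_space \<Rightarrow> real" where
    "\<And>x. smooth (\<lambda>y. \<rho> (y - x))" "\<And>x. \<rho> x \<ge> 0" "\<And>x. norm x \<ge> e \<Longrightarrow> \<rho> x = 0"
    "\<And>x. \<rho> (- x) = \<rho> x" "integrable lborel \<rho>" "(LINT x|lborel. \<rho> x) = 1"
proof -
  define M where "M = real DIM('a) * 2 / e"
  have M: "M > 0" using assms by (simp add: M_def)
  have nn: "flat_exp 0 t \<ge> 0" for t by (simp add: flat_exp_def)
  have b0: "bump M x \<ge> 0" for x :: 'a
    unfolding bump_def by (intro prod_nonneg) (simp add: nn)
  have supp: "bump M x = 0" if "norm x \<ge> e / 2" for x :: 'a
  proof -
    have "\<exists>i\<in>Basis. \<bar>x \<bullet> i\<bar> \<ge> 1 / M"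
    proof (rule ccontr)
      assume "\<not> ?thesis"
      then have "\<And>i. i \<in> Basis \<Longrightarrow> \<bar>x \<bullet> i\<bar> < 1 / M" by force
      then have "norm x < real DIM('a) * (1 / M)"
        using norm_le_l1[of x] sum_strict_mono[of Basis "\<lambda>i. \<bar>x \<bullet> i\<bar>" "\<lambda>_. 1 / M"] by simp
      with that show False by (simp add: M_def)
    qed
    then obtain i where i: "i \<in> Basis" "\<bar>x \<bullet> i\<bar> \<ge> 1 / M" by auto
    then have "\<bar>M * (x \<bullet> i)\<bar> \<ge> 1" using M by (simp add: abs_mult field_simps)
    then have "flat_exp 0 (1 + M * (x \<bullet> i)) * flat_exp 0 (1 - M * (x \<bullet> i)) = 0"
      by (auto simp: flat_exp_def)
    then show ?thesis unfolding bump_def using i(1) by (subst prod_zero_iff) auto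
  qed
  have cont: "continuous_on UNIV (bump M :: 'a \<Rightarrow> real)"
    using smooth_imp_continuous[OF smooth_bump[of 1 M 0]] by simp
  have "integrable lborel (\<lambda>x::'a. indicator (cball 0 e) x *\<^sub>R bump M x)"
    by (rule borel_integrable_compact) (auto intro: continuous_on_subset[OF cont])
  moreover have "(\<lambda>x::'a. indicator (cball 0 e) x *\<^sub>R bump M x) = bump M"
    using supp assms by (auto simp: fun_eq_iff indicator_def)
  ultimately have int: "integrable lborel (bump M :: 'a \<Rightarrow> real)" by simp
  define I where "I = (LINT x|lborel. bump M (x::'a))"
  have "I \<ge> 0" unfolding I_def using b0 by simp
  moreover have "I \<noteq> 0"
  proof
    assume "I = 0"
    then have "AE x::'a in lborel. bump M x = 0"
      using integral_nonneg_eq_0_iff_AE[OF int] b0 by (simp add: I_def)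
    then have "AE x::'a in lebesgue. bump M x = 0" by (rule AE_completion)
    moreover have "open {x::'a. bump M x \<noteq> 0}"
      by (rule open_Collect_neq[OF cont continuous_on_const])
    moreover from this have "{x::'a. bump M x \<noteq> 0} \<in> sets lebesgue"
      by (simp add: sets_completionI_sets)
    ultimately have "{x::'a. bump M x \<noteq> 0} \<in> null_sets lebesgue"
      by (subst (asm) AE_iff_null) auto
    moreover have "open {x::'a. bump M x \<noteq> 0}"
      by (rule open_Collect_neq[OF cont continuous_on_const])
    moreover have "bump M (0::'a) \<noteq> 0"
      unfolding bump_def by (simp add: flat_exp_def)
    then have "{x::'a. bump M x \<noteq> 0} \<noteq> {}" by blast
    ultimately show False
      using open_not_negligible[of "{x::'a. bump M x \<noteq> 0}"]
      unfolding negligible_iff_null_sets by blast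
  qed
  ultimately have I: "I > 0" by simp
  show ?thesis
  proof (rule that[of "\<lambda>x. (1 / I) * bump M x"])
    show "smooth (\<lambda>y. 1 / I * bump M (y - x))" for x :: 'a by (rule smooth_bump)
    show "0 \<le> 1 / I * bump M x" for x :: 'a using I b0 by simp
    show "1 / I * bump M x = 0" if "e \<le> norm x" for x :: 'a using supp that assms by simp
    show "1 / I * bump M (- x) = 1 / I * bump M x" for x :: 'a
      by (simp add: bump_def mult.commute)
    show "integrable lborel (\<lambda>x::'a. 1 / I * bump M x)" using int by simp
    show "(LINT x|lborel. 1 / I * bump M (x::'a)) = 1"
      using I by (simp add: I_def[symmetric])
  qed
qed

section \<open>Second differences\<close>

text \<open>
  The discrete Laplacian with step \<open>h\<close>.
\<close>

definition second_difference :: "real \<Rightarrow> ('a::euclidean_space \<Rightarrow> real) \<Rightarrow> 'a \<Rightarrow> real" where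
  "second_difference h f x =
     (\<Sum>i\<in>Basis. (f (x + h *\<^sub>R i) + f (x - h *\<^sub>R i) - 2 * f x) / h\<^sup>2)"

text \<open>
  Twice continuously differentiable functions supported in the compact set \<open>K\<close>, together with their
  Laplacian \<open>L\<close>. Only derivatives along the coordinate axes enter, because these determine the limit of
  the discrete Laplacian.
\<close>

definition C2_compact :: "'a::euclidean_space set \<Rightarrow> ('a \<Rightarrow> real) \<Rightarrow> ('a \<Rightarrow> real) \<Rightarrow> bool" where
  "C2_compact K \<phi> L \<longleftrightarrow> compact K \<and> continuous_on UNIV \<phi> \<and> (\<forall>x. x \<notin> K \<longrightarrow> \<phi> x = 0) \<and>
     (\<exists>d1 d2. (\<forall>i\<in>Basis.
          (\<forall>x. ((\<lambda>t. \<phi> (x + t *\<^sub>R i)) has_real_derivative d1 i x) (at 0)) \<and>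
          (\<forall>x. ((\<lambda>t. d1 i (x + t *\<^sub>R i)) has_real_derivative d2 i x) (at 0)) \<and>
          continuous_on UNIV (d2 i)) \<and>
        L = (\<lambda>x. \<Sum>i\<in>Basis. d2 i x))"

definition laplacian :: "('a::euclidean_space \<Rightarrow> real) \<Rightarrow> 'a \<Rightarrow> real" where
  "laplacian \<psi> x = (\<Sum>i\<in>Basis. partial_deriv i (partial_deriv i \<psi>) x)"

lemma second_difference_1d:
  fixes f :: "real \<Rightarrow> real"
  assumes "\<And>t. (f has_real_derivative f' t) (at t)" "\<And>t. (f' has_real_derivative f'' t) (at t)"
  shows "\<exists>s1 s2. \<bar>s1\<bar> \<le> \<bar>h\<bar> \<and> \<bar>s2\<bar> \<le> \<bar>h\<bar> \<and> f h + f (- h) - 2 * f 0 = (f'' s1 + f'' s2) / 2 * h\<^sup>2"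
proof -
  define D where "D m = (if m = 0 then f else if m = Suc 0 then f' else f'')" for m :: nat
  have D: "\<forall>m t. m < 2 \<and> \<bar>t\<bar> \<le> \<bar>x\<bar> \<longrightarrow> (D m has_real_derivative D (Suc m) t) (at t)" for x
    using assms by (auto simp: D_def less_2_cases_iff)
  have "\<exists>s. \<bar>s\<bar> \<le> \<bar>x\<bar> \<and> f x = f 0 + f' 0 * x + f'' s / 2 * x\<^sup>2" for x
    using Maclaurin_bi_le[OF _ D, of f x] by (simp add: D_def numeral_2_eq_2)
  from this[of h] this[of "- h"] obtain s1 s2 where
    "\<bar>s1\<bar> \<le> \<bar>h\<bar>" "f h = f 0 + f' 0 * h + f'' s1 / 2 * h\<^sup>2"
    "\<bar>s2\<bar> \<le> \<bar>h\<bar>" "f (- h) = f 0 + f' 0 * (- h) + f'' s2 / 2 * h\<^sup>2"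
    by auto
  then show ?thesis
    by (intro exI[of _ s1] exI[of _ s2]) (simp add: algebra_simps)
qed

lemma directional_derivative_vanishes:
  fixes f :: "'a::euclidean_space \<Rightarrow> real"
  assumes "closed K" "x \<notin> K" "\<And>x. x \<notin> K \<Longrightarrow> f x = 0"
    and "((\<lambda>t. f (x + t *\<^sub>R i)) has_real_derivative d) (at 0)"
  shows "d = 0"
proof -
  have "open ((\<lambda>t::real. x + t *\<^sub>R i) -` (- K))"
    by (intro open_vimage open_Compl assms continuous_intros)
  moreover have "((\<lambda>t::real. 0::real) has_real_derivative 0) (at 0)" by simp
  ultimately have "((\<lambda>t. f (x + t *\<^sub>R i)) has_real_derivative 0) (at 0)"
    using assms(2,3) by (auto elim: has_field_derivative_transform_within_open[rotated])
  then show ?thesis using assms(4) DERIV_unique by blast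
qed

lemma continuous_compact_support_bounded:
  fixes f :: "'a::euclidean_space \<Rightarrow> real"
  assumes "compact K" "continuous_on UNIV f" "\<And>x. x \<notin> K \<Longrightarrow> f x = 0"
  obtains C where "\<And>x. \<bar>f x\<bar> \<le> C"
proof -
  have "bounded (f ` K)"
    using assms by (intro compact_imp_bounded compact_continuous_image continuous_on_subset[OF assms(2)]) auto
  then obtain C where "\<forall>x\<in>K. \<bar>f x\<bar> \<le> C" by (auto simp: bounded_iff)
  then have "\<bar>f x\<bar> \<le> max C 0" for x using assms(3)[of x] by (cases "x \<in> K") fastforce+
  then show ?thesis using that by blast
qed

lemma continuous_compact_support_integrable:
  fixes f :: "'a::euclidean_space \<Rightarrow> real"
  assumes "compact K" "continuous_on UNIV f" "\<And>x. x \<notin> K \<Longrightarrow> f x = 0"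
  shows "integrable lborel f"
proof -
  have "integrable lborel (\<lambda>x. indicator K x *\<^sub>R f x)"
    by (rule borel_integrable_compact) (auto intro: assms continuous_on_subset[OF assms(2)])
  moreover have "(\<lambda>x. indicator K x *\<^sub>R f x) = f"
    using assms(3) by (auto simp: fun_eq_iff indicator_def)
  ultimately show ?thesis by simp
qed

lemma C2_compactE:
  assumes "C2_compact K \<phi> L"
  obtains d1 d2 where "compact K" "\<And>x. x \<notin> K \<Longrightarrow> \<phi> x = 0"
    "\<And>i x. i \<in> Basis \<Longrightarrow> ((\<lambda>t. \<phi> (x + t *\<^sub>R i)) has_real_derivative d1 i x) (at 0)"
    "\<And>i x. i \<in> Basis \<Longrightarrow> ((\<lambda>t. d1 i (x + t *\<^sub>R i)) has_real_derivative d2 i x) (at 0)"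
    "\<And>i. i \<in> Basis \<Longrightarrow> continuous_on UNIV (d2 i)" "L = (\<lambda>x. \<Sum>i\<in>Basis. d2 i x)"
    "\<And>i x. i \<in> Basis \<Longrightarrow> x \<notin> K \<Longrightarrow> d2 i x = 0"
proof -
  obtain d1 d2 where d: "compact K" "\<And>x. x \<notin> K \<Longrightarrow> \<phi> x = 0"
    "\<And>i x. i \<in> Basis \<Longrightarrow> ((\<lambda>t. \<phi> (x + t *\<^sub>R i)) has_real_derivative d1 i x) (at 0)"
    "\<And>i x. i \<in> Basis \<Longrightarrow> ((\<lambda>t. d1 i (x + t *\<^sub>R i)) has_real_derivative d2 i x) (at 0)"
    "\<And>i. i \<in> Basis \<Longrightarrow> continuous_on UNIV (d2 i)" "L = (\<lambda>x. \<Sum>i\<in>Basis. d2 i x)"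
    using assms unfolding C2_compact_def by blast
  have d1: "d1 i x = 0" if "i \<in> Basis" "x \<notin> K" for i x
    by (rule directional_derivative_vanishes[OF compact_imp_closed[OF d(1)] that(2) d(2) d(3)[OF that(1)]])
  have "d2 i x = 0" if "i \<in> Basis" "x \<notin> K" for i x
    by (rule directional_derivative_vanishes[OF compact_imp_closed[OF d(1)] that(2) d1[OF that(1)] d(4)[OF that(1)]])
  then show ?thesis using that d by blast
qed

lemma C2_compact_laplacian:
  assumes "C2_compact K \<phi> L"
  shows "continuous_on UNIV L" "\<And>x. x \<notin> K \<Longrightarrow> L x = 0"
proof -
  from assms obtain d1 d2 where d: "compact K" "\<And>x. x \<notin> K \<Longrightarrow> \<phi> x = 0"
    "\<And>i x. i \<in> Basis \<Longrightarrow> ((\<lambda>t. \<phi> (x + t *\<^sub>R i)) has_real_derivative d1 i x) (at 0)"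
    "\<And>i x. i \<in> Basis \<Longrightarrow> ((\<lambda>t. d1 i (x + t *\<^sub>R i)) has_real_derivative d2 i x) (at 0)"
    "\<And>i. i \<in> Basis \<Longrightarrow> continuous_on UNIV (d2 i)" "L = (\<lambda>x. \<Sum>i\<in>Basis. d2 i x)"
    and d2: "\<And>i x. i \<in> Basis \<Longrightarrow> x \<notin> K \<Longrightarrow> d2 i x = 0"
    by (rule C2_compactE) blast
  show "continuous_on UNIV L" unfolding d(6) by (intro continuous_intros d(5))
  show "L x = 0" if "x \<notin> K" for x unfolding d(6) using d2 that by simp
qed

text \<open>
  By Taylor's theorem on each coordinate line, a second difference quotient is an average of two values
  of the second derivative. This provides both the domination and the pointwise limit for passing from
  discrete to true Laplacians under integrals.
\<close>

lemma second_difference_bounded_convergent: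
  assumes "C2_compact K \<phi> L"
  obtains C where "\<And>h x. h \<noteq> 0 \<Longrightarrow> \<bar>second_difference h \<phi> x\<bar> \<le> C"
    and "\<And>x. (\<lambda>j. second_difference (1 / Suc j) \<phi> x) \<longlonglongrightarrow> L x"
proof -
  from assms obtain d1 d2 where d: "compact K" "\<And>x. x \<notin> K \<Longrightarrow> \<phi> x = 0"
    "\<And>i x. i \<in> Basis \<Longrightarrow> ((\<lambda>t. \<phi> (x + t *\<^sub>R i)) has_real_derivative d1 i x) (at 0)"
    "\<And>i x. i \<in> Basis \<Longrightarrow> ((\<lambda>t. d1 i (x + t *\<^sub>R i)) has_real_derivative d2 i x) (at 0)"
    "\<And>i. i \<in> Basis \<Longrightarrow> continuous_on UNIV (d2 i)" "L = (\<lambda>x. \<Sum>i\<in>Basis. d2 i x)"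
    and d2: "\<And>i x. i \<in> Basis \<Longrightarrow> x \<notin> K \<Longrightarrow> d2 i x = 0"
    by (rule C2_compactE) blast
  have shift: "((\<lambda>t. f (x + t *\<^sub>R i)) has_real_derivative f' (x + s *\<^sub>R i)) (at s)"
    if "\<And>x. ((\<lambda>t. f (x + t *\<^sub>R i)) has_real_derivative f' x) (at 0)" for f f' :: "'a \<Rightarrow> real" and x i s
    using that[of "x + s *\<^sub>R i"] DERIV_shift[of "\<lambda>t. f (x + t *\<^sub>R i)" "f' (x + s *\<^sub>R i)" 0 s]
    by (simp add: algebra_simps)
  have mean: "\<exists>s1 s2. \<bar>s1\<bar> \<le> \<bar>h\<bar> \<and> \<bar>s2\<bar> \<le> \<bar>h\<bar> \<and>
      (\<phi> (x + h *\<^sub>R i) + \<phi> (x - h *\<^sub>R i) - 2 * \<phi> x) / h\<^sup>2 = (d2 i (x + s1 *\<^sub>R i) + d2 i (x + s2 *\<^sub>R i)) / 2"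
    if "i \<in> Basis" "h \<noteq> 0" for i x h
  proof -
    from second_difference_1d[OF shift[OF d(3)[OF that(1)]] shift[OF d(4)[OF that(1)]], of h x]
    obtain s1 s2 where s: "\<bar>s1\<bar> \<le> \<bar>h\<bar>" "\<bar>s2\<bar> \<le> \<bar>h\<bar>"
      "\<phi> (x + h *\<^sub>R i) + \<phi> (x - h *\<^sub>R i) - 2 * \<phi> x = (d2 i (x + s1 *\<^sub>R i) + d2 i (x + s2 *\<^sub>R i)) / 2 * h\<^sup>2"
      by auto
    then show ?thesis using that(2) by (intro exI[of _ s1] exI[of _ s2]) (simp add: field_simps)
  qed
  have "\<exists>C. \<forall>x. \<bar>d2 i x\<bar> \<le> C" if "i \<in> Basis" for i
    using continuous_compact_support_bounded[OF d(1) d(5)[OF that] d2[OF that]] by metis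
  then obtain C where C: "\<And>i x. i \<in> Basis \<Longrightarrow> \<bar>d2 i x\<bar> \<le> C i" by metis
  show ?thesis
  proof
    fix h :: real and x
    assume h: "h \<noteq> 0"
    have "\<bar>(\<phi> (x + h *\<^sub>R i) + \<phi> (x - h *\<^sub>R i) - 2 * \<phi> x) / h\<^sup>2\<bar> \<le> C i" if i: "i \<in> Basis" for i
    proof -
      from mean[OF i h, of x] obtain s1 s2 where s:
        "(\<phi> (x + h *\<^sub>R i) + \<phi> (x - h *\<^sub>R i) - 2 * \<phi> x) / h\<^sup>2 = (d2 i (x + s1 *\<^sub>R i) + d2 i (x + s2 *\<^sub>R i)) / 2"
        by blast
      show ?thesis unfolding s
        using C[OF i, of "x + s1 *\<^sub>R i"] C[OF i, of "x + s2 *\<^sub>R i"] by (simp add: abs_le_iff)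
    qed
    then show "\<bar>second_difference h \<phi> x\<bar> \<le> (\<Sum>i\<in>Basis. C i)"
      unfolding second_difference_def by (intro order.trans[OF sum_abs] sum_mono)
  next
    fix x
    have "(\<lambda>j. (\<phi> (x + (1 / Suc j) *\<^sub>R i) + \<phi> (x - (1 / Suc j) *\<^sub>R i) - 2 * \<phi> x) / (1 / Suc j)\<^sup>2) \<longlonglongrightarrow> d2 i x"
      if i: "i \<in> Basis" for i
    proof -
      have "\<forall>j. \<exists>s1 s2. \<bar>s1\<bar> \<le> \<bar>1 / Suc j\<bar> \<and> \<bar>s2\<bar> \<le> \<bar>1 / Suc j\<bar> \<and>
        (\<phi> (x + (1 / Suc j) *\<^sub>R i) + \<phi> (x - (1 / Suc j) *\<^sub>R i) - 2 * \<phi> x) / (1 / Suc j)\<^sup>2 =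
        (d2 i (x + s1 *\<^sub>R i) + d2 i (x + s2 *\<^sub>R i)) / 2"
        by (intro allI mean i) simp
      then obtain s1 s2 :: "nat \<Rightarrow> real" where s: "\<And>j. \<bar>s1 j\<bar> \<le> \<bar>1 / Suc j\<bar>" "\<And>j. \<bar>s2 j\<bar> \<le> \<bar>1 / Suc j\<bar>"
        "\<And>j. (\<phi> (x + (1 / Suc j) *\<^sub>R i) + \<phi> (x - (1 / Suc j) *\<^sub>R i) - 2 * \<phi> x) / (1 / Suc j)\<^sup>2 =
        (d2 i (x + s1 j *\<^sub>R i) + d2 i (x + s2 j *\<^sub>R i)) / 2"
        by metis
      have lim: "(\<lambda>j. d2 i (x + f j *\<^sub>R i)) \<longlonglongrightarrow> d2 i x" if "\<And>j. \<bar>f j\<bar> \<le> \<bar>1 / Suc j\<bar>" for f :: "nat \<Rightarrow> real"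
      proof -
        have "f \<longlonglongrightarrow> 0"
          by (rule Lim_null_comparison[OF _ LIMSEQ_inverse_real_of_nat])
            (use that in \<open>auto simp: inverse_eq_divide\<close>)
        then have "(\<lambda>j. x + f j *\<^sub>R i) \<longlonglongrightarrow> x + 0 *\<^sub>R i"
          by (intro tendsto_intros)
        moreover have "isCont (d2 i) x"
          using d(5)[OF i] by (simp add: continuous_on_eq_continuous_at)
        ultimately show ?thesis by (intro isCont_tendsto_compose[of x "d2 i"]) simp_all
      qed
      have "(\<lambda>j. (d2 i (x + s1 j *\<^sub>R i) + d2 i (x + s2 j *\<^sub>R i)) / 2) \<longlonglongrightarrow> (d2 i x + d2 i x) / 2"
        by (intro tendsto_intros lim s) simp
      then show ?thesis unfolding s(3) by simp
    qed
    then show "(\<lambda>j. second_difference (1 / Suc j) \<phi> x) \<longlonglongrightarrow> L x"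
      unfolding second_difference_def d(6) by (intro tendsto_sum)
  qed
qed

lemma test_function_C2_compact:
  assumes "test_function V \<psi>"
  shows "C2_compact (closure {x. \<psi> x \<noteq> 0}) \<psi> (laplacian \<psi>)"
proof -
  have dir: "((\<lambda>t. f (x + t *\<^sub>R i)) has_real_derivative partial_deriv i f x) (at 0)"
    if "smooth f" for f :: "'a \<Rightarrow> real" and i x
  proof -
    have "set [] \<subseteq> (Basis :: 'a set) \<longrightarrow> foldr partial_deriv [] f differentiable_on UNIV"
      using that unfolding smooth_def by blast
    then have "f differentiable (at x)" by (simp add: differentiable_on_def)
    then have f: "(f has_derivative frechet_derivative f (at x)) (at (x + 0 *\<^sub>R i))"
      by (simp add: frechet_derivative_works)
    have "((\<lambda>t. x + t *\<^sub>R i) has_derivative (\<lambda>t. t *\<^sub>R i)) (at (0::real))"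
      by (auto intro!: derivative_eq_intros)
    from has_derivative_compose[OF this f]
    have "((\<lambda>t. f (x + t *\<^sub>R i)) has_derivative (\<lambda>t. frechet_derivative f (at x) (t *\<^sub>R i))) (at 0)" .
    moreover have "frechet_derivative f (at x) (t *\<^sub>R i) = frechet_derivative f (at x) i * t" for t
      using linear_frechet_derivative[OF \<open>f differentiable (at x)\<close>] by (simp add: linear_scale)
    ultimately show ?thesis by (simp add: has_field_derivative_def partial_deriv_def)
  qed
  have sm: "smooth f" if "test_function V f" for f using that by (simp add: test_function_def)
  have t: "test_function V (partial_deriv i \<psi>)" "test_function V (partial_deriv i (partial_deriv i \<psi>))"
    if "i \<in> Basis" for i
    using that assms by (simp_all add: test_function_partial_deriv)
  show ?thesis
    unfolding C2_compact_def
  proof (intro conjI)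
    show "compact (closure {x. \<psi> x \<noteq> 0})" using assms by (simp add: test_function_def)
    show "continuous_on UNIV \<psi>" by (intro smooth_imp_continuous sm assms)
    show "\<forall>x. x \<notin> closure {x. \<psi> x \<noteq> 0} \<longrightarrow> \<psi> x = 0"
      using closure_subset[of "{x. \<psi> x \<noteq> 0}"] by auto
    show "\<exists>d1 d2. (\<forall>i\<in>Basis.
          (\<forall>x. ((\<lambda>t. \<psi> (x + t *\<^sub>R i)) has_real_derivative d1 i x) (at 0)) \<and>
          (\<forall>x. ((\<lambda>t. d1 i (x + t *\<^sub>R i)) has_real_derivative d2 i x) (at 0)) \<and>
          continuous_on UNIV (d2 i)) \<and> laplacian \<psi> = (\<lambda>x. \<Sum>i\<in>Basis. d2 i x)"
      by (rule exI[of _ "\<lambda>i. partial_deriv i \<psi>"], rule exI[of _ "\<lambda>i. partial_deriv i (partial_deriv i \<psi>)"])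
        (intro conjI ballI allI ext laplacian_def dir sm t smooth_imp_continuous assms; assumption)
  qed
qed

lemma lborel_integral_shift:
  fixes f :: "'a::euclidean_space \<Rightarrow> real"
  assumes [measurable]: "f \<in> borel_measurable borel"
  shows "(LINT x|lborel. f (x + c)) = (LINT x|lborel. f x)"
    and "integrable lborel (\<lambda>x. f (x + c)) \<longleftrightarrow> integrable lborel f"
proof -
  have "(LINT x|distr lborel borel ((+) c). f x) = (LINT x|lborel. f (c + x))"
    by (rule integral_distr) auto
  then show "(LINT x|lborel. f (x + c)) = (LINT x|lborel. f x)"
    by (simp add: lborel_distr_plus add.commute)
  have "integrable (distr lborel borel ((+) c)) f \<longleftrightarrow> integrable lborel (\<lambda>x. f (c + x))"
    by (rule integrable_distr_eq) auto
  then show "integrable lborel (\<lambda>x. f (x + c)) \<longleftrightarrow> integrable lborel f"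
    by (simp add: lborel_distr_plus add.commute)
qed

lemma integrable_mult_bounded:
  fixes f g :: "'a \<Rightarrow> real"
  assumes "integrable M f" "g \<in> borel_measurable M" "\<And>x. \<bar>g x\<bar> \<le> C"
  shows "integrable M (\<lambda>x. g x * f x)"
proof (rule Bochner_Integration.integrable_bound)
  show "integrable M (\<lambda>x. C * f x)" using assms by simp
  show "(\<lambda>x. g x * f x) \<in> borel_measurable M" using assms by measurable
  have "\<bar>g x\<bar> * \<bar>f x\<bar> \<le> \<bar>C\<bar> * \<bar>f x\<bar>" for x
    using assms(3)[of x] by (intro mult_right_mono) auto
  then show "AE x in M. norm (g x * f x) \<le> norm (C * f x)" by (simp add: abs_mult)
qed

text \<open>
  Summation by parts for the discrete Laplacian is just the translation invariance of Lebesgue measure.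
\<close>

lemma second_difference_symmetric:
  fixes v \<phi> :: "'a::euclidean_space \<Rightarrow> real"
  assumes v[measurable]: "v \<in> borel_measurable borel" and B: "\<And>x. \<bar>v x\<bar> \<le> B" and int: "integrable lborel \<phi>"
  shows "(LINT x|lborel. v x * second_difference h \<phi> x) = (LINT x|lborel. second_difference h v x * \<phi> x)"
    and "integrable lborel (\<lambda>x. v x * second_difference h \<phi> x)"
    and "integrable lborel (\<lambda>x. second_difference h v x * \<phi> x)"
proof -
  have \<phi>[measurable]: "\<phi> \<in> borel_measurable borel" using int by (simp add: integrable_iff_bounded)
  have i1: "integrable lborel (\<lambda>x. v x * \<phi> (x + c))" for c
    by (rule integrable_mult_bounded[OF _ _ B]) (use int in \<open>simp_all add: lborel_integral_shift\<close>)
  have i1': "integrable lborel (\<lambda>x. v x * \<phi> (x - c))" for c using i1[of "- c"] by simp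
  have i0: "integrable lborel (\<lambda>x. v x * \<phi> x)" using i1[of 0] by simp
  have i2: "integrable lborel (\<lambda>x. v (x + c) * \<phi> x)" for c
    by (rule integrable_mult_bounded[OF _ _ B]) (use int in \<open>simp_all\<close>)
  have i2': "integrable lborel (\<lambda>x. v (x - c) * \<phi> x)" for c using i2[of "- c"] by simp
  have s: "(LINT x|lborel. v x * \<phi> (x + c)) = (LINT x|lborel. v (x - c) * \<phi> x)" for c
    using lborel_integral_shift(1)[of "\<lambda>x. v (x - c) * \<phi> x" c] by simp
  have s': "(LINT x|lborel. v x * \<phi> (x - c)) = (LINT x|lborel. v (x + c) * \<phi> x)" for c
    using s[of "- c"] by simp
  have e1: "v x * second_difference h \<phi> x =
    (\<Sum>i\<in>Basis. (v x * \<phi> (x + h *\<^sub>R i) + v x * \<phi> (x - h *\<^sub>R i) - 2 * (v x * \<phi> x)) / h\<^sup>2)" for x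
    unfolding second_difference_def sum_distrib_left by (intro sum.cong refl) (simp add: field_simps)
  have e2: "second_difference h v x * \<phi> x =
    (\<Sum>i\<in>Basis. (v (x + h *\<^sub>R i) * \<phi> x + v (x - h *\<^sub>R i) * \<phi> x - 2 * (v x * \<phi> x)) / h\<^sup>2)" for x
    unfolding second_difference_def sum_distrib_right by (intro sum.cong refl) (simp add: field_simps)
  show "integrable lborel (\<lambda>x. v x * second_difference h \<phi> x)"
    unfolding e1 using i0 i1 i1' by (auto intro!: Bochner_Integration.integrable_sum)
  show "integrable lborel (\<lambda>x. second_difference h v x * \<phi> x)"
    unfolding e2 using i0 i2 i2' by (auto intro!: Bochner_Integration.integrable_sum)
  show "(LINT x|lborel. v x * second_difference h \<phi> x) = (LINT x|lborel. second_difference h v x * \<phi> x)"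
    unfolding e1 e2 using i0 i1 i1' i2 i2' s s'
    by (subst (1 2) Bochner_Integration.integral_sum) (auto intro!: sum.cong)
qed

section \<open>Kato's inequality for weak Laplacians\<close>

lemma second_difference_eq_0:
  fixes f :: "'a::euclidean_space \<Rightarrow> real"
  assumes "\<And>y. dist x y \<le> \<bar>h\<bar> \<Longrightarrow> f y = 0"
  shows "second_difference h f x = 0"
proof -
  have "f (x + h *\<^sub>R i) = 0" "f (x - h *\<^sub>R i) = 0" "f x = 0" if "i \<in> Basis" for i
    using that by (auto intro!: assms simp: dist_norm)
  then show ?thesis unfolding second_difference_def by simp
qed

text \<open>
  The discrete chain rule: convexity alone gives this inequality, without any derivative of \<open>v\<close>.
\<close>

lemma second_difference_convex:
  fixes v :: "'a::euclidean_space \<Rightarrow> real"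
  assumes "\<And>s t. \<beta> t \<ge> \<beta> s + b s * (t - s)"
  shows "second_difference h (\<lambda>x. \<beta> (v x)) x \<ge> b (v x) * second_difference h v x"
  unfolding second_difference_def sum_distrib_left
proof (intro sum_mono)
  fix i :: 'a assume "i \<in> Basis"
  let ?a = "v (x + h *\<^sub>R i)" and ?c = "v (x - h *\<^sub>R i)"
  have "b (v x) * (?a + ?c - 2 * v x) \<le> \<beta> ?a + \<beta> ?c - 2 * \<beta> (v x)"
    using assms[of "v x" ?a] assms[of "v x" ?c] by (simp add: algebra_simps)
  then show "b (v x) * ((?a + ?c - 2 * v x) / h\<^sup>2) \<le> (\<beta> ?a + \<beta> ?c - 2 * \<beta> (v x)) / h\<^sup>2"
    by (simp add: divide_right_mono)
qed

text \<open>
  Kato's inequality for the mollified function \<open>v\<close>, whose Laplacian on \<open>K\<close> is the mollification of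
  \<open>g\<close>. The discrete inequality is tested with \<open>\<phi>\<close>; then the step tends to zero. On the right
  the second differences fall on \<open>\<phi>\<close>, on the left they fall on the mollifier, so that only smooth functions
  are ever differentiated.
\<close>

lemma kato_mollified:
  fixes U g \<rho> :: "'a::euclidean_space \<Rightarrow> real"
  assumes U[measurable]: "U \<in> borel_measurable borel" and B: "\<And>x. \<bar>U x\<bar> \<le> B"
    and eq: "\<And>\<psi>. test_function V \<psi> \<Longrightarrow>
      (LINT y|lborel. U y * laplacian \<psi> y) = (LINT y|lborel. g y * \<psi> y)"
    and sm: "\<And>x. smooth (\<lambda>y. \<rho> (y - x))" and nonneg: "\<And>x. \<rho> x \<ge> 0"
    and e: "e > 0" "\<And>x. norm x \<ge> e \<Longrightarrow> \<rho> x = 0"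
    and \<rho>int: "integrable lborel \<rho>" "(LINT x|lborel. \<rho> x) = 1"
    and \<phi>: "C2_compact K \<phi> L" "\<And>x. \<phi> x \<ge> 0" and K: "\<And>x. x \<in> K \<Longrightarrow> cball x e \<subseteq> V"
    and convex: "\<And>s t. \<beta> t \<ge> \<beta> s + b s * (t - s)" and b1: "\<And>s. \<bar>b s\<bar> \<le> 1"
    and cont: "continuous_on UNIV \<beta>" "continuous_on UNIV b"
  defines "v \<equiv> \<lambda>x. LINT y|lborel. U y * \<rho> (y - x)"
  shows "(LINT x|lborel. b (v x) * (LINT y|lborel. g y * \<rho> (y - x)) * \<phi> x) \<le> (LINT x|lborel. \<beta> (v x) * L x)"
proof -
  have B0: "B \<ge> 0" using B[of 0] by linarith
  have [measurable]: "\<beta> \<in> borel_measurable borel" "b \<in> borel_measurable borel"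
    using cont by (auto intro: borel_measurable_continuous_onI)
  have c\<rho>: "continuous_on UNIV \<rho>" using smooth_imp_continuous[OF sm[of 0]] by simp
  have [measurable]: "\<rho> \<in> borel_measurable borel" using c\<rho> by (rule borel_measurable_continuous_onI)
  have c\<phi>: "continuous_on UNIV \<phi>" "compact K" "\<And>x. x \<notin> K \<Longrightarrow> \<phi> x = 0"
    using \<phi>(1) unfolding C2_compact_def by auto
  have [measurable]: "\<phi> \<in> borel_measurable borel" using c\<phi>(1) by (rule borel_measurable_continuous_onI)
  have \<phi>int: "integrable lborel \<phi>" by (rule continuous_compact_support_integrable[OF c\<phi>(2,1,3)])
  have [measurable]: "L \<in> borel_measurable borel"
    using C2_compact_laplacian(1)[OF \<phi>(1)] by (rule borel_measurable_continuous_onI)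
  have sdm[measurable]: "second_difference h f \<in> borel_measurable borel"
    if [measurable]: "f \<in> borel_measurable borel" for h and f :: "'a \<Rightarrow> real"
    unfolding second_difference_def by measurable
  have \<rho>x: "integrable lborel (\<lambda>y. \<rho> (y - x))" "(LINT y|lborel. \<rho> (y - x)) = 1" for x
    using lborel_integral_shift[of \<rho> "- x"] \<rho>int by simp_all
  have U\<rho>: "integrable lborel (\<lambda>y. U y * \<rho> (y - x))" for x
    by (rule integrable_mult_bounded[OF \<rho>x(1) _ B]) simp
  have vm[measurable]: "v \<in> borel_measurable borel" unfolding v_def by measurable
  have vB: "\<bar>v x\<bar> \<le> B" for x
  proof -
    have "norm (v x) \<le> (LINT y|lborel. norm (U y * \<rho> (y - x)))"
      unfolding v_def by (rule integral_norm_bound)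
    also have "\<dots> \<le> (LINT y|lborel. B * \<rho> (y - x))"
      by (intro integral_mono integrable_norm integrable_mult_right U\<rho> \<rho>x)
        (use B nonneg in \<open>auto simp: abs_mult intro!: mult_right_mono\<close>)
    finally show ?thesis using \<rho>x by simp
  qed
  have lip: "\<bar>\<beta> t - \<beta> s\<bar> \<le> \<bar>t - s\<bar>" for s t
  proof -
    have "\<bar>b s * (t - s)\<bar> \<le> \<bar>t - s\<bar>" "\<bar>b t * (s - t)\<bar> \<le> \<bar>s - t\<bar>"
      using b1 by (auto simp: abs_mult intro: mult_left_le_one_le)
    then show ?thesis using convex[of s t] convex[of t s] by (auto simp: abs_le_iff)
  qed
  define B' where "B' = \<bar>\<beta> 0\<bar> + B"
  have \<beta>B: "\<bar>\<beta> (v x)\<bar> \<le> B'" for x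
    using lip[of "v x" 0] vB[of x] by (auto simp: B'_def)
  have B'0: "B' \<ge> 0" using B0 by (simp add: B'_def)

  define \<psi> where "\<psi> x = (\<lambda>y. \<rho> (y - x))" for x
  have supp: "closure {y. \<psi> x y \<noteq> 0} \<subseteq> cball x e" for x
  proof (rule closure_minimal)
    show "{y. \<psi> x y \<noteq> 0} \<subseteq> cball x e"
      using e(2) by (force simp: \<psi>_def dist_norm norm_minus_commute)
  qed auto
  have test: "test_function A (\<psi> x)" if "cball x e \<subseteq> A" for A x
    unfolding test_function_def
  proof (intro conjI)
    show "smooth (\<psi> x)" unfolding \<psi>_def by (rule sm)
    show "compact (closure {y. \<psi> x y \<noteq> 0})"
      using supp[of x] bounded_subset[OF bounded_cball] by (auto simp: compact_eq_bounded_closed)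
    show "closure {y. \<psi> x y \<noteq> 0} \<subseteq> A" using supp that by blast
  qed
  obtain C where C: "\<And>h x. h \<noteq> 0 \<Longrightarrow> \<bar>second_difference h \<rho> x\<bar> \<le> C"
  proof (rule second_difference_bounded_convergent[OF test_function_C2_compact[OF test[of 0 UNIV]]])
    fix C assume *: "\<And>h x. h \<noteq> 0 \<Longrightarrow> \<bar>second_difference h (\<psi> 0) x\<bar> \<le> C"
    show thesis by (rule that[of C]) (use * in \<open>simp add: \<psi>_def\<close>)
  qed simp
  have C0: "C \<ge> 0" using C[of 1 0] by linarith
  have sd_shift: "second_difference h (\<psi> x) y = second_difference h \<rho> (y - x)" for h x y
    unfolding second_difference_def \<psi>_def by (simp add: algebra_simps)
  have sd_lim: "(\<lambda>j. second_difference (1 / Suc j) (\<psi> x) y) \<longlonglongrightarrow> laplacian (\<psi> x) y" for x y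
    by (rule second_difference_bounded_convergent[OF test_function_C2_compact[OF test[of x UNIV]]]) auto
  have sd_bound: "\<bar>second_difference h (\<psi> x) y\<bar> \<le> C * indicator (cball x (e + 1)) y"
    if "h \<noteq> 0" "\<bar>h\<bar> \<le> 1" for h x y
  proof (cases "y \<in> cball x (e + 1)")
    case True
    then show ?thesis using C[OF that(1)] by (simp add: sd_shift)
  next
    case False
    have "\<psi> x z = 0" if "dist y z \<le> \<bar>h\<bar>" for z
    proof -
      have "dist x z \<ge> e" using False that \<open>\<bar>h\<bar> \<le> 1\<close> dist_triangle[of x y z]
        by (simp add: dist_commute)
      then show ?thesis unfolding \<psi>_def by (intro e(2)) (simp add: dist_norm norm_minus_commute)
    qed
    then have "second_difference h (\<psi> x) y = 0" by (rule second_difference_eq_0)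
    then show ?thesis using C0 by simp
  qed
  have sd_v: "second_difference h v x = (LINT y|lborel. U y * second_difference h (\<psi> x) y)" for h x
  proof -
    have "second_difference h v x = (\<Sum>i\<in>Basis. (LINT y|lborel.
      (U y * \<rho> (y - (x + h *\<^sub>R i)) + U y * \<rho> (y - (x - h *\<^sub>R i)) - 2 * (U y * \<rho> (y - x))) / h\<^sup>2))"
      unfolding second_difference_def v_def using U\<rho> by simp
    also have "\<dots> = (LINT y|lborel. (\<Sum>i\<in>Basis.
      (U y * \<rho> (y - (x + h *\<^sub>R i)) + U y * \<rho> (y - (x - h *\<^sub>R i)) - 2 * (U y * \<rho> (y - x))) / h\<^sup>2))"
      using U\<rho> by (intro Bochner_Integration.integral_sum[symmetric]) auto
    also have "\<dots> = (LINT y|lborel. U y * second_difference h (\<psi> x) y)"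
      unfolding second_difference_def \<psi>_def sum_distrib_left
      by (intro Bochner_Integration.integral_cong sum.cong refl) (simp add: field_simps)
    finally show ?thesis .
  qed
  have ind: "integrable lborel (\<lambda>y. a * indicator (cball x r) y :: real)" for a r and x :: 'a
    by (intro integrable_mult_right integrable_real_indicator)
      (use emeasure_lborel_cball_finite[of x r] in auto)
  have Usd: "\<bar>U y * second_difference h (\<psi> x) y\<bar> \<le> (B * C) * indicator (cball x (e + 1)) y"
    if "h \<noteq> 0" "\<bar>h\<bar> \<le> 1" for h x y
    using mult_mono[OF B[of y] sd_bound[OF that, of x y]] B0 by (simp add: abs_mult mult.assoc)
  define D where "D = (B * C) * measure lborel (cball (0::'a) (e + 1))"
  have sd_v_bound: "\<bar>second_difference h v x\<bar> \<le> D" if "h \<noteq> 0" "\<bar>h\<bar> \<le> 1" for h x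
  proof -
    have "norm (second_difference h v x) \<le> (LINT y|lborel. norm (U y * second_difference h (\<psi> x) y))"
      unfolding sd_v by (rule integral_norm_bound)
    also have "\<dots> \<le> (LINT y|lborel. (B * C) * indicator (cball x (e + 1)) y)"
    proof (rule integral_mono_AE)
      show "integrable lborel (\<lambda>y. norm (U y * second_difference h (\<psi> x) y))"
        by (rule Bochner_Integration.integrable_bound[OF ind[of "B * C" x "e + 1"]])
          (use Usd[OF that] B0 C0 in \<open>auto simp: \<psi>_def\<close>)
    qed (use Usd[OF that] ind in auto)
    also have "\<dots> = D"
      using e(1) by (simp add: D_def content_cball)
    finally show ?thesis by simp
  qed
  have sd_v_lim: "(\<lambda>j. second_difference (1 / Suc j) v x) \<longlonglongrightarrow> (LINT y|lborel. g y * \<rho> (y - x))"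
    if "x \<in> K" for x
  proof -
    have "(\<lambda>j. LINT y|lborel. U y * second_difference (1 / Suc j) (\<psi> x) y) \<longlonglongrightarrow>
        (LINT y|lborel. U y * laplacian (\<psi> x) y)"
    proof (rule integral_dominated_convergence[OF _ _ ind[of "B * C" x "e + 1"]])
      have "laplacian (\<psi> x) \<in> borel_measurable borel"
        using C2_compact_laplacian(1)[OF test_function_C2_compact[OF test[of x UNIV]]]
        by (intro borel_measurable_continuous_onI) simp
      then show "(\<lambda>y. U y * laplacian (\<psi> x) y) \<in> borel_measurable lborel" by simp
      show "(\<lambda>y. U y * second_difference (1 / Suc j) (\<psi> x) y) \<in> borel_measurable lborel" for j
        by (simp add: \<psi>_def)
      show "AE y in lborel. (\<lambda>j. U y * second_difference (1 / Suc j) (\<psi> x) y) \<longlonglongrightarrow> U y * laplacian (\<psi> x) y"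
        by (intro AE_I2 tendsto_intros sd_lim)
      show "AE y in lborel. norm (U y * second_difference (1 / Suc j) (\<psi> x) y) \<le> B * C * indicator (cball x (e + 1)) y" for j
        using Usd[of "1 / Suc j"] by (intro AE_I2) auto
    qed
    also have "(LINT y|lborel. U y * laplacian (\<psi> x) y) = (LINT y|lborel. g y * \<psi> x y)"
      by (intro eq test K that)
    finally show ?thesis by (simp add: sd_v \<psi>_def)
  qed
  obtain C' where C': "\<And>h x. h \<noteq> 0 \<Longrightarrow> \<bar>second_difference h \<phi> x\<bar> \<le> C'"
    and lim\<phi>: "\<And>x. (\<lambda>j. second_difference (1 / Suc j) \<phi> x) \<longlonglongrightarrow> L x"
  proof (rule second_difference_bounded_convergent[OF \<phi>(1)])
    fix C assume "\<And>h x. h \<noteq> 0 \<Longrightarrow> \<bar>second_difference h \<phi> x\<bar> \<le> C"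
      "\<And>x. (\<lambda>j. second_difference (1 / Suc j) \<phi> x) \<longlonglongrightarrow> L x"
    then show thesis by (rule that)
  qed
  have C'0: "C' \<ge> 0" using C'[of 1 0] by linarith
  obtain R where R: "K \<subseteq> cball 0 R"
    using compact_imp_bounded[OF c\<phi>(2)] by (metis bounded_subset_ballD ball_subset_cball subset_trans)
  have \<phi>_bound: "\<bar>second_difference h \<phi> x\<bar> \<le> C' * indicator (cball 0 (R + 1)) x"
    if "h \<noteq> 0" "\<bar>h\<bar> \<le> 1" for h x
  proof (cases "x \<in> cball 0 (R + 1)")
    case True
    then show ?thesis using C'[OF that(1)] by simp
  next
    case False
    have "\<phi> z = 0" if "dist x z \<le> \<bar>h\<bar>" for z
    proof (rule c\<phi>(3))
      have "norm z > R" using False that \<open>\<bar>h\<bar> \<le> 1\<close> norm_triangle_sub[of x z]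
        by (simp add: dist_norm)
      then show "z \<notin> K" using R by auto
    qed
    then have "second_difference h \<phi> x = 0" by (rule second_difference_eq_0)
    then show ?thesis using C'0 by simp
  qed
  have l1: "(\<lambda>j. LINT x|lborel. \<beta> (v x) * second_difference (1 / Suc j) \<phi> x) \<longlonglongrightarrow> (LINT x|lborel. \<beta> (v x) * L x)"
  proof (rule integral_dominated_convergence[OF _ _ ind[of "B' * C'" 0 "R + 1"]])
    show "AE x in lborel. (\<lambda>j. \<beta> (v x) * second_difference (1 / Suc j) \<phi> x) \<longlonglongrightarrow> \<beta> (v x) * L x"
      by (intro AE_I2 tendsto_intros lim\<phi>)
    show "AE x in lborel. norm (\<beta> (v x) * second_difference (1 / Suc j) \<phi> x) \<le> B' * C' * indicator (cball 0 (R + 1)) x" for j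
    proof (intro AE_I2)
      fix x
      show "norm (\<beta> (v x) * second_difference (1 / Suc j) \<phi> x) \<le> B' * C' * indicator (cball 0 (R + 1)) x"
        using mult_mono[OF \<beta>B[of x] \<phi>_bound[of "1 / Suc j" x]] B'0 by (simp add: abs_mult mult.assoc)
    qed
  qed auto
  have lim: "(\<lambda>j. b (v x) * second_difference (1 / Suc j) v x * \<phi> x) \<longlonglongrightarrow>
      b (v x) * ((LINT y|lborel. g y * \<rho> (y - x)) * \<phi> x)" for x
  proof (cases "x \<in> K")
    case True
    show ?thesis unfolding mult.assoc by (intro tendsto_intros sd_v_lim True)
  next
    case False
    then show ?thesis using c\<phi>(3) by simp
  qed
  have l2: "(\<lambda>j. LINT x|lborel. b (v x) * second_difference (1 / Suc j) v x * \<phi> x) \<longlonglongrightarrow>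
      (LINT x|lborel. b (v x) * (LINT y|lborel. g y * \<rho> (y - x)) * \<phi> x)"
  proof -
    have "(\<lambda>j. LINT x|lborel. b (v x) * second_difference (1 / Suc j) v x * \<phi> x) \<longlonglongrightarrow>
      (LINT x|lborel. b (v x) * ((LINT y|lborel. g y * \<rho> (y - x)) * \<phi> x))"
    proof (rule integral_dominated_convergence[where w = "\<lambda>x. D * \<phi> x"])
      show "AE x in lborel. (\<lambda>j. b (v x) * second_difference (1 / Suc j) v x * \<phi> x) \<longlonglongrightarrow>
          b (v x) * ((LINT y|lborel. g y * \<rho> (y - x)) * \<phi> x)"
        by (intro AE_I2 lim)
      show "AE x in lborel. norm (b (v x) * second_difference (1 / Suc j) v x * \<phi> x) \<le> D * \<phi> x" for j
      proof (intro AE_I2)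
        fix x
        have "\<bar>b (v x)\<bar> * \<bar>second_difference (1 / Suc j) v x\<bar> \<le> 1 * D"
          by (intro mult_mono b1 sd_v_bound) auto
        then show "norm (b (v x) * second_difference (1 / Suc j) v x * \<phi> x) \<le> D * \<phi> x"
          using \<phi>(2)[of x] by (simp add: abs_mult mult_right_mono)
      qed
      show "(\<lambda>x. b (v x) * ((LINT y|lborel. g y * \<rho> (y - x)) * \<phi> x)) \<in> borel_measurable lborel"
        by (rule borel_measurable_LIMSEQ_metric[OF _ lim]) measurable
    qed (use \<phi>int in auto)
    then show ?thesis by (simp add: mult.assoc)
  qed
  show ?thesis
  proof (rule LIMSEQ_le[OF l2 l1], intro exI allI impI)
    fix j :: nat
    have i1: "integrable lborel (\<lambda>x. second_difference (1 / Suc j) (\<lambda>x. \<beta> (v x)) x * \<phi> x)"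
      and i2: "(LINT x|lborel. \<beta> (v x) * second_difference (1 / Suc j) \<phi> x) =
        (LINT x|lborel. second_difference (1 / Suc j) (\<lambda>x. \<beta> (v x)) x * \<phi> x)"
      using second_difference_symmetric[OF _ \<beta>B \<phi>int] by simp_all
    have i3: "integrable lborel (\<lambda>x. second_difference (1 / Suc j) v x * \<phi> x)"
      by (rule second_difference_symmetric[OF vm vB \<phi>int])
    have i4: "integrable lborel (\<lambda>x. b (v x) * (second_difference (1 / Suc j) v x * \<phi> x))"
      by (rule integrable_mult_bounded[OF i3 _ b1]) simp
    show "(LINT x|lborel. b (v x) * second_difference (1 / Suc j) v x * \<phi> x) \<le>
      (LINT x|lborel. \<beta> (v x) * second_difference (1 / Suc j) \<phi> x)"
      unfolding i2
    proof (rule integral_mono)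
      show "integrable lborel (\<lambda>x. b (v x) * second_difference (1 / Suc j) v x * \<phi> x)"
        using i4 by (simp add: mult.assoc)
      show "b (v x) * second_difference (1 / Suc j) v x * \<phi> x \<le>
          second_difference (1 / Suc j) (\<lambda>x. \<beta> (v x)) x * \<phi> x" for x
        using second_difference_convex[of \<beta> b, OF convex] \<phi>(2) by (intro mult_right_mono)
    qed (rule i1)
  qed
qed

text \<open>
  A mollification is a weighted mean over a small ball, hence stays in every interval containing the
  values there.
\<close>

lemma mollifier_average:
  fixes f \<rho> :: "'a::euclidean_space \<Rightarrow> real"
  assumes "\<And>x. \<rho> x \<ge> 0" "\<And>x. norm x \<ge> e \<Longrightarrow> \<rho> x = 0" "integrable lborel \<rho>" "(LINT x|lborel. \<rho> x) = 1"
    and "\<rho> \<in> borel_measurable borel"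
    and int: "integrable lborel (\<lambda>x. f x * \<rho> (x - y))"
    and near: "\<And>x. dist y x < e \<Longrightarrow> \<bar>f x - c\<bar> \<le> \<eta>"
  shows "\<bar>(LINT x|lborel. f x * \<rho> (x - y)) - c\<bar> \<le> \<eta>"
proof -
  have \<rho>: "integrable lborel (\<lambda>x. \<rho> (x - y))" "(LINT x|lborel. \<rho> (x - y)) = 1"
    using lborel_integral_shift[of \<rho> "- y"] assms(3-5) by simp_all
  have "(LINT x|lborel. f x * \<rho> (x - y)) - c = (LINT x|lborel. f x * \<rho> (x - y) - c * \<rho> (x - y))"
    using \<rho> int by simp
  also have "norm \<dots> \<le> (LINT x|lborel. norm (f x * \<rho> (x - y) - c * \<rho> (x - y)))"
    by (rule integral_norm_bound)
  also have "\<dots> \<le> (LINT x|lborel. \<eta> * \<rho> (x - y))"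
  proof (intro integral_mono integrable_norm Bochner_Integration.integrable_diff integrable_mult_right int \<rho>)
    fix x
    show "norm (f x * \<rho> (x - y) - c * \<rho> (x - y)) \<le> \<eta> * \<rho> (x - y)"
    proof (cases "dist y x < e")
      case True
      then show ?thesis using near[OF True] assms(1)[of "x - y"]
        by (simp add: left_diff_distrib[symmetric] abs_mult mult_right_mono)
    next
      case False
      then have "\<rho> (x - y) = 0" by (intro assms(2)) (simp add: dist_norm norm_minus_commute)
      then show ?thesis by simp
    qed
  qed
  finally show ?thesis using \<rho> by simp
qed

lemma integrable_pair_product:
  fixes f :: "'a::euclidean_space \<Rightarrow> real" and g :: "'b::euclidean_space \<Rightarrow> real"
  assumes f: "integrable lborel f" and g: "integrable lborel g"
  shows "integrable (lborel \<Otimes>\<^sub>M lborel) (\<lambda>(x, y). f x * g y)"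
proof -
  have [measurable]: "f \<in> borel_measurable borel" "g \<in> borel_measurable borel"
    using f g by (auto simp: integrable_iff_bounded)
  have "integrable lborel (\<lambda>x. LINT y|lborel. norm (f x * g y))"
    using f by (simp add: abs_mult)
  then show ?thesis
    using g by (intro lborel_pair.Fubini_integrable) auto
qed

lemma isCont_real_near:
  fixes f :: "'a::metric_space \<Rightarrow> real"
  assumes "isCont f y" "\<eta> > 0"
  obtains d where "d > 0" "\<And>z. dist z y < d \<Longrightarrow> \<bar>f z - f y\<bar> < \<eta>"
proof -
  obtain d where d: "d > 0" "\<And>z. z \<noteq> y \<Longrightarrow> dist z y < d \<Longrightarrow> \<bar>f z - f y\<bar> < \<eta>"
    using assms unfolding isCont_def LIM_def dist_real_def by metis
  then have "\<bar>f z - f y\<bar> < \<eta>" if "dist z y < d" for z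
    using that assms(2) by (cases "z = y") auto
  then show ?thesis using that d(1) by blast
qed

text \<open>
  Kato's inequality \<open>\<Delta>(\<beta>(U)) \<ge> \<beta>'(U) \<Delta>U\<close> in the weak sense, for convex \<open>\<beta>\<close> with \<open>\<bar>\<beta>'\<bar> \<le> 1\<close>
  and a continuous \<open>U\<close> whose distributional Laplacian \<open>g\<close> is only integrable. In the limit of the
  mollified inequality, the mollification of \<open>g\<close> is moved by Fubini's theorem to the factor
  \<open>\<beta>'(v) \<phi>\<close>. That factor converges pointwise and boundedly, since \<open>U\<close> is continuous near the support
  of \<open>\<phi>\<close>; so no convergence of mollified \<open>g\<close> has to be established.
\<close>

lemma kato_inequality:
  fixes U g :: "'a::euclidean_space \<Rightarrow> real"
  assumes V: "open V" and U[measurable]: "U \<in> borel_measurable borel" and B: "\<And>x. \<bar>U x\<bar> \<le> B"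
    and UV: "continuous_on V U" and g: "integrable lborel g"
    and eq: "\<And>\<psi>. test_function V \<psi> \<Longrightarrow>
      (LINT y|lborel. U y * laplacian \<psi> y) = (LINT y|lborel. g y * \<psi> y)"
    and \<phi>: "C2_compact K \<phi> L" "\<And>x. \<phi> x \<ge> 0" and K: "K \<subseteq> V"
    and convex: "\<And>s t. \<beta> t \<ge> \<beta> s + b s * (t - s)" and b1: "\<And>s. \<bar>b s\<bar> \<le> 1"
    and cont: "continuous_on UNIV \<beta>" "continuous_on UNIV b"
  shows "(LINT x|lborel. b (U x) * g x * \<phi> x) \<le> (LINT x|lborel. \<beta> (U x) * L x)"
proof -
  have [measurable]: "\<beta> \<in> borel_measurable borel" "b \<in> borel_measurable borel"
    using cont by (auto intro: borel_measurable_continuous_onI)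
  have [measurable]: "g \<in> borel_measurable borel" using g by (simp add: integrable_iff_bounded)
  have c\<phi>: "continuous_on UNIV \<phi>" "compact K" "\<And>x. x \<notin> K \<Longrightarrow> \<phi> x = 0"
    using \<phi>(1) unfolding C2_compact_def by auto
  have [measurable]: "\<phi> \<in> borel_measurable borel" using c\<phi>(1) by (rule borel_measurable_continuous_onI)
  have \<phi>int: "integrable lborel \<phi>" by (rule continuous_compact_support_integrable[OF c\<phi>(2,1,3)])
  have [measurable]: "L \<in> borel_measurable borel"
    using C2_compact_laplacian(1)[OF \<phi>(1)] by (rule borel_measurable_continuous_onI)
  have Lint: "integrable lborel L"
    by (rule continuous_compact_support_integrable[OF c\<phi>(2) C2_compact_laplacian[OF \<phi>(1)]])
  obtain M where M: "\<And>x. \<bar>\<phi> x\<bar> \<le> M"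
    using continuous_compact_support_bounded[OF c\<phi>(2,1,3)] by blast
  have M0: "M \<ge> 0" using M[of 0] by linarith
  obtain d where d: "d > 0" "(\<Union>x\<in>K. cball x d) \<subseteq> V"
    by (rule compact_subset_open_imp_cball_epsilon_subset[OF c\<phi>(2) V K])
  define e where "e m = d / real (Suc m)" for m
  have e: "e m > 0" "e m \<le> d" for m using d(1) by (simp_all add: e_def field_simps)
  have e0: "e \<longlonglongrightarrow> 0"
    unfolding e_def using tendsto_mult[OF tendsto_const[of d] LIMSEQ_inverse_real_of_nat]
    by (simp add: field_simps)
  have "\<forall>m. \<exists>\<rho> :: 'a \<Rightarrow> real. (\<forall>x. smooth (\<lambda>y. \<rho> (y - x))) \<and> (\<forall>x. \<rho> x \<ge> 0) \<and>
      (\<forall>x. norm x \<ge> e m \<longrightarrow> \<rho> x = 0) \<and> (\<forall>x. \<rho> (- x) = \<rho> x) \<and> integrable lborel \<rho> \<and> (LINT x|lborel. \<rho> x) = 1"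
  proof
    fix m
    show "\<exists>\<rho> :: 'a \<Rightarrow> real. (\<forall>x. smooth (\<lambda>y. \<rho> (y - x))) \<and> (\<forall>x. \<rho> x \<ge> 0) \<and>
      (\<forall>x. norm x \<ge> e m \<longrightarrow> \<rho> x = 0) \<and> (\<forall>x. \<rho> (- x) = \<rho> x) \<and> integrable lborel \<rho> \<and> (LINT x|lborel. \<rho> x) = 1"
      by (rule exists_mollifier[OF e(1)[of m]]) blast
  qed
  from choice[OF this] obtain \<rho> :: "nat \<Rightarrow> 'a \<Rightarrow> real" where sm: "\<And>m x. smooth (\<lambda>y. \<rho> m (y - x))"
    and nonneg: "\<And>m x. \<rho> m x \<ge> 0" and supp: "\<And>m x. norm x \<ge> e m \<Longrightarrow> \<rho> m x = 0"
    and even: "\<And>m x. \<rho> m (- x) = \<rho> m x"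
    and \<rho>int: "\<And>m. integrable lborel (\<rho> m)" "\<And>m. (LINT x|lborel. \<rho> m x) = 1"
    by blast
  have c\<rho>: "continuous_on UNIV (\<rho> m)" for m using smooth_imp_continuous[OF sm[of m 0]] by simp
  have [measurable]: "\<rho> m \<in> borel_measurable borel" for m using c\<rho> by (rule borel_measurable_continuous_onI)
  have \<rho>x: "integrable lborel (\<lambda>y. \<rho> m (y - x))" for m x
    using lborel_integral_shift[of "\<rho> m" "- x"] \<rho>int by simp_all
  define v where "v m x = (LINT y|lborel. U y * \<rho> m (y - x))" for m x
  have U\<rho>: "integrable lborel (\<lambda>y. U y * \<rho> m (y - x))" for m x
    by (rule integrable_mult_bounded[OF \<rho>x _ B]) simp
  have vm[measurable]: "v m \<in> borel_measurable borel" for m unfolding v_def by measurable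
  have v_near: "\<bar>v m x - c\<bar> \<le> \<eta>" if "\<And>z. dist x z < e m \<Longrightarrow> \<bar>U z - c\<bar> \<le> \<eta>" for m x c \<eta>
    unfolding v_def
    by (rule mollifier_average[OF nonneg supp \<rho>int _ U\<rho>]) (use that in auto)
  have vB: "\<bar>v m x\<bar> \<le> B" for m x using v_near[of x m 0 B] B by simp
  have v_lim: "(\<lambda>m. v m x) \<longlonglongrightarrow> U x" if "x \<in> V" for x
  proof (rule LIMSEQ_I)
    fix \<eta> :: real assume "\<eta> > 0"
    have "isCont U x" using UV V that by (simp add: continuous_on_eq_continuous_at)
    then obtain r where r: "r > 0" "\<And>z. dist z x < r \<Longrightarrow> \<bar>U z - U x\<bar> < \<eta> / 2"
      using isCont_real_near[OF _ half_gt_zero] \<open>\<eta> > 0\<close> by blast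
    from LIMSEQ_D[OF e0 r(1)] obtain N where N: "\<And>m. m \<ge> N \<Longrightarrow> e m < r" using e(1) by fastforce
    have "\<bar>v m x - U x\<bar> \<le> \<eta> / 2" if "m \<ge> N" for m
    proof (rule v_near)
      fix z assume "dist x z < e m"
      then show "\<bar>U z - U x\<bar> \<le> \<eta> / 2" using N[OF that] r(2)[of z] by (simp add: dist_commute)
    qed
    moreover have "\<eta> / 2 < \<eta>" using \<open>\<eta> > 0\<close> by simp
    ultimately show "\<exists>N. \<forall>m\<ge>N. norm (v m x - U x) < \<eta>"
      by (intro exI[of _ N] allI impI, unfold real_norm_def) (rule le_less_trans)
  qed
  have lip: "\<bar>\<beta> t - \<beta> s\<bar> \<le> \<bar>t - s\<bar>" for s t
  proof -
    have "\<bar>b s * (t - s)\<bar> \<le> \<bar>t - s\<bar>" "\<bar>b t * (s - t)\<bar> \<le> \<bar>s - t\<bar>"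
      using b1 by (auto simp: abs_mult intro: mult_left_le_one_le)
    then show ?thesis using convex[of s t] convex[of t s] by (auto simp: abs_le_iff)
  qed
  define B' where "B' = \<bar>\<beta> 0\<bar> + B"
  have \<beta>B: "\<bar>\<beta> (v m x)\<bar> \<le> B'" for m x
    using lip[of "v m x" 0] vB[of m x] by (auto simp: B'_def)
  have l1: "(\<lambda>m. LINT x|lborel. \<beta> (v m x) * L x) \<longlonglongrightarrow> (LINT x|lborel. \<beta> (U x) * L x)"
  proof (rule integral_dominated_convergence[where w = "\<lambda>x. B' * \<bar>L x\<bar>"])
    show "AE x in lborel. (\<lambda>m. \<beta> (v m x) * L x) \<longlonglongrightarrow> \<beta> (U x) * L x"
    proof (intro AE_I2)
      fix x
      show "(\<lambda>m. \<beta> (v m x) * L x) \<longlonglongrightarrow> \<beta> (U x) * L x"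
      proof (cases "x \<in> K")
        case True
        then have "(\<lambda>m. \<beta> (v m x)) \<longlonglongrightarrow> \<beta> (U x)"
          using cont(1) K v_lim by (intro isCont_tendsto_compose[of _ \<beta>])
            (auto simp: continuous_on_eq_continuous_at)
        then show ?thesis by (intro tendsto_intros)
      next
        case False
        then show ?thesis using C2_compact_laplacian(2)[OF \<phi>(1)] by simp
      qed
    qed
    show "AE x in lborel. norm (\<beta> (v m x) * L x) \<le> B' * \<bar>L x\<bar>" for m
      using \<beta>B by (intro AE_I2) (simp add: abs_mult mult_right_mono)
  qed (use Lint in auto)
  define q where "q m y = (LINT x|lborel. b (v m x) * \<phi> x * \<rho> m (x - y))" for m y
  have b\<phi>: "\<bar>b (v m x) * \<phi> x\<bar> \<le> \<bar>\<phi> x\<bar>" for m x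
    using b1 by (simp add: abs_mult mult_left_le_one_le)
  have q_int: "integrable lborel (\<lambda>x. b (v m x) * \<phi> x * \<rho> m (x - y))" for m y
    by (rule integrable_mult_bounded[OF \<rho>x _ order.trans[OF b\<phi> M]]) simp
  have q_near: "\<bar>q m y - c\<bar> \<le> \<eta>" if "\<And>z. dist y z < e m \<Longrightarrow> \<bar>b (v m z) * \<phi> z - c\<bar> \<le> \<eta>" for m y c \<eta>
    unfolding q_def
    by (rule mollifier_average[OF nonneg supp \<rho>int _ q_int]) (use that in auto)
  have qM: "\<bar>q m y\<bar> \<le> M" for m y
    using q_near[of y m 0 M] order.trans[OF b\<phi> M] by simp
  have qm[measurable]: "q m \<in> borel_measurable borel" for m unfolding q_def by measurable
  have q_lim: "(\<lambda>m. q m y) \<longlonglongrightarrow> b (U y) * \<phi> y" for y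
  proof (rule LIMSEQ_I)
    fix \<eta>0 :: real assume \<eta>0: "\<eta>0 > 0"
    define \<eta> where "\<eta> = \<eta>0 / (2 * (1 + M))"
    have \<eta>: "\<eta> > 0" using \<eta>0 M0 by (simp add: \<eta>_def)
    have "isCont \<phi> y" using c\<phi>(1) by (simp add: continuous_on_eq_continuous_at)
    then obtain r where r: "r > 0" "\<And>z. dist z y < r \<Longrightarrow> \<bar>\<phi> z - \<phi> y\<bar> < \<eta>"
      using isCont_real_near[OF _ \<eta>] by blast
    have "\<exists>r'>0. \<forall>m z. e m < r' \<and> dist y z < e m \<longrightarrow> \<bar>b (v m z) * \<phi> z - b (U y) * \<phi> y\<bar> \<le> \<eta> * (1 + M)"
    proof (cases "y \<in> V")
      case False
      then have "\<phi> y = 0" using c\<phi>(3) K by blast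
      have "\<bar>b (v m z) * \<phi> z\<bar> \<le> \<eta> * (1 + M)" if "e m < r" "dist y z < e m" for m z
      proof -
        have "\<bar>b (v m z) * \<phi> z\<bar> \<le> \<eta>"
          using b\<phi>[of m z] r(2)[of z] that \<open>\<phi> y = 0\<close> by (simp add: dist_commute)
        also have "\<dots> \<le> \<eta> * (1 + M)" using \<eta> M0 by simp
        finally show ?thesis .
      qed
      then show ?thesis using r(1) \<open>\<phi> y = 0\<close> by auto
    next
      case True
      have "isCont b (U y)" using cont(2) by (simp add: continuous_on_eq_continuous_at)
      then obtain s where s: "s > 0" "\<And>t. \<bar>t - U y\<bar> < s \<Longrightarrow> \<bar>b t - b (U y)\<bar> < \<eta>"
        using isCont_real_near[OF _ \<eta>, of "U y" b] by (auto simp: dist_real_def)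
      have "isCont U y" using UV V True by (simp add: continuous_on_eq_continuous_at)
      then obtain r1 where r1: "r1 > 0" "\<And>z. dist z y < r1 \<Longrightarrow> \<bar>U z - U y\<bar> < s / 2"
        using isCont_real_near[OF _ half_gt_zero] s(1) by blast
      have "\<bar>b (v m z) * \<phi> z - b (U y) * \<phi> y\<bar> \<le> \<eta> * (1 + M)"
        if "e m < min r (r1 / 2)" "dist y z < e m" for m z
      proof -
        have "\<bar>v m z - U y\<bar> \<le> s / 2"
        proof (rule v_near)
          fix w assume "dist z w < e m"
          then have "dist w y < r1" using that dist_triangle[of w y z] by (simp add: dist_commute)
          then show "\<bar>U w - U y\<bar> \<le> s / 2" using r1(2) by fastforce
        qed
        then have 1: "\<bar>b (v m z) - b (U y)\<bar> \<le> \<eta>" using s(1) s(2)[of "v m z"] by simp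
        have 2: "\<bar>\<phi> z - \<phi> y\<bar> \<le> \<eta>" using that r(2)[of z] by (simp add: dist_commute)
        have "b (v m z) * \<phi> z - b (U y) * \<phi> y = b (v m z) * (\<phi> z - \<phi> y) + (b (v m z) - b (U y)) * \<phi> y"
          by (simp add: algebra_simps)
        also have "\<bar>\<dots>\<bar> \<le> \<bar>b (v m z)\<bar> * \<bar>\<phi> z - \<phi> y\<bar> + \<bar>b (v m z) - b (U y)\<bar> * \<bar>\<phi> y\<bar>"
          using abs_triangle_ineq by (simp add: abs_mult[symmetric])
        also have "\<dots> \<le> 1 * \<eta> + \<eta> * M"
          using \<eta> M0 by (intro add_mono mult_mono 1 2 M b1) auto
        finally show ?thesis by (simp add: algebra_simps)
      qed
      then show ?thesis using r(1) r1(1) by (intro exI[of _ "min r (r1 / 2)"]) auto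
    qed
    then obtain r' where r': "r' > 0"
      "\<And>m z. e m < r' \<Longrightarrow> dist y z < e m \<Longrightarrow> \<bar>b (v m z) * \<phi> z - b (U y) * \<phi> y\<bar> \<le> \<eta> * (1 + M)"
      by blast
    from LIMSEQ_D[OF e0 r'(1)] obtain N where N: "\<And>m. m \<ge> N \<Longrightarrow> e m < r'" using e(1) by fastforce
    have "\<bar>q m y - b (U y) * \<phi> y\<bar> \<le> \<eta> * (1 + M)" if "m \<ge> N" for m
      by (rule q_near) (use N[OF that] r'(2) in blast)
    moreover have "\<eta> * (1 + M) = \<eta>0 / 2" using M0 by (simp add: \<eta>_def divide_simps)
    then have "\<eta> * (1 + M) < \<eta>0" using \<eta>0 by simp
    ultimately show "\<exists>N. \<forall>m\<ge>N. norm (q m y - b (U y) * \<phi> y) < \<eta>0"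
      by (intro exI[of _ N] allI impI, unfold real_norm_def) (rule le_less_trans)
  qed
  have swap: "(LINT x|lborel. b (v m x) * (LINT y|lborel. g y * \<rho> m (y - x)) * \<phi> x) = (LINT y|lborel. g y * q m y)" for m
  proof -
    have s: "\<rho> m x = 0" if "x \<notin> cball 0 (e m)" for x using supp[of m x] that by simp
    obtain C where C: "\<And>x. \<bar>\<rho> m x\<bar> \<le> C"
      using continuous_compact_support_bounded[OF compact_cball c\<rho> s] by blast
    have "integrable (lborel \<Otimes>\<^sub>M lborel) (\<lambda>p. (b (v m (fst p)) * \<rho> m (snd p - fst p)) * (case p of (x, y) \<Rightarrow> \<phi> x * g y))"
    proof (rule integrable_mult_bounded[OF integrable_pair_product[OF \<phi>int g]])
      show "\<bar>b (v m (fst p)) * \<rho> m (snd p - fst p)\<bar> \<le> 1 * C" for p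
        unfolding abs_mult by (intro mult_mono b1 C) auto
    qed measurable
    then have "integrable (lborel \<Otimes>\<^sub>M lborel) (\<lambda>(x, y). b (v m x) * (g y * \<rho> m (y - x)) * \<phi> x)"
      by (simp add: case_prod_beta' mult_ac)
    from lborel_pair.Fubini_integral[OF this]
    have "(LINT x|lborel. LINT y|lborel. b (v m x) * (g y * \<rho> m (y - x)) * \<phi> x) =
        (LINT y|lborel. LINT x|lborel. b (v m x) * (g y * \<rho> m (y - x)) * \<phi> x)" by simp
    also have "\<dots> = (LINT y|lborel. LINT x|lborel. g y * (b (v m x) * \<phi> x * \<rho> m (x - y)))"
    proof (intro Bochner_Integration.integral_cong refl)
      fix x y
      have "\<rho> m (y - x) = \<rho> m (x - y)" using even[of m "x - y"] by simp
      then show "b (v m x) * (g y * \<rho> m (y - x)) * \<phi> x = g y * (b (v m x) * \<phi> x * \<rho> m (x - y))"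
        by (simp add: mult_ac)
    qed
    also have "\<dots> = (LINT y|lborel. g y * q m y)" by (simp add: q_def)
    finally show ?thesis by simp
  qed
  have "(\<lambda>m. LINT y|lborel. g y * q m y) \<longlonglongrightarrow> (LINT y|lborel. g y * (b (U y) * \<phi> y))"
  proof (rule integral_dominated_convergence[where w = "\<lambda>y. \<bar>g y\<bar> * M"])
    show "AE y in lborel. (\<lambda>m. g y * q m y) \<longlonglongrightarrow> g y * (b (U y) * \<phi> y)"
      by (intro AE_I2 tendsto_mult tendsto_const q_lim)
    show "AE y in lborel. norm (g y * q m y) \<le> \<bar>g y\<bar> * M" for m
      using qM by (intro AE_I2) (simp add: abs_mult mult_left_mono)
  qed (use g in auto)
  then have l2: "(\<lambda>m. LINT x|lborel. b (v m x) * (LINT y|lborel. g y * \<rho> m (y - x)) * \<phi> x) \<longlonglongrightarrow>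
      (LINT y|lborel. b (U y) * g y * \<phi> y)"
    unfolding swap by (simp add: mult_ac)
  show ?thesis
  proof (rule LIMSEQ_le[OF l2 l1], intro exI allI impI)
    fix m
    have "cball x (e m) \<subseteq> V" if "x \<in> K" for x
    proof -
      have "cball x (e m) \<subseteq> cball x d" using e(2) by (rule subset_cball)
      then show ?thesis using d(2) that by blast
    qed
    from kato_mollified[OF U B eq sm nonneg e(1) supp \<rho>int \<phi> this convex b1 cont]
    show "(LINT x|lborel. b (v m x) * (LINT y|lborel. g y * \<rho> m (y - x)) * \<phi> x) \<le>
        (LINT x|lborel. \<beta> (v m x) * L x)"
      unfolding v_def .
  qed
qed

section \<open>A test function modelled on the Yukawa kernel\<close>

text \<open>
  Radial functions are written in terms of the squared distance \<open>q\<close>, which is smooth at the centre. In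
  this variable the Laplacian is \<open>2 n H' + 4 q H''\<close> in dimension \<open>n\<close>.
\<close>

lemma C2_compact_radial:
  fixes p :: "'a::euclidean_space"
  assumes H: "\<And>q. q \<ge> 0 \<Longrightarrow> (H has_real_derivative H1 q) (at q)"
    and H1: "\<And>q. q \<ge> 0 \<Longrightarrow> (H1 has_real_derivative H2 q) (at q)"
    and H2: "continuous_on {0..} H2" and zero: "\<And>q. q \<ge> r\<^sup>2 \<Longrightarrow> H q = 0" and r: "r > 0"
  shows "C2_compact (cball p r) (\<lambda>x. H ((norm (x - p))\<^sup>2))
    (\<lambda>x. 2 * real DIM('a) * H1 ((norm (x - p))\<^sup>2) + 4 * (norm (x - p))\<^sup>2 * H2 ((norm (x - p))\<^sup>2))"
  unfolding C2_compact_def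
proof (intro conjI)
  define Q where "Q x = (norm (x - p))\<^sup>2" for x :: 'a
  have Q0: "Q x \<ge> 0" for x by (simp add: Q_def)
  have cQ: "continuous_on UNIV Q" unfolding Q_def by (intro continuous_intros)
  have cH: "continuous_on {0..} H" "continuous_on {0..} H1"
    by (auto intro!: continuous_at_imp_continuous_on DERIV_isCont[OF H] DERIV_isCont[OF H1])
  have comp: "continuous_on UNIV (\<lambda>x. f (Q x))" if "continuous_on {0..} f" for f :: "real \<Rightarrow> real"
    by (rule continuous_on_compose2[OF that cQ]) (auto simp: Q0)
  have dQ: "((\<lambda>t. Q (x + t *\<^sub>R i)) has_real_derivative 2 * ((x - p) \<bullet> i)) (at 0)" if "i \<in> Basis" for x i
  proof -
    have "Q (x + t *\<^sub>R i) = Q x + 2 * t * ((x - p) \<bullet> i) + t\<^sup>2" for t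
      using that unfolding Q_def power2_norm_eq_inner
      by (simp add: inner_diff_left inner_diff_right inner_add_left inner_add_right inner_commute
          power2_eq_square algebra_simps)
    then show ?thesis by (auto intro!: derivative_eq_intros)
  qed
  have chain: "((\<lambda>t. f (Q (x + t *\<^sub>R i))) has_real_derivative f' (Q x) * (2 * ((x - p) \<bullet> i))) (at 0)"
    if "i \<in> Basis" "\<And>q. q \<ge> 0 \<Longrightarrow> (f has_real_derivative f' q) (at q)" for f f' x i
  proof -
    have "(f has_real_derivative f' (Q x)) (at (Q (x + 0 *\<^sub>R i)))" using that(2)[OF Q0[of x]] by simp
    from DERIV_chain2[OF this dQ[OF that(1)]] show ?thesis .
  qed
  show "compact (cball p r)" by simp
  show "continuous_on UNIV (\<lambda>x. H ((norm (x - p))\<^sup>2))" using comp[OF cH(1)] by (simp add: Q_def)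
  show "\<forall>x. x \<notin> cball p r \<longrightarrow> H ((norm (x - p))\<^sup>2) = 0"
  proof (intro allI impI zero)
    fix x assume "x \<notin> cball p r"
    then show "r\<^sup>2 \<le> (norm (x - p))\<^sup>2" using r by (intro power_mono) (auto simp: dist_norm norm_minus_commute)
  qed
  define d1 where "d1 i x = H1 (Q x) * (2 * ((x - p) \<bullet> i))" for i x
  define d2 where "d2 i x = 2 * H1 (Q x) + 4 * ((x - p) \<bullet> i)\<^sup>2 * H2 (Q x)" for i x
  have D1: "((\<lambda>t. H (Q (x + t *\<^sub>R i))) has_real_derivative d1 i x) (at 0)" if "i \<in> Basis" for i x
    unfolding d1_def by (rule chain[OF that H])
  have D2: "((\<lambda>t. d1 i (x + t *\<^sub>R i)) has_real_derivative d2 i x) (at 0)" if "i \<in> Basis" for i x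
  proof -
    have lin: "((\<lambda>t. 2 * ((x + t *\<^sub>R i - p) \<bullet> i)) has_real_derivative 2) (at 0)"
      using that by (auto intro!: derivative_eq_intros simp: inner_diff_left inner_add_left)
    show ?thesis
      unfolding d1_def d2_def
      by (rule DERIV_cong[OF DERIV_mult[OF chain[OF that H1] lin]])
        (simp_all add: power2_eq_square algebra_simps)
  qed
  have C2: "continuous_on UNIV (d2 i)" for i
    unfolding d2_def by (intro continuous_intros comp cH H2)
  have S: "(\<Sum>i\<in>Basis. d2 i x) = 2 * real DIM('a) * H1 (Q x) + 4 * Q x * H2 (Q x)" for x
  proof -
    have "(\<Sum>i\<in>Basis. ((x - p) \<bullet> i)\<^sup>2) = Q x"
      unfolding Q_def power2_norm_eq_inner by (simp add: euclidean_inner[of "x - p" "x - p"] power2_eq_square)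
    then show ?thesis
      unfolding d2_def by (simp add: sum.distrib sum_distrib_left[symmetric] sum_distrib_right[symmetric])
  qed
  show "\<exists>d1 d2. (\<forall>i\<in>Basis.
          (\<forall>x. ((\<lambda>t. H ((norm (x + t *\<^sub>R i - p))\<^sup>2)) has_real_derivative d1 i x) (at 0)) \<and>
          (\<forall>x. ((\<lambda>t. d1 i (x + t *\<^sub>R i)) has_real_derivative d2 i x) (at 0)) \<and>
          continuous_on UNIV (d2 i)) \<and>
      (\<lambda>x. 2 * real DIM('a) * H1 ((norm (x - p))\<^sup>2) + 4 * (norm (x - p))\<^sup>2 * H2 ((norm (x - p))\<^sup>2)) =
      (\<lambda>x. \<Sum>i\<in>Basis. d2 i x)"
    by (rule exI[of _ d1], rule exI[of _ d2])
      (use D1 D2 C2 S in \<open>auto simp: Q_def fun_eq_iff\<close>)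
qed

lemma positive_part_power_deriv:
  "((\<lambda>t::real. (max 0 t) ^ Suc (Suc n)) has_real_derivative real (Suc (Suc n)) * (max 0 t) ^ Suc n) (at t)"
proof -
  consider "t > 0" | "t < 0" | "t = 0" by linarith
  then show ?thesis
  proof cases
    case 1
    have "((\<lambda>t::real. t ^ Suc (Suc n)) has_real_derivative real (Suc (Suc n)) * t ^ Suc n) (at t)"
      by (rule DERIV_cong[OF DERIV_pow]) simp
    then have "((\<lambda>t::real. (max 0 t) ^ Suc (Suc n)) has_real_derivative real (Suc (Suc n)) * t ^ Suc n) (at t)"
      by (rule has_field_derivative_transform_within_open[where S = "{0<..}"]) (use 1 in auto)
    then show ?thesis using 1 by simp
  next
    case 2
    have "((\<lambda>t::real. 0::real) has_real_derivative 0) (at t)" by simp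
    then have "((\<lambda>t::real. (max 0 t) ^ Suc (Suc n)) has_real_derivative 0) (at t)"
      by (rule has_field_derivative_transform_within_open[where S = "{..<0}"]) (use 2 in auto)
    then show ?thesis using 2 by simp
  next
    case 3
    have "((\<lambda>h::real. (max 0 h) ^ Suc n * (max 0 h / h)) \<longlongrightarrow> 0) (at 0)"
    proof (rule Lim_null_comparison)
      show "\<forall>\<^sub>F h::real in at 0. norm ((max 0 h) ^ Suc n * (max 0 h / h)) \<le> (max 0 h) ^ Suc n"
        by (intro always_eventually allI) (auto simp: abs_mult max_def)
      have "((\<lambda>h::real. (max 0 h) ^ Suc n) \<longlongrightarrow> (max 0 0) ^ Suc n) (at 0)"
        by (intro tendsto_intros)
      then show "((\<lambda>h::real. (max 0 h) ^ Suc n) \<longlongrightarrow> 0) (at 0)" by simp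
    qed
    then show ?thesis using 3 by (simp add: DERIV_def mult.commute mult.left_commute)
  qed
qed

lemma yukawa_derivs:
  fixes l a q :: real
  assumes a: "q + a > 0"
  defines "s \<equiv> \<lambda>q. sqrt (q + a)"
  shows "((\<lambda>q. exp (- l * s q) / s q) has_real_derivative
      - (1 / 2) * exp (- l * s q) * (l / s q ^ 2 + 1 / s q ^ 3)) (at q)"
    and "((\<lambda>q. - (1 / 2) * exp (- l * s q) * (l / s q ^ 2 + 1 / s q ^ 3)) has_real_derivative
      1 / 4 * exp (- l * s q) * (l\<^sup>2 / s q ^ 3 + 3 * l / s q ^ 4 + 3 / s q ^ 5)) (at q)"
proof -
  have s0: "s q > 0" using a by (simp add: s_def)
  have ds: "(s has_real_derivative 1 / (2 * s q)) (at q)"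
    unfolding s_def using a by (auto intro!: derivative_eq_intros simp: field_simps)
  have ch: "((\<lambda>q. f (s q)) has_real_derivative f' * (1 / (2 * s q))) (at q)"
    if "(f has_real_derivative f') (at (s q))" for f f'
    by (rule DERIV_chain2[OF that ds])
  have 1: "((\<lambda>s. exp (- l * s) / s) has_real_derivative - exp (- l * s) * (l / s + 1 / s ^ 2)) (at s)"
    if "s > 0" for s
    using that by (auto intro!: derivative_eq_intros simp: field_simps power2_eq_square)
  have 2: "((\<lambda>s. - (1 / 2) * exp (- l * s) * (l / s ^ 2 + 1 / s ^ 3)) has_real_derivative
      1 / 2 * exp (- l * s) * (l\<^sup>2 / s ^ 2 + 3 * l / s ^ 3 + 3 / s ^ 4)) (at s)" if "s > 0" for s
    using that by (auto intro!: derivative_eq_intros simp: field_simps eval_nat_numeral)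
  show "((\<lambda>q. exp (- l * s q) / s q) has_real_derivative
      - (1 / 2) * exp (- l * s q) * (l / s q ^ 2 + 1 / s q ^ 3)) (at q)"
    by (rule DERIV_cong[OF ch[OF 1[OF s0]]]) (use s0 in \<open>simp add: field_simps eval_nat_numeral\<close>)
  show "((\<lambda>q. - (1 / 2) * exp (- l * s q) * (l / s q ^ 2 + 1 / s q ^ 3)) has_real_derivative
      1 / 4 * exp (- l * s q) * (l\<^sup>2 / s q ^ 3 + 3 * l / s q ^ 4 + 3 / s q ^ 5)) (at q)"
    by (rule DERIV_cong[OF ch[OF 2[OF s0]]]) (use s0 in \<open>simp add: field_simps eval_nat_numeral\<close>)
qed

text \<open>
  In dimension three \<open>exp (- l * s) / s\<close> with \<open>s = \<bar>x - p\<bar>\<close> is a multiple of the fundamental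
  solution of \<open>l\<^sup>2 - \<Delta>\<close> with pole \<open>p\<close>. Here \<open>s\<close> is regularised to \<open>sqrt (\<bar>x - p\<bar>\<^sup>2 + \<delta>\<^sup>2)\<close>, and
  the kernel is multiplied by the cut-off \<open>(1 - \<bar>x - p\<bar>\<^sup>2 / r\<^sup>2)\<^sup>3\<close>. Applying \<open>l\<^sup>2 - \<Delta>\<close> gives the explicit
  approximate Dirac measure \<open>m\<close> and an error from derivatives of the cut-off. The error contains no
  second derivative of the kernel and is therefore of the size of the kernel \<open>K\<close> itself. The exponent of
  \<open>K\<close> is halved to absorb the factor \<open>l\<close> that comes from differentiating the kernel once.
\<close>

lemma yukawa_kernel:
  fixes p :: "'a::euclidean_space" and l r \<delta> :: real
  assumes dim: "DIM('a) = 3" and l: "l > 0" and r: "r > 0" and \<delta>: "\<delta> > 0"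
  defines "K \<equiv> \<lambda>x. exp (- (l / 2) * sqrt ((norm (x - p))\<^sup>2 + \<delta>\<^sup>2)) / sqrt ((norm (x - p))\<^sup>2 + \<delta>\<^sup>2)"
  obtains \<phi> L m :: "'a \<Rightarrow> real" where
    "C2_compact (cball p r) \<phi> L" "\<And>x. 0 \<le> \<phi> x" "\<And>x. \<phi> x \<le> K x"
    "continuous_on UNIV m" "\<And>x. 0 \<le> m x" "\<And>x. x \<notin> cball p r \<Longrightarrow> m x = 0"
    "\<And>x. \<bar>l\<^sup>2 * \<phi> x - L x - m x\<bar> \<le> 78 / r\<^sup>2 * K x"
    "\<And>x. norm (x - p) \<le> \<delta> \<Longrightarrow> \<delta> \<le> r / 2 \<Longrightarrow> l * \<delta> \<le> 1 / 2 \<Longrightarrow> 1 / (200 * \<delta> ^ 3) \<le> m x"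
    "\<And>x d. d > 0 \<Longrightarrow> d \<le> norm (x - p) \<Longrightarrow> m x \<le> \<delta>\<^sup>2 * (l\<^sup>2 / d ^ 3 + 3 * l / d ^ 4 + 3 / d ^ 5)"
proof -
  define s where "s q = sqrt (q + \<delta>\<^sup>2)" for q
  define h0 where "h0 q = max 0 (1 - q / r\<^sup>2)" for q :: real
  define G where "G q = exp (- l * s q) / s q" for q
  define G1 where "G1 q = - (1 / 2) * exp (- l * s q) * (l / s q ^ 2 + 1 / s q ^ 3)" for q
  define G2 where "G2 q = 1 / 4 * exp (- l * s q) * (l\<^sup>2 / s q ^ 3 + 3 * l / s q ^ 4 + 3 / s q ^ 5)" for q
  define \<eta> where "\<eta> q = h0 q ^ 3" for q
  define \<eta>1 where "\<eta>1 q = - (3 / r\<^sup>2) * h0 q ^ 2" for q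
  define \<eta>2 where "\<eta>2 q = 6 / r ^ 4 * h0 q" for q
  have s: "s q > 0" "s q ^ 2 = q + \<delta>\<^sup>2" if "q \<ge> 0" for q
    using that \<delta> unfolding s_def by (simp_all add: add_nonneg_pos)
  have dG: "(G has_real_derivative G1 q) (at q)" "(G1 has_real_derivative G2 q) (at q)" if "q \<ge> 0" for q
  proof -
    have "q + \<delta>\<^sup>2 > 0" using that \<delta> by (simp add: add_nonneg_pos)
    from yukawa_derivs[OF this, of l]
    show "(G has_real_derivative G1 q) (at q)" "(G1 has_real_derivative G2 q) (at q)"
      unfolding G_def G1_def G2_def s_def by simp_all
  qed
  have dh: "((\<lambda>q. 1 - q / r\<^sup>2) has_real_derivative - (1 / r\<^sup>2)) (at q)" for q
    using r by (auto intro!: derivative_eq_intros simp: eval_nat_numeral)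
  have d\<eta>: "(\<eta> has_real_derivative \<eta>1 q) (at q)" for q
    using DERIV_chain2[OF positive_part_power_deriv[of 1] dh[of q]]
    unfolding \<eta>_def \<eta>1_def h0_def by (simp add: eval_nat_numeral)
  have d\<eta>1: "(\<eta>1 has_real_derivative \<eta>2 q) (at q)" for q
    using DERIV_cmult[OF DERIV_chain2[OF positive_part_power_deriv[of 0] dh[of q]], of "- (3 / r\<^sup>2)"]
    unfolding \<eta>1_def \<eta>2_def h0_def using r by (simp add: eval_nat_numeral mult.assoc)
  define H where "H q = G q * \<eta> q" for q
  define H1 where "H1 q = G1 q * \<eta> q + G q * \<eta>1 q" for q
  define H2 where "H2 q = G2 q * \<eta> q + 2 * G1 q * \<eta>1 q + G q * \<eta>2 q" for q
  have dH: "(H has_real_derivative H1 q) (at q)" if "q \<ge> 0" for q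
    unfolding H_def H1_def by (rule DERIV_cong[OF DERIV_mult[OF dG(1)[OF that] d\<eta>]]) simp
  have dH1: "(H1 has_real_derivative H2 q) (at q)" if "q \<ge> 0" for q
    unfolding H1_def H2_def
    by (rule DERIV_cong[OF DERIV_add[OF DERIV_mult[OF dG(2)[OF that] d\<eta>] DERIV_mult[OF dG(1)[OF that] d\<eta>1]]]) simp
  have cs: "continuous_on {0..} s" unfolding s_def by (intro continuous_intros)
  have ch: "continuous_on {0..} h0" unfolding h0_def using r by (intro continuous_intros) auto
  have s_ne: "s q \<noteq> 0" if "q \<ge> 0" for q using s(1)[of q] that by simp
  have cG: "continuous_on {0..} G" "continuous_on {0..} G1" "continuous_on {0..} G2"
    unfolding G_def G1_def G2_def by (auto intro!: continuous_intros cs simp: s_ne)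
  have c\<eta>: "continuous_on {0..} \<eta>" "continuous_on {0..} \<eta>1" "continuous_on {0..} \<eta>2"
    unfolding \<eta>_def \<eta>1_def \<eta>2_def using r by (auto intro!: continuous_intros ch)
  have cH2: "continuous_on {0..} H2" unfolding H2_def by (intro continuous_intros cG c\<eta>)
  have h00: "h0 q = 0" if "q \<ge> r\<^sup>2" for q using that r by (simp add: h0_def field_simps)
  have h01: "0 \<le> h0 q" "h0 q \<le> 1" if "q \<ge> 0" for q using that by (auto simp: h0_def)
  have \<eta>01: "0 \<le> \<eta> q" "\<eta> q \<le> 1" if "q \<ge> 0" for q
    using h01[OF that] by (auto simp: \<eta>_def power_le_one)
  have H0: "H q = 0" if "q \<ge> r\<^sup>2" for q using h00[OF that] by (simp add: H_def \<eta>_def)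
  define Q where "Q x = (norm (x - p))\<^sup>2" for x
  have Q0: "Q x \<ge> 0" for x by (simp add: Q_def)
  have cQ: "continuous_on UNIV Q" unfolding Q_def by (intro continuous_intros)
  define L where "L x = 6 * H1 (Q x) + 4 * Q x * H2 (Q x)" for x
  define m where "m x = 4 * \<delta>\<^sup>2 * G2 (Q x) * \<eta> (Q x)" for x
  have C: "C2_compact (cball p r) (\<lambda>x. H (Q x)) L"
    using C2_compact_radial[OF dH dH1 cH2 H0 r, of p] dim by (simp add: Q_def L_def[abs_def])
  have G0: "G q \<ge> 0" if "q \<ge> 0" for q using s(1)[OF that] by (simp add: G_def)
  have K: "K x = exp (- (l / 2) * s (Q x)) / s (Q x)" for x by (simp add: K_def s_def Q_def)
  have GK: "exp (- l * s q) / s q \<le> exp (- (l / 2) * s q) / s q" if "q \<ge> 0" for q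
    using s(1)[OF that] l by (intro divide_right_mono) auto
  have LGK: "l * exp (- l * s q) \<le> 2 * (exp (- (l / 2) * s q) / s q)" if "q \<ge> 0" for q
  proof -
    define t where "t = l / 2 * s q"
    have "t \<le> exp t" using exp_ge_add_one_self[of t] by linarith
    then have "t * exp (- t) \<le> 1"
      by (simp add: exp_minus field_simps)
    then have "t * exp (- t) * exp (- t) \<le> 1 * exp (- t)" by (intro mult_right_mono) auto
    then have "t * exp (- (2 * t)) \<le> exp (- t)" by (simp add: mult.assoc exp_add[symmetric])
    then have "l / 2 * s q * exp (- l * s q) \<le> exp (- (l / 2) * s q)" by (simp add: t_def)
    then show ?thesis using s(1)[OF that] by (simp add: field_simps)
  qed
  have error: "\<bar>l\<^sup>2 * H q - (6 * H1 q + 4 * q * H2 q) - 4 * \<delta>\<^sup>2 * G2 q * \<eta> q\<bar>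
      \<le> 78 / r\<^sup>2 * (exp (- (l / 2) * s q) / s q)" if q: "q \<ge> 0" for q
  proof -
    let ?e = "exp (- l * s q)"
    note s = s[OF q]
    \<comment> \<open>With \<open>s\<^sup>2\<close> in place of \<open>q\<close> this is the equation of the exact kernel; the difference
      \<open>\<delta>\<^sup>2 = s\<^sup>2 - q\<close> is what produces \<open>m\<close>.\<close>
    have yuk: "l\<^sup>2 * G q - 6 * G1 q - 4 * (s q ^ 2) * G2 q = 0"
      unfolding G_def G1_def G2_def using s(1)
      by (simp add: field_simps eval_nat_numeral)
    have "l\<^sup>2 * H q - (6 * H1 q + 4 * q * H2 q) - 4 * \<delta>\<^sup>2 * G2 q * \<eta> q =
        (l\<^sup>2 * G q - 6 * G1 q - 4 * (q + \<delta>\<^sup>2) * G2 q) * \<eta> q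
        - (8 * q * G1 q * \<eta>1 q + G q * (6 * \<eta>1 q + 4 * q * \<eta>2 q))"
      unfolding H_def H1_def H2_def by (simp add: algebra_simps)
    also have "\<dots> = - (8 * q * G1 q * \<eta>1 q + G q * (6 * \<eta>1 q + 4 * q * \<eta>2 q))"
      using yuk s(2) by simp
    finally have E: "\<bar>l\<^sup>2 * H q - (6 * H1 q + 4 * q * H2 q) - 4 * \<delta>\<^sup>2 * G2 q * \<eta> q\<bar> =
        \<bar>8 * q * G1 q * \<eta>1 q + G q * (6 * \<eta>1 q + 4 * q * \<eta>2 q)\<bar>" by simp
    have b1: "\<bar>\<eta>1 q\<bar> \<le> 3 / r\<^sup>2"
      using h01[OF q] r mult_left_mono[of "h0 q ^ 2" 1 "3 / r\<^sup>2"] by (simp add: \<eta>1_def abs_mult power_le_one)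
    have b2: "\<bar>q * \<eta>2 q\<bar> \<le> 6 / r\<^sup>2"
    proof (cases "q \<ge> r\<^sup>2")
      case True
      then show ?thesis using h00 r by (simp add: \<eta>2_def)
    next
      case False
      have "q * \<eta>2 q \<le> r\<^sup>2 * (6 / r ^ 4 * 1)"
        unfolding \<eta>2_def using False h01[OF q] q r by (intro mult_mono) auto
      also have "\<dots> = 6 / r\<^sup>2" using r by (simp add: field_simps eval_nat_numeral)
      finally show ?thesis using q h01[OF q] r by (simp add: \<eta>2_def)
    qed
    have b3: "\<bar>q * G1 q\<bar> \<le> 1 / 2 * ?e * (l + 1 / s q)"
    proof -
      have "\<bar>q * G1 q\<bar> = q * (1 / 2 * ?e * (l / s q ^ 2 + 1 / s q ^ 3))"
        using q s(1) l by (simp add: G1_def abs_mult)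
      also have "\<dots> \<le> s q ^ 2 * (1 / 2 * ?e * (l / s q ^ 2 + 1 / s q ^ 3))"
      proof (rule mult_right_mono)
        show "q \<le> (s q)\<^sup>2" using s(2) by simp
        show "0 \<le> 1 / 2 * ?e * (l / s q ^ 2 + 1 / s q ^ 3)"
          using s(1) l by (intro mult_nonneg_nonneg add_nonneg_nonneg divide_nonneg_pos) auto
      qed
      also have "\<dots> = 1 / 2 * ?e * (l + 1 / s q)"
        using s(1) by (simp add: field_simps eval_nat_numeral)
      finally show ?thesis .
    qed
    have "\<bar>8 * q * G1 q * \<eta>1 q\<bar> = 8 * (\<bar>q * G1 q\<bar> * \<bar>\<eta>1 q\<bar>)" by (simp add: abs_mult)
    also have "\<dots> \<le> 8 * ((1 / 2 * ?e * (l + 1 / s q)) * (3 / r\<^sup>2))"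
      using s(1) l by (intro mult_left_mono mult_mono b1 b3) auto
    also have "\<dots> = 12 / r\<^sup>2 * (l * ?e + ?e / s q)" by (simp add: algebra_simps add_divide_distrib)
    finally have t1: "\<bar>8 * q * G1 q * \<eta>1 q\<bar> \<le> 12 / r\<^sup>2 * (l * ?e + ?e / s q)" .
    have "\<bar>6 * \<eta>1 q + 4 * (q * \<eta>2 q)\<bar> \<le> 6 * (3 / r\<^sup>2) + 4 * (6 / r\<^sup>2)"
      using b1 b2 by linarith
    then have "\<bar>G q * (6 * \<eta>1 q + 4 * q * \<eta>2 q)\<bar> \<le> (?e / s q) * (6 * (3 / r\<^sup>2) + 4 * (6 / r\<^sup>2))"
      unfolding abs_mult using G0[OF q] by (intro mult_mono) (auto simp: G_def mult.assoc)
    then have t2: "\<bar>G q * (6 * \<eta>1 q + 4 * q * \<eta>2 q)\<bar> \<le> 42 / r\<^sup>2 * (?e / s q)" by (simp add: mult_ac)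
    have "\<bar>8 * q * G1 q * \<eta>1 q + G q * (6 * \<eta>1 q + 4 * q * \<eta>2 q)\<bar> \<le>
        12 / r\<^sup>2 * (l * ?e + ?e / s q) + 42 / r\<^sup>2 * (?e / s q)"
      using t1 t2 by linarith
    also have "\<dots> = 12 / r\<^sup>2 * (l * ?e) + 54 / r\<^sup>2 * (?e / s q)" by (simp add: algebra_simps)
    also have "\<dots> \<le> 12 / r\<^sup>2 * (2 * (exp (- (l / 2) * s q) / s q)) + 54 / r\<^sup>2 * (exp (- (l / 2) * s q) / s q)"
      by (intro add_mono mult_left_mono LGK[OF q] GK[OF q]) auto
    also have "\<dots> = 78 / r\<^sup>2 * (exp (- (l / 2) * s q) / s q)" by simp
    finally show ?thesis unfolding E .
  qed
  have G2pos: "G2 q \<ge> 0" if "q \<ge> 0" for q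
    using s(1)[OF that] l unfolding G2_def by (intro mult_nonneg_nonneg add_nonneg_nonneg) auto
  show ?thesis
  proof (rule that[OF C])
    fix x :: 'a
    show "0 \<le> H (Q x)" using G0[OF Q0] \<eta>01(1)[OF Q0] by (simp add: H_def)
    have "H (Q x) \<le> G (Q x)" using mult_left_mono[OF \<eta>01(2)[OF Q0] G0[OF Q0]] by (simp add: H_def)
    then show "H (Q x) \<le> K x" using GK[OF Q0[of x]] by (simp add: K G_def)
    have comp: "continuous_on UNIV (\<lambda>x. f (Q x))" if "continuous_on {0..} f" for f :: "real \<Rightarrow> real"
      by (rule continuous_on_compose2[OF that cQ]) (auto simp: Q0)
    show "continuous_on UNIV m" unfolding m_def by (intro continuous_intros comp cG c\<eta>)
    show "0 \<le> m x" using G2pos[OF Q0[of x]] \<eta>01(1)[OF Q0[of x]] by (simp add: m_def)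
    show "m x = 0" if "x \<notin> cball p r"
    proof -
      have "r\<^sup>2 \<le> Q x" unfolding Q_def using that r by (intro power_mono) (auto simp: dist_norm norm_minus_commute)
      then show ?thesis using h00 by (simp add: m_def \<eta>_def)
    qed
    show "\<bar>l\<^sup>2 * H (Q x) - L x - m x\<bar> \<le> 78 / r\<^sup>2 * K x"
      using error[OF Q0] by (simp add: L_def m_def K)
    show "1 / (200 * \<delta> ^ 3) \<le> m x" if "norm (x - p) \<le> \<delta>" "\<delta> \<le> r / 2" "l * \<delta> \<le> 1 / 2"
    proof -
      let ?s = "s (Q x)"
      have Qd: "Q x \<le> \<delta>\<^sup>2" unfolding Q_def using that(1) by (intro power_mono) auto
      have "(2 * \<delta>)\<^sup>2 = 4 * \<delta>\<^sup>2" by (simp add: power_mult_distrib)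
      then have "Q x + \<delta>\<^sup>2 \<le> (2 * \<delta>)\<^sup>2" using Qd zero_le_power2[of \<delta>] by linarith
      then have "?s \<le> sqrt ((2 * \<delta>)\<^sup>2)" unfolding s_def by (rule real_sqrt_le_mono)
      then have s2: "?s \<le> 2 * \<delta>" unfolding real_sqrt_abs using \<delta> by simp
      have "l * ?s \<le> l * (2 * \<delta>)" using s2 l by (intro mult_left_mono) auto
      then have "l * ?s \<le> 1" using that(3) by linarith
      then have "exp (- 1) \<le> exp (- l * ?s)" by simp
      moreover have "1 / 3 \<le> exp (- 1 :: real)"
        using exp_le by (simp add: exp_minus field_simps)
      ultimately have e: "1 / 3 \<le> exp (- l * ?s)" by linarith
      have "3 / (2 * \<delta>) ^ 5 \<le> 3 / ?s ^ 5"
        using s2 s(1)[OF Q0, of x] \<delta> by (intro divide_left_mono power_mono mult_pos_pos zero_less_power) auto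
      also have "\<dots> \<le> l\<^sup>2 / ?s ^ 3 + 3 * l / ?s ^ 4 + 3 / ?s ^ 5" using s(1)[OF Q0, of x] l by simp
      finally have g: "3 / (2 * \<delta>) ^ 5 \<le> l\<^sup>2 / ?s ^ 3 + 3 * l / ?s ^ 4 + 3 / ?s ^ 5" .
      have "(1 / 4) * (1 / 3) * (3 / (2 * \<delta>) ^ 5) \<le> G2 (Q x)"
        unfolding G2_def using e g \<delta> by (intro mult_mono) auto
      moreover have "(3 / 4) ^ 3 \<le> \<eta> (Q x)"
      proof -
        have "Q x \<le> (r / 2)\<^sup>2" using Qd power_mono[OF that(2), of 2] \<delta> by linarith
        then have "Q x / r\<^sup>2 \<le> 1 / 4" using r by (simp add: field_simps power2_eq_square)
        then have "3 / 4 \<le> h0 (Q x)" unfolding h0_def le_max_iff_disj by linarith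
        then show ?thesis unfolding \<eta>_def by (intro power_mono) auto
      qed
      ultimately have "4 * \<delta>\<^sup>2 * ((1 / 4) * (1 / 3) * (3 / (2 * \<delta>) ^ 5)) * (3 / 4) ^ 3 \<le> m x"
        unfolding m_def using \<delta> G2pos[OF Q0[of x]] by (intro mult_mono) auto
      moreover have "1 / (200 * \<delta> ^ 3) \<le> 4 * \<delta>\<^sup>2 * ((1 / 4) * (1 / 3) * (3 / (2 * \<delta>) ^ 5)) * (3 / 4) ^ 3"
        using \<delta> by (simp add: field_simps eval_nat_numeral)
      ultimately show ?thesis by linarith
    qed
    show "m x \<le> \<delta>\<^sup>2 * (l\<^sup>2 / d ^ 3 + 3 * l / d ^ 4 + 3 / d ^ 5)" if d: "d > 0" "d \<le> norm (x - p)" for d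
    proof -
      let ?s = "s (Q x)"
      have "norm (x - p) \<le> ?s" unfolding s_def Q_def by (intro real_le_rsqrt) simp
      then have ds: "d \<le> ?s" using d(2) by linarith
      have pw: "a / ?s ^ k \<le> a / d ^ k" if "a \<ge> 0" for a k
        using that d(1) ds by (intro divide_left_mono power_mono mult_pos_pos zero_less_power) auto
      have "exp (- l * ?s) * (l\<^sup>2 / ?s ^ 3 + 3 * l / ?s ^ 4 + 3 / ?s ^ 5) \<le>
          1 * (l\<^sup>2 / d ^ 3 + 3 * l / d ^ 4 + 3 / d ^ 5)"
        using l s(1)[OF Q0, of x] by (intro mult_mono add_mono pw) (auto simp: add_nonneg_nonneg)
      then have "4 * G2 (Q x) \<le> l\<^sup>2 / d ^ 3 + 3 * l / d ^ 4 + 3 / d ^ 5"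
        by (simp add: G2_def)
      then have "(4 * G2 (Q x)) * \<eta> (Q x) \<le> (l\<^sup>2 / d ^ 3 + 3 * l / d ^ 4 + 3 / d ^ 5) * 1"
        using G2pos[OF Q0[of x]] \<eta>01[OF Q0[of x]] d l by (intro mult_mono) auto
      from mult_left_mono[OF this zero_le_power2[of \<delta>]]
      show ?thesis unfolding m_def by (simp add: mult_ac)
    qed
  qed
qed

text \<open>
  The singularity \<open>1 / \<bar>x\<bar>\<^sup>2\<close> is integrable in dimension three and the exponential cuts the integral off
  at length \<open>1 / l\<close>. The bound is computed by the layer cake formula: writing
  \<open>exp (- l * a) / a\<^sup>2\<close> as the integral of minus its derivative over \<open>{a..}\<close> and exchanging the
  integrals reduces it to the volumes of balls.
\<close>

lemma yukawa_square_integral: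
  fixes p :: "'a::euclidean_space" and l \<delta> :: real
  assumes dim: "DIM('a) = 3" and l: "l > 0" and \<delta>: "\<delta> > 0"
  defines "K \<equiv> \<lambda>x. exp (- (l / 2) * sqrt ((norm (x - p))\<^sup>2 + \<delta>\<^sup>2)) / sqrt ((norm (x - p))\<^sup>2 + \<delta>\<^sup>2)"
  shows "integrable lborel (\<lambda>x. (K x)\<^sup>2)" "(LINT x|lborel. (K x)\<^sup>2) \<le> 3 * unit_ball_vol 3 / l"
proof -
  define V :: real where "V = unit_ball_vol 3"
  have V: "V > 0" by (simp add: V_def)
  have expk: "((\<lambda>t. (l * t) ^ k / exp (l * t)) \<longlongrightarrow> 0) at_top" for k
    by (rule filterlim_compose[OF tendsto_power_div_exp_0])
      (rule filterlim_tendsto_pos_mult_at_top[OF tendsto_const l filterlim_ident])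
  define k where "k t = exp (- l * t) * (l / t\<^sup>2 + 2 / t ^ 3)" for t
  define k2 where "k2 t = V * (exp (- l * t) * (l * t + 2))" for t
  have [measurable]: "k \<in> borel_measurable borel" "k2 \<in> borel_measurable borel"
    unfolding k_def k2_def by measurable
  have layer: "(\<integral>\<^sup>+t. ennreal (k t) * indicator {a..} t \<partial>lborel) = ennreal (exp (- l * a) / a\<^sup>2)" if a: "a > 0" for a
  proof -
    have "(\<integral>\<^sup>+t. ennreal (k t) * indicator {a..} t \<partial>lborel) = ennreal (0 - (- (exp (- l * a) / a\<^sup>2)))"
    proof (rule nn_integral_FTC_atLeast)
      show "((\<lambda>t. - (exp (- l * t) / t\<^sup>2)) has_real_derivative k t) (at t)" if "a \<le> t" for t
        using a that unfolding k_def
        by (auto intro!: derivative_eq_intros simp: field_simps eval_nat_numeral)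
      show "0 \<le> k t" if "a \<le> t" for t using a that l by (simp add: k_def)
      show "((\<lambda>t. - (exp (- l * t) / t\<^sup>2)) \<longlongrightarrow> 0) at_top"
      proof (rule Lim_null_comparison[OF _ expk[of 0]])
        show "\<forall>\<^sub>F t in at_top. norm (- (exp (- l * t) / t\<^sup>2)) \<le> (l * t) ^ 0 / exp (l * t)"
          using eventually_ge_at_top[of 1]
        proof eventually_elim
          case (elim t)
          have "1 \<le> t\<^sup>2" using elim by simp
          then have "exp (- l * t) / t\<^sup>2 \<le> exp (- l * t) / 1"
            by (intro divide_left_mono) auto
          then show ?case by (simp add: exp_minus field_simps)
        qed
      qed
    qed simp
    then show ?thesis by simp
  qed
  have total: "(\<integral>\<^sup>+t. ennreal (k2 t) * indicator {0..} t \<partial>lborel) = ennreal (3 * V / l)"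
  proof -
    have "(\<integral>\<^sup>+t. ennreal (k2 t) * indicator {0..} t \<partial>lborel) = ennreal (0 - (- V * (exp (- l * 0) * (0 + 3 / l))))"
    proof (rule nn_integral_FTC_atLeast)
      show "((\<lambda>t. - V * (exp (- l * t) * (t + 3 / l))) has_real_derivative k2 t) (at t)" for t
        using l unfolding k2_def by (auto intro!: derivative_eq_intros simp: field_simps)
      show "0 \<le> k2 t" if "0 \<le> t" for t using that V l by (simp add: k2_def)
      have "((\<lambda>t. - (V / l) * ((l * t) ^ 1 / exp (l * t)) - (3 * V / l) * ((l * t) ^ 0 / exp (l * t))) \<longlongrightarrow>
          - (V / l) * 0 - (3 * V / l) * 0) at_top"
        by (intro tendsto_intros expk)
      moreover have "- (V / l) * ((l * t) ^ 1 / exp (l * t)) - (3 * V / l) * ((l * t) ^ 0 / exp (l * t)) =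
          - V * (exp (- l * t) * (t + 3 / l))" for t
        using l by (simp add: exp_minus field_simps)
      ultimately show "((\<lambda>t. - V * (exp (- l * t) * (t + 3 / l))) \<longlongrightarrow> 0) at_top" by simp
    qed simp
    then show ?thesis by (simp add: mult.commute)
  qed
  have ball: "ennreal (k t) * emeasure lborel (cball p t) \<le> ennreal (k2 t) * indicator {0..} t" for t
  proof -
    consider "t < 0" | "t = 0" | "t > 0" by linarith
    then show ?thesis
    proof cases
      case 3
      have "ennreal (k t) * emeasure lborel (cball p t) = ennreal (k t) * ennreal (V * t ^ 3)"
        using 3 dim by (simp add: emeasure_cball V_def)
      also have "\<dots> = ennreal (k t * (V * t ^ 3))" using 3 l V by (intro ennreal_mult[symmetric]) (auto simp: k_def)
      also have "k t * (V * t ^ 3) = k2 t" using 3 by (simp add: k_def k2_def field_simps eval_nat_numeral)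
      finally show ?thesis using 3 by simp
    qed (simp_all add: k_def)
  qed
  have "(\<integral>\<^sup>+x. ennreal ((K x)\<^sup>2) \<partial>lborel) \<le> (\<integral>\<^sup>+x. (\<integral>\<^sup>+t. ennreal (k t) * indicator (cball p t) x \<partial>lborel) \<partial>lborel)"
  proof (rule nn_integral_mono_AE)
    show "AE x in lborel. ennreal ((K x)\<^sup>2) \<le> (\<integral>\<^sup>+t. ennreal (k t) * indicator (cball p t) x \<partial>lborel)"
      using AE_lborel_singleton[of p]
    proof eventually_elim
      case (elim x)
      define a where "a = norm (x - p)"
      have a: "a > 0" using elim by (simp add: a_def)
      define s where "s = sqrt (a\<^sup>2 + \<delta>\<^sup>2)"
      have sa: "a \<le> s" unfolding s_def by (intro real_le_rsqrt) simp
      have "(K x)\<^sup>2 = exp (- l * s) / s\<^sup>2"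
        unfolding K_def a_def[symmetric] s_def[symmetric]
        by (simp add: power_divide exp_of_nat_mult[symmetric] power2_eq_square exp_add[symmetric])
      also have "\<dots> \<le> exp (- l * a) / a\<^sup>2"
        using a sa l by (intro frac_le power_mono) auto
      finally have "ennreal ((K x)\<^sup>2) \<le> ennreal (exp (- l * a) / a\<^sup>2)" by (rule ennreal_leI)
      also have "\<dots> = (\<integral>\<^sup>+t. ennreal (k t) * indicator {a..} t \<partial>lborel)" by (rule layer[OF a, symmetric])
      also have "\<dots> = (\<integral>\<^sup>+t. ennreal (k t) * indicator (cball p t) x \<partial>lborel)"
        by (intro nn_integral_cong) (auto simp: a_def indicator_def dist_norm norm_minus_commute)
      finally show ?case .
    qed
  qed
  also have "\<dots> = (\<integral>\<^sup>+t. (\<integral>\<^sup>+x. ennreal (k t) * indicator (cball p t) x \<partial>lborel) \<partial>lborel)"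
  proof -
    have "(\<lambda>(x, t). ennreal (k t) * indicator {y :: 'a \<times> real. dist p (fst y) \<le> snd y} (x, t))
        \<in> borel_measurable (lborel \<Otimes>\<^sub>M lborel)"
    proof -
      have "closed {y :: 'a \<times> real. dist p (fst y) \<le> snd y}" by (intro closed_Collect_le continuous_intros)
      then have [measurable]: "{y :: 'a \<times> real. dist p (fst y) \<le> snd y} \<in> sets (borel \<Otimes>\<^sub>M borel)"
        unfolding borel_prod by (rule borel_closed)
      show ?thesis by measurable
    qed
    from lborel_pair.Fubini[OF this] show ?thesis
      by (simp add: indicator_def)
  qed
  also have "\<dots> = (\<integral>\<^sup>+t. ennreal (k t) * emeasure lborel (cball p t) \<partial>lborel)"
    by (intro nn_integral_cong nn_integral_cmult_indicator) simp
  also have "\<dots> \<le> (\<integral>\<^sup>+t. ennreal (k2 t) * indicator {0..} t \<partial>lborel)"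
    by (intro nn_integral_mono ball)
  also note total
  finally have le: "(\<integral>\<^sup>+x. ennreal ((K x)\<^sup>2) \<partial>lborel) \<le> ennreal (3 * V / l)" .
  have [measurable]: "K \<in> borel_measurable borel" unfolding K_def by measurable
  show "integrable lborel (\<lambda>x. (K x)\<^sup>2)"
    by (rule integrableI_bounded) (use le in \<open>auto simp: top_unique less_top[symmetric]\<close>)
  show "(LINT x|lborel. (K x)\<^sup>2) \<le> 3 * unit_ball_vol 3 / l"
    using le V l by (subst integral_eq_nn_integral) (auto simp: V_def intro!: enn2real_leI)
qed

section \<open>A convex profile adapted to the double well\<close>

text \<open>
  A smooth convex substitute for \<open>\<bar>t\<bar> - 1\<close>: it vanishes exactly at the two wells \<open>t = \<plusminus> 1\<close> and is
  positive exactly where \<open>\<bar>t\<bar> > 1\<close>.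
\<close>

definition soft_abs :: "real \<Rightarrow> real" where "soft_abs t = sqrt (1 + t\<^sup>2) - sqrt 2"

text \<open>
  The derivative of \<open>soft_abs\<close>.
\<close>

definition soft_sgn :: "real \<Rightarrow> real" where "soft_sgn t = t / sqrt (1 + t\<^sup>2)"

lemma deriv_W: "deriv W s = s ^ 3 - s"
proof (rule DERIV_imp_deriv)
  show "(W has_real_derivative s ^ 3 - s) (at s)"
    unfolding W_def[abs_def]
    by (auto intro!: derivative_eq_intros simp: field_simps eval_nat_numeral)
qed

lemma W_nonneg: "W s \<ge> 0" by (simp add: W_def)

lemma soft_abs_convex: "soft_abs t \<ge> soft_abs s + soft_sgn s * (t - s)"
proof -
  define y where "y = sqrt (1 + s\<^sup>2)"
  have y: "y > 0" "y\<^sup>2 = 1 + s\<^sup>2" by (simp_all add: y_def add_pos_nonneg)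
  have sg: "soft_sgn s = s / y" by (simp add: soft_sgn_def y_def)
  have "1 + s * t \<le> sqrt ((1 + s\<^sup>2) * (1 + t\<^sup>2))"
  proof (rule real_le_rsqrt)
    have "0 \<le> (t - s)\<^sup>2" by simp
    then show "(1 + s * t)\<^sup>2 \<le> (1 + s\<^sup>2) * (1 + t\<^sup>2)" by (simp add: power2_eq_square algebra_simps)
  qed
  then have "1 + s * t \<le> y * sqrt (1 + t\<^sup>2)" by (simp add: real_sqrt_mult y_def)
  moreover have "1 + s * t = y * (y + soft_sgn s * (t - s))"
    unfolding sg using y by (simp add: field_simps power2_eq_square)
  ultimately have "y * (y + soft_sgn s * (t - s)) \<le> y * sqrt (1 + t\<^sup>2)" by simp
  then have "y + soft_sgn s * (t - s) \<le> sqrt (1 + t\<^sup>2)" using y(1) by simp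
  then show ?thesis by (simp add: soft_abs_def y_def)
qed

lemma soft_sgn_bound: "\<bar>soft_sgn t\<bar> \<le> 1"
proof -
  have "\<bar>t\<bar> \<le> sqrt (1 + t\<^sup>2)" by (rule real_le_rsqrt) simp
  moreover have "sqrt (1 + t\<^sup>2) > 0" by (simp add: add_pos_nonneg)
  ultimately show ?thesis by (simp add: soft_sgn_def)
qed

lemma continuous_soft:
  "continuous_on UNIV soft_abs" "continuous_on UNIV soft_sgn"
proof -
  have "sqrt (1 + t\<^sup>2) \<noteq> 0" for t :: real by (smt (verit) real_sqrt_eq_0_iff zero_le_power2)
  then show "continuous_on UNIV soft_abs" "continuous_on UNIV soft_sgn"
    unfolding soft_abs_def[abs_def] soft_sgn_def[abs_def] by (auto intro!: continuous_intros)
qed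

text \<open>
  In terms of \<open>y = sqrt (1 + t\<^sup>2)\<close> the left hand side is \<open>(y\<^sup>2 - 1) (y\<^sup>2 - 2) / y\<close>. This is a convex
  function of \<open>y > 0\<close> whose tangent at the zero \<open>y = sqrt 2\<close> is the right hand side. The difference,
  multiplied by \<open>y\<close>, is an explicit square times a positive quadratic.
\<close>

lemma soft_abs_dissipation: "soft_sgn t * deriv W t \<ge> 2 * soft_abs t"
proof -
  define y where "y = sqrt (1 + t\<^sup>2)"
  define c :: real where "c = sqrt 2"
  have y: "y > 0" "t\<^sup>2 = y\<^sup>2 - 1" by (simp_all add: y_def add_pos_nonneg)
  have sg: "soft_sgn t = t / y" by (simp add: soft_sgn_def y_def)
  have c: "c > 0" "c * c = 2" by (simp_all add: c_def)
  have "soft_sgn t * deriv W t = t\<^sup>2 * (t\<^sup>2 - 1) / y"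
    unfolding sg deriv_W by (simp add: field_simps eval_nat_numeral)
  also have "\<dots> = (y\<^sup>2 - 1) * (y\<^sup>2 - 2) / y" by (simp add: y(2))
  finally have e: "soft_sgn t * deriv W t = (y\<^sup>2 - 1) * (y\<^sup>2 - 2) / y" .
  have "0 \<le> (y - c)\<^sup>2 * (y\<^sup>2 + 2 * c * y + 1)"
    using y(1) c by (intro mult_nonneg_nonneg add_nonneg_nonneg) auto
  also have "\<dots> = y ^ 4 + (1 - 3 * (c * c)) * y\<^sup>2 + (2 * c * (c * c) - 2 * c) * y + c * c"
    by (simp add: power2_eq_square algebra_simps eval_nat_numeral)
  also have "\<dots> = (y\<^sup>2 - 1) * (y\<^sup>2 - 2) - 2 * (y - c) * y"
    unfolding c(2) by (simp add: power2_eq_square algebra_simps eval_nat_numeral)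
  finally have "2 * (y - c) * y \<le> (y\<^sup>2 - 1) * (y\<^sup>2 - 2)" by simp
  then have "2 * (y - c) \<le> (y\<^sup>2 - 1) * (y\<^sup>2 - 2) / y" using y(1) by (simp add: pos_le_divide_eq)
  then show ?thesis unfolding e by (simp add: soft_abs_def y_def c_def)
qed

lemma soft_abs_square_le_W: "(soft_abs t)\<^sup>2 \<le> W t"
proof -
  define y where "y = sqrt (1 + t\<^sup>2)"
  define c :: real where "c = sqrt 2"
  have y: "y \<ge> 1" "t\<^sup>2 = y\<^sup>2 - 1" by (simp_all add: y_def)
  have c: "c \<ge> 1" "c\<^sup>2 = 2" by (simp_all add: c_def)
  have "2 * \<bar>y - c\<bar> \<le> (y + c) * \<bar>y - c\<bar>" using y c by (intro mult_right_mono) auto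
  also have "\<dots> = \<bar>(y + c) * (y - c)\<bar>" using y c by (simp add: abs_mult)
  also have "(y + c) * (y - c) = y\<^sup>2 - 2" using c(2) by (simp add: power2_eq_square algebra_simps)
  finally have "2 * \<bar>y - c\<bar> \<le> \<bar>y\<^sup>2 - 2\<bar>" .
  from power_mono[OF this, of 2] have "4 * (y - c)\<^sup>2 \<le> (y\<^sup>2 - 2)\<^sup>2"
    by (simp add: power_mult_distrib)
  moreover have "soft_abs t = y - c" by (simp add: soft_abs_def y_def c_def)
  moreover have "W t = 1 / 4 * (y\<^sup>2 - 2)\<^sup>2" by (simp add: W_def y(2))
  ultimately show ?thesis by simp
qed

lemma soft_abs_lower: "soft_abs t \<ge> - 1"
proof -
  have "1 \<le> sqrt (1 + t\<^sup>2)" by simp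
  moreover have "sqrt 2 \<le> 2" by (rule real_le_lsqrt) simp_all
  ultimately show ?thesis unfolding soft_abs_def by linarith
qed

lemma soft_abs_upper: "\<bar>soft_abs t\<bar> \<le> 1 + \<bar>t\<bar>"
proof -
  have "sqrt (1 + t\<^sup>2) \<le> 1 + \<bar>t\<bar>" by (rule real_le_lsqrt) (simp_all add: power2_sum)
  moreover have "0 \<le> sqrt (2::real)" by simp
  ultimately show ?thesis using soft_abs_lower[of t] unfolding soft_abs_def by linarith
qed

section \<open>The interior estimate\<close>

text \<open>
  With \<open>\<epsilon> F = \<epsilon>\<^sup>2 \<Delta>U - W'(U)\<close>, Kato's inequality and the dissipation inequality show that
  \<open>soft_abs U\<close> is a subsolution of \<open>(2 / \<epsilon>\<^sup>2 - \<Delta>) \<beta> \<le> \<bar>F\<bar> / \<epsilon>\<close>. Testing with the truncated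
  Yukawa kernel for \<open>l = sqrt 2 / \<epsilon>\<close> bounds \<open>soft_abs U\<close> at the pole. Every error term carries the
  right power of \<open>\<epsilon>\<close>, because the square integral of the kernel is of order \<open>\<epsilon>\<close>: this is where
  dimension three enters. The free parameter \<open>A\<close> comes from Young's inequality.
\<close>

lemma interior_estimate:
  fixes U g :: "'a::euclidean_space \<Rightarrow> real" and \<epsilon> a w A B r R :: real
  assumes dim: "DIM('a) = 3" and r: "0 < r" "r < R" and \<epsilon>: "\<epsilon> > 0" and A: "A > 0"
    and U[measurable]: "U \<in> borel_measurable borel" and B: "\<And>x. \<bar>U x\<bar> \<le> B"
    and UV: "continuous_on (ball p R) U" and g: "integrable lborel g"
    and eq: "\<And>\<psi>. test_function (ball p R) \<psi> \<Longrightarrow>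
      (LINT y|lborel. U y * laplacian \<psi> y) = (LINT y|lborel. g y * \<psi> y)"
  defines "F \<equiv> \<lambda>x. \<epsilon> * g x - 1 / \<epsilon> * deriv W (U x)"
  assumes Fint: "integrable lborel (\<lambda>x. indicator (cball p r) x * (F x)\<^sup>2)"
    and Fa: "(LINT x|lborel. indicator (cball p r) x * (F x)\<^sup>2) \<le> \<epsilon> * a"
    and Ww: "(LINT x|lborel. indicator (cball p r) x * W (U x)) \<le> \<epsilon> * w"
    and z: "soft_abs (U p) > 0"
  shows "soft_abs (U p) * unit_ball_vol 3 / 800 \<le>
    A * a / 2 + 3 * unit_ball_vol 3 / (2 * A) + 39 / r\<^sup>2 * (\<epsilon> * (w + 3 * unit_ball_vol 3))"
proof -
  define V :: real where "V = unit_ball_vol 3"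
  have V: "V > 0" by (simp add: V_def)
  define z0 where "z0 = soft_abs (U p)"
  have z0: "z0 > 0" using z by (simp add: z0_def)
  define l where "l = sqrt 2 / \<epsilon>"
  have l: "l > 0" "l\<^sup>2 = 2 / \<epsilon>\<^sup>2" using \<epsilon> by (simp_all add: l_def power_divide)
  have cont[measurable]: "soft_abs \<in> borel_measurable borel" "soft_sgn \<in> borel_measurable borel"
    using continuous_soft by (auto intro: borel_measurable_continuous_onI)
  have [measurable]: "g \<in> borel_measurable borel" using g by (simp add: integrable_iff_bounded)

  \<comment> \<open>On the ball of radius \<open>d\<close> the density \<open>soft_abs \<circ> U\<close> is at least half its value at \<open>p\<close>. The
    regularisation length \<open>\<delta>\<close> is then taken so small that the mass of the approximate Dirac measure
    outside this ball, where \<open>soft_abs \<circ> U\<close> may be negative, is negligible.\<close>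
  have "isCont U p" using UV r by (simp add: continuous_on_eq_continuous_at)
  moreover have "isCont soft_abs (U p)" using continuous_soft(1) by (simp add: continuous_on_eq_continuous_at)
  ultimately have "isCont (\<lambda>x. soft_abs (U x)) p" by (rule isCont_o2)
  from isCont_real_near[OF this half_gt_zero[OF z0]] obtain d0 where d0: "d0 > 0"
    "\<And>x. dist x p < d0 \<Longrightarrow> \<bar>soft_abs (U x) - soft_abs (U p)\<bar> < z0 / 2" by blast
  define d where "d = min (d0 / 2) (r / 2)"
  have d: "d > 0" using d0(1) r(1) by (simp add: d_def)
  have near: "z0 / 2 \<le> soft_abs (U x)" if "norm (x - p) \<le> d" for x
  proof -
    have "dist x p < d0" using that d0(1) by (simp add: d_def dist_norm)
    from d0(2)[OF this] show ?thesis unfolding z0_def by linarith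
  qed
  define M where "M = l\<^sup>2 / d ^ 3 + 3 * l / d ^ 4 + 3 / d ^ 5"
  have M: "M \<ge> 0" unfolding M_def using l d by (intro add_nonneg_nonneg divide_nonneg_nonneg) auto
  define N where "N = M * V * r ^ 3 + 1"
  have N: "N > 0" using M V r unfolding N_def by (intro add_nonneg_pos) auto
  define \<delta> where "\<delta> = min (min d (1 / (2 * l))) (min 1 (z0 * V / 800 / N))"
  have \<delta>: "\<delta> > 0" unfolding \<delta>_def using d l z0 V N by simp
  have \<delta>d: "\<delta> \<le> d" "\<delta> \<le> 1 / (2 * l)" "\<delta> \<le> 1" "\<delta> \<le> z0 * V / 800 / N" by (auto simp: \<delta>_def)
  have \<delta>r: "\<delta> \<le> r / 2" using \<delta>d(1) by (simp add: d_def)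
  have \<delta>l: "l * \<delta> \<le> 1 / 2" using mult_left_mono[OF \<delta>d(2), of l] l by simp
  have \<delta>N: "\<delta>\<^sup>2 * M * (V * r ^ 3) \<le> z0 * V / 800"
  proof -
    have "\<delta>\<^sup>2 \<le> \<delta>" using \<delta> \<delta>d(3) mult_left_mono[of \<delta> 1 \<delta>] by (simp add: power2_eq_square)
    then have "\<delta>\<^sup>2 * (M * V * r ^ 3) \<le> \<delta> * N"
      using \<delta> M V r unfolding N_def by (intro mult_mono) auto
    also have "\<dots> \<le> z0 * V / 800" using mult_right_mono[OF \<delta>d(4), of N] N by simp
    finally show ?thesis by (simp add: mult_ac)
  qed
  define K where "K x = exp (- (l / 2) * sqrt ((norm (x - p))\<^sup>2 + \<delta>\<^sup>2)) / sqrt ((norm (x - p))\<^sup>2 + \<delta>\<^sup>2)" for x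
  have K0: "K x \<ge> 0" for x by (simp add: K_def)
  have Kint: "integrable lborel (\<lambda>x. (K x)\<^sup>2)" and "(LINT x|lborel. (K x)\<^sup>2) \<le> 3 * V / l"
    using yukawa_square_integral[OF dim l(1) \<delta>, of p] by (simp_all add: K_def V_def)
  moreover have "3 * V / l \<le> 3 * V * \<epsilon>"
  proof -
    have "1 \<le> sqrt (2::real)" by simp
    then have "1 / l \<le> \<epsilon>" using \<epsilon> by (simp add: l_def field_simps)
    from mult_left_mono[OF this, of "3 * V"] show ?thesis using V by simp
  qed
  ultimately have KV: "(LINT x|lborel. (K x)\<^sup>2) \<le> 3 * V * \<epsilon>" by linarith
  obtain \<phi> L m :: "'a \<Rightarrow> real" where \<phi>: "C2_compact (cball p r) \<phi> L" "\<And>x. 0 \<le> \<phi> x" "\<And>x. \<phi> x \<le> K x"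
    and m: "continuous_on UNIV m" "\<And>x. 0 \<le> m x" "\<And>x. x \<notin> cball p r \<Longrightarrow> m x = 0"
    and E: "\<And>x. \<bar>l\<^sup>2 * \<phi> x - L x - m x\<bar> \<le> 78 / r\<^sup>2 * K x"
    and m_near: "\<And>x. norm (x - p) \<le> \<delta> \<Longrightarrow> \<delta> \<le> r / 2 \<Longrightarrow> l * \<delta> \<le> 1 / 2 \<Longrightarrow> 1 / (200 * \<delta> ^ 3) \<le> m x"
    and m_far: "\<And>x d. d > 0 \<Longrightarrow> d \<le> norm (x - p) \<Longrightarrow> m x \<le> \<delta>\<^sup>2 * (l\<^sup>2 / d ^ 3 + 3 * l / d ^ 4 + 3 / d ^ 5)"
  proof (rule yukawa_kernel[OF dim l(1) r(1) \<delta>, of p, folded K_def], goal_cases)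
    case (1 \<phi> L m)
    show ?case by (rule 1(1)[OF 1(2-)])
  qed
  define \<beta> where "\<beta> x = soft_abs (U x)" for x
  define b where "b x = soft_sgn (U x)" for x
  have [measurable]: "\<beta> \<in> borel_measurable borel" "b \<in> borel_measurable borel"
    unfolding \<beta>_def[abs_def] b_def[abs_def] by measurable
  have \<beta>B: "\<bar>\<beta> x\<bar> \<le> 1 + B" for x unfolding \<beta>_def using soft_abs_upper[of "U x"] B[of x] by linarith
  have b1: "\<bar>b x\<bar> \<le> 1" for x by (simp add: b_def soft_sgn_bound)
  have c\<phi>: "continuous_on UNIV \<phi>" "\<And>x. x \<notin> cball p r \<Longrightarrow> \<phi> x = 0"
    using \<phi>(1) unfolding C2_compact_def by auto
  have [measurable]: "\<phi> \<in> borel_measurable borel" using c\<phi>(1) by (rule borel_measurable_continuous_onI)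
  obtain C where C: "\<And>x. \<bar>\<phi> x\<bar> \<le> C"
    using continuous_compact_support_bounded[OF compact_cball c\<phi>] by blast
  have L: "continuous_on UNIV L" "\<And>x. x \<notin> cball p r \<Longrightarrow> L x = 0"
    using C2_compact_laplacian[OF \<phi>(1)] by auto
  have iL: "integrable lborel (\<lambda>x. \<beta> x * L x)"
    by (rule integrable_mult_bounded[OF continuous_compact_support_integrable[OF compact_cball L] _ \<beta>B]) measurable
  have im: "integrable lborel (\<lambda>x. \<beta> x * m x)"
    by (rule integrable_mult_bounded[OF continuous_compact_support_integrable[OF compact_cball m(1,3)] _ \<beta>B]) measurable
  have ig: "integrable lborel (\<lambda>x. b x * g x * \<phi> x)"
  proof -
    have "\<bar>b x * \<phi> x\<bar> \<le> 1 * C" for x unfolding abs_mult by (intro mult_mono b1 C) auto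
    from integrable_mult_bounded[OF g _ this] have "integrable lborel (\<lambda>x. b x * \<phi> x * g x)" by measurable
    then show ?thesis by (simp add: mult_ac)
  qed
  have kato: "(LINT x|lborel. b x * g x * \<phi> x) \<le> (LINT x|lborel. \<beta> x * L x)"
    unfolding b_def \<beta>_def
    by (rule kato_inequality[OF open_ball U B UV g eq \<phi>(1,2) _ soft_abs_convex soft_sgn_bound continuous_soft])
      (use r in auto)

  \<comment> \<open>Pointwise form of the tested inequality: the first bracket has nonpositive integral by Kato's
    inequality, and the products \<open>\<bar>F\<bar> * \<phi>\<close> and \<open>\<bar>\<beta>\<bar> * K\<close> are split by Young's inequality.\<close>
  let ?I = "indicator (cball p r) :: 'a \<Rightarrow> real"
  have upper: "\<beta> x * m x \<le> (b x * g x * \<phi> x - \<beta> x * L x) +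
      (A / (2 * \<epsilon>) * (?I x * (F x)\<^sup>2) + (1 / (2 * A * \<epsilon>) + 39 / r\<^sup>2) * (K x)\<^sup>2 + 39 / r\<^sup>2 * (?I x * W (U x)))" for x
  proof (cases "x \<in> cball p r")
    case False
    then show ?thesis using A \<epsilon> c\<phi>(2) L(2) m(3) by simp
  next
    case True
    have "2 * \<beta> x \<le> b x * deriv W (U x)" unfolding \<beta>_def b_def by (rule soft_abs_dissipation)
    then have "1 / \<epsilon>\<^sup>2 * (2 * \<beta> x) * \<phi> x \<le> 1 / \<epsilon>\<^sup>2 * (b x * deriv W (U x)) * \<phi> x"
      by (intro mult_right_mono mult_left_mono \<phi>(2)) auto
    moreover have "g x = 1 / \<epsilon>\<^sup>2 * deriv W (U x) + F x / \<epsilon>"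
      using \<epsilon> by (simp add: F_def field_simps power2_eq_square)
    then have "b x * g x * \<phi> x = 1 / \<epsilon>\<^sup>2 * (b x * deriv W (U x)) * \<phi> x + b x * F x * \<phi> x / \<epsilon>"
      by (simp add: algebra_simps)
    ultimately have s1: "l\<^sup>2 * \<beta> x * \<phi> x \<le> b x * g x * \<phi> x - b x * F x * \<phi> x / \<epsilon>"
      unfolding l(2) by simp
    have s2: "- (b x * F x * \<phi> x / \<epsilon>) \<le> A / (2 * \<epsilon>) * (F x)\<^sup>2 + 1 / (2 * A * \<epsilon>) * (K x)\<^sup>2"
    proof -
      have "- (b x * F x * \<phi> x) \<le> \<bar>b x\<bar> * \<bar>F x\<bar> * \<bar>\<phi> x\<bar>" by (simp add: abs_mult[symmetric])
      also have "\<dots> \<le> 1 * \<bar>F x\<bar> * K x"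
        using \<phi>(2,3)[of x] by (intro mult_mono b1) auto
      finally have "- (b x * F x * \<phi> x) \<le> \<bar>F x\<bar> * K x" by simp
      moreover have "0 \<le> (A * \<bar>F x\<bar> - K x)\<^sup>2" by simp
      then have "2 * A * (\<bar>F x\<bar> * K x) \<le> A\<^sup>2 * (F x)\<^sup>2 + (K x)\<^sup>2"
        by (simp add: power2_diff power_mult_distrib mult_ac)
      then have "\<bar>F x\<bar> * K x \<le> (A\<^sup>2 * (F x)\<^sup>2 + (K x)\<^sup>2) / (2 * A)"
        using A by (simp add: pos_le_divide_eq mult_ac)
      ultimately have "- (b x * F x * \<phi> x) \<le> (A\<^sup>2 * (F x)\<^sup>2 + (K x)\<^sup>2) / (2 * A)" by linarith
      then have "- (b x * F x * \<phi> x) / \<epsilon> \<le> (A\<^sup>2 * (F x)\<^sup>2 + (K x)\<^sup>2) / (2 * A) / \<epsilon>"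
        using \<epsilon> by (intro divide_right_mono) auto
      also have "\<dots> = A / (2 * \<epsilon>) * (F x)\<^sup>2 + 1 / (2 * A * \<epsilon>) * (K x)\<^sup>2"
        using A \<epsilon> by (simp add: field_simps power2_eq_square)
      finally show ?thesis by simp
    qed
    have s3: "- (\<beta> x * (l\<^sup>2 * \<phi> x - L x - m x)) \<le> 39 / r\<^sup>2 * (W (U x) + (K x)\<^sup>2)"
    proof -
      have "- (\<beta> x * (l\<^sup>2 * \<phi> x - L x - m x)) \<le> \<bar>\<beta> x\<bar> * \<bar>l\<^sup>2 * \<phi> x - L x - m x\<bar>"
        by (simp add: abs_mult[symmetric])
      also have "\<dots> \<le> \<bar>\<beta> x\<bar> * (78 / r\<^sup>2 * K x)" by (intro mult_left_mono E) auto
      also have "\<dots> = 39 / r\<^sup>2 * (2 * \<bar>\<beta> x\<bar> * K x)" by simp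
      also have "\<dots> \<le> 39 / r\<^sup>2 * (W (U x) + (K x)\<^sup>2)"
      proof (intro mult_left_mono)
        have "0 \<le> (\<bar>\<beta> x\<bar> - K x)\<^sup>2" by simp
        then have "2 * \<bar>\<beta> x\<bar> * K x \<le> (\<beta> x)\<^sup>2 + (K x)\<^sup>2" by (simp add: power2_diff)
        also have "(\<beta> x)\<^sup>2 \<le> W (U x)" unfolding \<beta>_def by (rule soft_abs_square_le_W)
        finally show "2 * \<bar>\<beta> x\<bar> * K x \<le> W (U x) + (K x)\<^sup>2" by simp
      qed simp
      finally show ?thesis .
    qed
    have "\<beta> x * m x = l\<^sup>2 * \<beta> x * \<phi> x - \<beta> x * L x - \<beta> x * (l\<^sup>2 * \<phi> x - L x - m x)"
      by (simp add: algebra_simps)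
    also have "\<dots> \<le> (b x * g x * \<phi> x - \<beta> x * L x) +
        ((A / (2 * \<epsilon>) * (F x)\<^sup>2 + 1 / (2 * A * \<epsilon>) * (K x)\<^sup>2) + 39 / r\<^sup>2 * (W (U x) + (K x)\<^sup>2))"
      using s1 s2 s3 by linarith
    also have "\<dots> = (b x * g x * \<phi> x - \<beta> x * L x) +
      (A / (2 * \<epsilon>) * (?I x * (F x)\<^sup>2) + (1 / (2 * A * \<epsilon>) + 39 / r\<^sup>2) * (K x)\<^sup>2 + 39 / r\<^sup>2 * (?I x * W (U x)))"
      using True by (simp add: algebra_simps add_divide_distrib)
    finally show ?thesis .
  qed
  have iW: "integrable lborel (\<lambda>x. ?I x * W (U x))"
  proof -
    have "W t \<le> 1 / 4 * (B\<^sup>2 + 1)\<^sup>2" if "\<bar>t\<bar> \<le> B" for t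
    proof -
      have "t\<^sup>2 \<le> B\<^sup>2" using that power_mono[OF that, of 2] by simp
      then have "\<bar>t\<^sup>2 - 1\<bar> \<le> \<bar>B\<^sup>2 + 1\<bar>" by (smt (verit) zero_le_power2)
      then have "(t\<^sup>2 - 1)\<^sup>2 \<le> (B\<^sup>2 + 1)\<^sup>2" by (simp only: abs_le_square_iff)
      then show ?thesis by (simp add: W_def)
    qed
    then have "\<bar>W (U x)\<bar> \<le> 1 / 4 * (B\<^sup>2 + 1)\<^sup>2" for x using B[of x] W_nonneg[of "U x"] by simp
    moreover have "(\<lambda>x. W (U x)) \<in> borel_measurable lborel" unfolding W_def by measurable
    moreover have "integrable lborel ?I"
      by (intro integrable_real_indicator) (use emeasure_lborel_cball_finite[of p r] in auto)
    ultimately have "integrable lborel (\<lambda>x. W (U x) * ?I x)" by (intro integrable_mult_bounded)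
    then show ?thesis by (simp add: mult.commute)
  qed
  let ?X = "\<lambda>x. A / (2 * \<epsilon>) * (?I x * (F x)\<^sup>2) + (1 / (2 * A * \<epsilon>) + 39 / r\<^sup>2) * (K x)\<^sup>2 + 39 / r\<^sup>2 * (?I x * W (U x))"
  have iX: "integrable lborel ?X"
    by (intro Bochner_Integration.integrable_add integrable_mult_right Fint Kint iW)
  have "(LINT x|lborel. \<beta> x * m x) \<le> (LINT x|lborel. (b x * g x * \<phi> x - \<beta> x * L x) + ?X x)"
    by (intro integral_mono im upper Bochner_Integration.integrable_add[OF _ iX] Bochner_Integration.integrable_diff ig iL)
  also have "\<dots> = (LINT x|lborel. b x * g x * \<phi> x) - (LINT x|lborel. \<beta> x * L x) + (LINT x|lborel. ?X x)"
    using ig iL iX by (simp del: Bochner_Integration.integral_mult_right_zero)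
  also have "\<dots> \<le> (LINT x|lborel. ?X x)" using kato by simp
  also have "\<dots> = A / (2 * \<epsilon>) * (LINT x|lborel. ?I x * (F x)\<^sup>2) +
      (1 / (2 * A * \<epsilon>) + 39 / r\<^sup>2) * (LINT x|lborel. (K x)\<^sup>2) + 39 / r\<^sup>2 * (LINT x|lborel. ?I x * W (U x))"
    using Fint Kint iW by simp
  also have "\<dots> \<le> A / (2 * \<epsilon>) * (\<epsilon> * a) + (1 / (2 * A * \<epsilon>) + 39 / r\<^sup>2) * (3 * V * \<epsilon>) + 39 / r\<^sup>2 * (\<epsilon> * w)"
    using A \<epsilon> by (intro add_mono mult_left_mono Fa KV Ww) auto
  also have "\<dots> = A * a / 2 + 3 * V / (2 * A) + 39 / r\<^sup>2 * (\<epsilon> * (w + 3 * V))"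
    using A \<epsilon> r by (simp add: field_simps)
  finally have ub: "(LINT x|lborel. \<beta> x * m x) \<le> A * a / 2 + 3 * V / (2 * A) + 39 / r\<^sup>2 * (\<epsilon> * (w + 3 * V))" .

  \<comment> \<open>The approximate Dirac measure \<open>m\<close> has height of order \<open>\<delta> ^ -3\<close> on the ball of radius \<open>\<delta>\<close>, so it
    sees a fixed fraction of the value at \<open>p\<close>.\<close>
  let ?Y = "\<lambda>x. z0 / (400 * \<delta> ^ 3) * indicator (cball p \<delta>) x - \<delta>\<^sup>2 * M * ?I x"
  have lower: "?Y x \<le> \<beta> x * m x" for x
  proof -
    have IM: "0 \<le> \<delta>\<^sup>2 * M * ?I x" using M by (intro mult_nonneg_nonneg) auto
    consider "norm (x - p) \<le> \<delta>" | "\<delta> < norm (x - p)" "norm (x - p) \<le> d" | "d < norm (x - p)" "x \<in> cball p r"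
      | "d < norm (x - p)" "x \<notin> cball p r" by linarith
    then show ?thesis
    proof cases
      case 1
      have "z0 / 2 * (1 / (200 * \<delta> ^ 3)) \<le> \<beta> x * m x"
        using near[of x] m_near[OF 1 \<delta>r \<delta>l] 1 \<delta>d(1) z0 \<delta> m(2)[of x] unfolding \<beta>_def by (intro mult_mono) auto
      moreover have "x \<in> cball p \<delta>" using 1 by (simp add: dist_norm norm_minus_commute)
      ultimately show ?thesis using IM by simp
    next
      case 2
      have "x \<notin> cball p \<delta>" using 2 by (simp add: dist_norm norm_minus_commute)
      moreover have "0 \<le> \<beta> x * m x" using near[OF 2(2)] z0 m(2)[of x] by (simp add: \<beta>_def)
      ultimately show ?thesis using IM by simp
    next
      case 3
      have "x \<notin> cball p \<delta>" using 3 \<delta>d(1) by (simp add: dist_norm norm_minus_commute)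
      moreover have "- 1 * m x \<le> \<beta> x * m x"
        unfolding \<beta>_def by (intro mult_right_mono soft_abs_lower m(2))
      moreover have "m x \<le> \<delta>\<^sup>2 * M" unfolding M_def using m_far[OF d] 3(1) by simp
      ultimately show ?thesis using 3(2) by simp
    next
      case 4
      have "x \<notin> cball p \<delta>" using 4 \<delta>d(1) by (simp add: dist_norm norm_minus_commute)
      then show ?thesis using 4 m(3) by simp
    qed
  qed
  have ind: "integrable lborel (\<lambda>x. indicator (cball p t) x :: real)" for t
    by (intro integrable_real_indicator) (use emeasure_lborel_cball_finite[of p t] in auto)
  have vol: "(LINT x|lborel. indicator (cball p t) x :: real) = V * t ^ 3" if "t > 0" for t
    using that dim by (simp add: content_cball V_def)
  have "z0 * V / 800 \<le> z0 / (400 * \<delta> ^ 3) * (V * \<delta> ^ 3) - \<delta>\<^sup>2 * M * (V * r ^ 3)"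
  proof -
    have "z0 / (400 * \<delta> ^ 3) * (V * \<delta> ^ 3) = z0 * V / 400" using \<delta> by simp
    with \<delta>N show ?thesis by linarith
  qed
  also have "\<dots> = (LINT x|lborel. ?Y x)"
    using ind vol[OF \<delta>] vol[OF r(1)] by simp
  also have "\<dots> \<le> (LINT x|lborel. \<beta> x * m x)"
    by (intro integral_mono lower im Bochner_Integration.integrable_diff integrable_mult_right ind)
  also note ub
  finally show ?thesis unfolding z0_def V_def .
qed

section \<open>Weak derivatives and the energy measures\<close>

lemma locally_integrable_measurable:
  assumes \<Omega>: "open \<Omega>" and f: "locally_integrable \<Omega> f"
  shows "f \<in> borel_measurable (lebesgue_on \<Omega>)"
proof -
  obtain D where D: "countable D" "D \<subseteq> Pow \<Omega>" "\<And>X. X \<in> D \<Longrightarrow> \<exists>a b. X = cbox a b" "\<Union>D = \<Omega>"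
  proof (rule open_countable_Union_open_cbox[OF \<Omega>], goal_cases)
    case (1 D)
    show ?case by (rule 1(1)[OF 1(2-)])
  qed
  show ?thesis
  proof (rule measurable_piecewise_restrict[OF D(1)])
    fix X assume X: "X \<in> D"
    from D(3)[OF X] obtain a b where ab: "X = cbox a b" by (elim exE)
    have sub: "X \<subseteq> \<Omega>" using D(2) X by blast
    have sets: "X \<in> sets lebesgue" "\<Omega> \<in> sets lebesgue" unfolding ab using \<Omega> by auto
    show "X \<inter> space (lebesgue_on \<Omega>) \<in> sets (lebesgue_on \<Omega>)"
      using sub sets by (auto simp: space_restrict_space sets_restrict_space)
    have "compact X" unfolding ab by (rule compact_cbox)
    then have "f absolutely_integrable_on X" using f sub unfolding locally_integrable_def by simp
    then have "(\<lambda>x. indicator X x *\<^sub>R f x) \<in> borel_measurable lebesgue"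
      by (simp add: set_integrable_def)
    then have "f \<in> borel_measurable (lebesgue_on X)"
      using sets by (subst borel_measurable_restrict_space_iff) auto
    moreover have "restrict_space (lebesgue_on \<Omega>) X = lebesgue_on X"
      using sets sub by (subst restrict_restrict_space) (auto simp: Int_absorb1)
    ultimately show "f \<in> borel_measurable (restrict_space (lebesgue_on \<Omega>) X)" by simp
  qed (simp add: space_restrict_space D(4))
qed

lemma locally_integrable_times_test:
  assumes \<Omega>: "open \<Omega>" and f: "locally_integrable \<Omega> f" and \<psi>: "test_function \<Omega> \<psi>"
  shows "integrable (lebesgue_on \<Omega>) (\<lambda>x. f x * \<psi> x)"
proof -
  define K where "K = closure {x. \<psi> x \<noteq> 0}"
  have K: "compact K" "K \<subseteq> \<Omega>" using \<psi> by (auto simp: K_def test_function_def)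
  have zero: "\<psi> x = 0" if "x \<notin> K" for x
    using that closure_subset[of "{x. \<psi> x \<noteq> 0}"] by (auto simp: K_def)
  have cont: "continuous_on UNIV \<psi>" using \<psi> by (auto simp: test_function_def intro: smooth_imp_continuous)
  obtain C where C: "\<And>x. \<bar>\<psi> x\<bar> \<le> C"
    using continuous_compact_support_bounded[OF K(1) cont zero] by blast
  have "f absolutely_integrable_on K" using f K unfolding locally_integrable_def by blast
  then have "integrable lebesgue (\<lambda>x. indicator K x *\<^sub>R f x)" by (simp add: set_integrable_def)
  moreover have "\<psi> \<in> borel_measurable lebesgue"
    using cont by (auto intro!: measurable_completion borel_measurable_continuous_onI)
  ultimately have "integrable lebesgue (\<lambda>x. \<psi> x * (indicator K x *\<^sub>R f x))"
    by (rule integrable_mult_bounded[OF _ _ C])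
  moreover have "(\<lambda>x. \<psi> x * (indicator K x *\<^sub>R f x)) = (\<lambda>x. indicator \<Omega> x *\<^sub>R (f x * \<psi> x))"
    using zero K(2) by (auto simp: indicator_def fun_eq_iff)
  ultimately show ?thesis using \<Omega> by (subst integrable_restrict_space) auto
qed

text \<open>
  Membership in \<open>W22\<close> provides a second derivative of some first weak derivative. It is also one of the
  chosen first derivative: the two first derivatives have the same integrals against
  derivatives of test functions, as both of these are integrals of \<open>u\<close> against a second derivative.
\<close>

lemma W22_second_derivatives:
  assumes \<Omega>: "open \<Omega>" and u: "u \<in> W22 \<Omega>" and i: "i \<in> Basis"
  shows "has_weak_partial \<Omega> i u (weak_partial \<Omega> i u)"
    and "has_weak_partial \<Omega> i (weak_partial \<Omega> i u) (weak_partial \<Omega> i (weak_partial \<Omega> i u))"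
proof -
  obtain g where g: "g \<in> W12 \<Omega>" "has_weak_partial \<Omega> i u g" using u i by (auto simp: W22_def)
  obtain h where h: "has_weak_partial \<Omega> i g h" using g(1) i by (auto simp: W12_def)
  show 1: "has_weak_partial \<Omega> i u (weak_partial \<Omega> i u)"
    unfolding weak_partial_def by (rule someI[of "has_weak_partial \<Omega> i u", OF g(2)])
  have "has_weak_partial \<Omega> i (weak_partial \<Omega> i u) h"
    unfolding has_weak_partial_def
  proof (intro conjI allI impI)
    show "locally_integrable \<Omega> (weak_partial \<Omega> i u)" using 1 by (simp add: has_weak_partial_def)
    show "locally_integrable \<Omega> h" using h by (simp add: has_weak_partial_def)
    fix \<phi> assume \<phi>: "test_function \<Omega> \<phi>"
    have d: "test_function \<Omega> (partial_deriv i \<phi>)" by (rule test_function_partial_deriv[OF \<phi> i])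
    have "(LINT x|lebesgue_on \<Omega>. weak_partial \<Omega> i u x * partial_deriv i \<phi> x) =
        (LINT x|lebesgue_on \<Omega>. g x * partial_deriv i \<phi> x)"
    proof -
      have "(LINT x|lebesgue_on \<Omega>. u x * partial_deriv i (partial_deriv i \<phi>) x) =
          - (LINT x|lebesgue_on \<Omega>. weak_partial \<Omega> i u x * partial_deriv i \<phi> x)"
        using 1 d unfolding has_weak_partial_def by blast
      moreover have "(LINT x|lebesgue_on \<Omega>. u x * partial_deriv i (partial_deriv i \<phi>) x) =
          - (LINT x|lebesgue_on \<Omega>. g x * partial_deriv i \<phi> x)"
        using g(2) d unfolding has_weak_partial_def by blast
      ultimately show ?thesis by simp
    qed
    also have "\<dots> = - (LINT x|lebesgue_on \<Omega>. h x * \<phi> x)"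
      using h \<phi> unfolding has_weak_partial_def by blast
    finally show "(LINT x|lebesgue_on \<Omega>. weak_partial \<Omega> i u x * partial_deriv i \<phi> x) =
        - (LINT x|lebesgue_on \<Omega>. h x * \<phi> x)" .
  qed
  then show "has_weak_partial \<Omega> i (weak_partial \<Omega> i u) (weak_partial \<Omega> i (weak_partial \<Omega> i u))"
    unfolding weak_partial_def[of \<Omega> i "weak_partial \<Omega> i u"]
    by (rule someI[of "has_weak_partial \<Omega> i (weak_partial \<Omega> i u)"])
qed

lemma locally_integrable_sum:
  assumes "\<And>i. i \<in> I \<Longrightarrow> locally_integrable \<Omega> (f i)" "finite I"
  shows "locally_integrable \<Omega> (\<lambda>x. \<Sum>i\<in>I. f i x)"
  using assms unfolding locally_integrable_def
  by (auto intro!: absolutely_integrable_sum)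

lemma weak_laplacian_locally_integrable:
  assumes "open \<Omega>" "u \<in> W22 \<Omega>"
  shows "locally_integrable \<Omega> (weak_laplacian \<Omega> u)"
  unfolding weak_laplacian_def[abs_def]
  using W22_second_derivatives(2)[OF assms]
  by (intro locally_integrable_sum) (auto simp: has_weak_partial_def)

text \<open>
  This distributional identity is the only way in which the weak Laplacian enters the estimate.
\<close>

lemma weak_laplacian_test:
  assumes \<Omega>: "open \<Omega>" and u: "u \<in> W22 \<Omega>" and \<psi>: "test_function \<Omega> \<psi>"
  shows "(LINT x|lebesgue_on \<Omega>. u x * laplacian \<psi> x) = (LINT x|lebesgue_on \<Omega>. weak_laplacian \<Omega> u x * \<psi> x)"
proof -
  note d = W22_second_derivatives[OF \<Omega> u]
  have t: "test_function \<Omega> (partial_deriv i \<psi>)" "test_function \<Omega> (partial_deriv i (partial_deriv i \<psi>))"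
    if "i \<in> Basis" for i
    using that \<psi> by (simp_all add: test_function_partial_deriv)
  have lu: "locally_integrable \<Omega> u"
    using d(1) nonempty_Basis unfolding has_weak_partial_def by blast
  have "(LINT x|lebesgue_on \<Omega>. u x * laplacian \<psi> x) =
      (\<Sum>i\<in>Basis. LINT x|lebesgue_on \<Omega>. u x * partial_deriv i (partial_deriv i \<psi>) x)"
    unfolding laplacian_def sum_distrib_left
    by (intro Bochner_Integration.integral_sum locally_integrable_times_test \<Omega> lu t)
  also have "\<dots> = (\<Sum>i\<in>Basis. LINT x|lebesgue_on \<Omega>. weak_partial \<Omega> i (weak_partial \<Omega> i u) x * \<psi> x)"
  proof (intro sum.cong refl)
    fix i :: 'a assume i: "i \<in> Basis"
    have "(LINT x|lebesgue_on \<Omega>. u x * partial_deriv i (partial_deriv i \<psi>) x) =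
        - (LINT x|lebesgue_on \<Omega>. weak_partial \<Omega> i u x * partial_deriv i \<psi> x)"
      using d(1)[OF i] t(1)[OF i] unfolding has_weak_partial_def by blast
    also have "(LINT x|lebesgue_on \<Omega>. weak_partial \<Omega> i u x * partial_deriv i \<psi> x) =
        - (LINT x|lebesgue_on \<Omega>. weak_partial \<Omega> i (weak_partial \<Omega> i u) x * \<psi> x)"
      using d(2)[OF i] \<psi> unfolding has_weak_partial_def by blast
    finally show "(LINT x|lebesgue_on \<Omega>. u x * partial_deriv i (partial_deriv i \<psi>) x) =
        (LINT x|lebesgue_on \<Omega>. weak_partial \<Omega> i (weak_partial \<Omega> i u) x * \<psi> x)" by simp
  qed
  also have "\<dots> = (LINT x|lebesgue_on \<Omega>. weak_laplacian \<Omega> u x * \<psi> x)"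
    unfolding weak_laplacian_def sum_distrib_right
    using d(2) by (intro Bochner_Integration.integral_sum[symmetric] locally_integrable_times_test \<Omega> \<psi>)
      (auto simp: has_weak_partial_def)
  finally show ?thesis .
qed

lemma weak_grad_measurable:
  assumes \<Omega>: "open \<Omega>" and u: "u \<in> W22 \<Omega>"
  shows "weak_grad \<Omega> u \<in> borel_measurable (lebesgue_on \<Omega>)"
proof -
  have "weak_partial \<Omega> i u \<in> borel_measurable (lebesgue_on \<Omega>)" if "i \<in> Basis" for i
    using W22_second_derivatives(1)[OF \<Omega> u that]
    by (intro locally_integrable_measurable \<Omega>) (simp add: has_weak_partial_def)
  then show ?thesis unfolding weak_grad_def[abs_def]
    by (intro borel_measurable_sum borel_measurable_scaleR) auto
qed

lemma densities_measurable:
  assumes \<Omega>: "open \<Omega>" and u: "u \<in> W22 \<Omega>"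
  shows "area_density \<Omega> \<epsilon> u \<in> borel_measurable (lebesgue_on \<Omega>)"
    and "willmore_density \<Omega> \<epsilon> u \<in> borel_measurable (lebesgue_on \<Omega>)"
proof -
  have [measurable]: "u \<in> borel_measurable (lebesgue_on \<Omega>)" using u by (simp add: W22_def L2_def)
  note [measurable] = weak_grad_measurable[OF \<Omega> u]
    locally_integrable_measurable[OF \<Omega> weak_laplacian_locally_integrable[OF \<Omega> u]]
  show "area_density \<Omega> \<epsilon> u \<in> borel_measurable (lebesgue_on \<Omega>)"
    unfolding area_density_def[abs_def] W_def by measurable
  show "willmore_density \<Omega> \<epsilon> u \<in> borel_measurable (lebesgue_on \<Omega>)"
    unfolding willmore_density_def[abs_def] deriv_W by measurable
qed

lemma c0_pos: "c0 > 0"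
proof -
  have eq: "sqrt (2 * W s) = (1 - s\<^sup>2) / sqrt 2" if "s \<in> {-1..1}" for s
  proof -
    have s: "s\<^sup>2 \<le> 1" using that by (auto simp: abs_square_le_1 abs_le_iff)
    have "2 * W s = ((1 - s\<^sup>2) / sqrt 2)\<^sup>2" by (simp add: W_def power_divide power2_commute)
    moreover have "(1 - s\<^sup>2) / sqrt 2 \<ge> 0" using s by simp
    ultimately show ?thesis using s by simp
  qed
  have "((\<lambda>s. (1 - s\<^sup>2) / sqrt 2) has_integral (1 - 1 ^ 3 / 3) / sqrt 2 - (- 1 - (- 1) ^ 3 / 3) / sqrt 2) {-1..1::real}"
  proof (rule fundamental_theorem_of_calculus)
    show "((\<lambda>s. (s - s ^ 3 / 3) / sqrt 2) has_vector_derivative (1 - s\<^sup>2) / sqrt 2) (at s within {-1..1})" for s :: real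
      unfolding has_real_derivative_iff_has_vector_derivative[symmetric]
      by (rule DERIV_cdivide) (auto intro!: derivative_eq_intros)
  qed simp
  then have "((\<lambda>s. sqrt (2 * W s)) has_integral (4 / 3) / sqrt 2) {-1..1}"
    using eq by (subst has_integral_cong[where g = "\<lambda>s. (1 - s\<^sup>2) / sqrt 2"]) (auto simp: diff_divide_distrib[symmetric])
  then have c: "c0 = (4 / 3) / sqrt 2" unfolding c0_def by (rule integral_unique)
  show ?thesis unfolding c by simp
qed

text \<open>
  Both energy measures have this form; the lemma turns their mass on a Borel set into an integral over
  the whole space.
\<close>

lemma emeasure_distr_density_lebesgue_on:
  assumes "open \<Omega>" and [measurable]: "f \<in> borel_measurable (lebesgue_on \<Omega>)" and S: "S \<in> sets borel"
  shows "emeasure (distr (density (lebesgue_on \<Omega>) (\<lambda>x. ennreal (f x))) borel id) S =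
    (\<integral>\<^sup>+x. ennreal (f x) * indicator (S \<inter> \<Omega>) x \<partial>lebesgue)"
proof -
  have \<Omega>: "\<Omega> \<in> sets lebesgue" using assms(1) by auto
  have id: "id \<in> measurable (density (lebesgue_on \<Omega>) (\<lambda>x. ennreal (f x))) borel"
    by (simp add: measurable_restrict_space1 measurable_completion id_def)
  have "S \<inter> \<Omega> \<in> sets (lebesgue_on \<Omega>)" using S \<Omega> by (auto simp: sets_restrict_space)
  then have "emeasure (distr (density (lebesgue_on \<Omega>) (\<lambda>x. ennreal (f x))) borel id) S =
      (\<integral>\<^sup>+x. ennreal (f x) * indicator (S \<inter> \<Omega>) x \<partial>lebesgue_on \<Omega>)"
    using emeasure_distr[OF id S] by (simp add: space_restrict_space emeasure_density)
  also have "\<dots> = (\<integral>\<^sup>+x. ennreal (f x) * indicator (S \<inter> \<Omega>) x * indicator \<Omega> x \<partial>lebesgue)"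
    using \<Omega> by (subst nn_integral_restrict_space) auto
  also have "\<dots> = (\<integral>\<^sup>+x. ennreal (f x) * indicator (S \<inter> \<Omega>) x \<partial>lebesgue)"
    by (intro nn_integral_cong) (auto simp: indicator_def)
  finally show ?thesis .
qed

lemma test_function_vanishes:
  assumes "test_function V \<psi>" "x \<notin> V"
  shows "\<psi> x = 0"
  using assms closure_subset[of "{x. \<psi> x \<noteq> 0}"] by (auto simp: test_function_def)

lemma test_function_mono: "test_function V \<psi> \<Longrightarrow> V \<subseteq> \<Omega> \<Longrightarrow> test_function \<Omega> \<psi>"
  by (auto simp: test_function_def)

lemma test_function_measurable:
  assumes "test_function V \<psi>"
  shows "\<psi> \<in> borel_measurable borel"
  using assms by (auto simp: test_function_def intro: borel_measurable_continuous_onI smooth_imp_continuous)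

lemma laplacian_test_measurable:
  assumes "test_function V \<psi>"
  shows "laplacian \<psi> \<in> borel_measurable borel"
  unfolding laplacian_def[abs_def]
  by (intro borel_measurable_sum test_function_measurable[of V] test_function_partial_deriv assms)

lemma laplacian_test_vanishes:
  assumes "test_function V \<psi>" "x \<notin> V"
  shows "laplacian \<psi> x = 0"
  unfolding laplacian_def
  by (intro sum.neutral ballI test_function_vanishes[OF _ assms(2)] test_function_partial_deriv assms(1))

text \<open>
  The interior estimate is stated for Borel functions on the whole space. Here \<open>u\<close> and a Borel
  representative of its weak Laplacian are cut off outside the larger ball, which leaves the weak
  equation intact for test functions supported in that ball.
\<close>

lemma local_willmore_estimate:
  fixes u :: "'a::euclidean_space \<Rightarrow> real" and \<epsilon> A r R w :: real
  assumes dim: "DIM('a) = 3" and r: "0 < r" "r < R" and \<epsilon>: "\<epsilon> > 0" and A: "A > 0"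
    and \<Omega>: "open \<Omega>" "cball p R \<subseteq> \<Omega>" and u: "u \<in> W22 \<Omega>" "continuous_on \<Omega> u"
    and area: "emeasure (area_measure \<Omega> \<epsilon> u) UNIV \<le> ennreal w" and w: "w \<ge> 0"
    and willmore: "emeasure (willmore_measure \<Omega> \<epsilon> u) UNIV < \<infinity>"
    and z: "soft_abs (u p) > 0"
  shows "soft_abs (u p) * unit_ball_vol 3 / 800 \<le>
    A * (c0 * measure (willmore_measure \<Omega> \<epsilon> u) (cball p r)) / 2 + 3 * unit_ball_vol 3 / (2 * A) +
    39 / r\<^sup>2 * (\<epsilon> * (c0 * w + 3 * unit_ball_vol 3))"
proof -
  let ?b = "indicator (ball p R) :: 'a \<Rightarrow> real" and ?c = "indicator (cball p r) :: 'a \<Rightarrow> real"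
  have ball_\<Omega>: "ball p R \<subseteq> \<Omega>" and cr: "cball p r \<subseteq> ball p R" using \<Omega>(2) r by auto
  have \<Omega>s: "\<Omega> \<inter> space lebesgue \<in> sets lebesgue" using \<Omega>(1) by auto
  define U where "U x = ?b x *\<^sub>R u x" for x
  have [measurable]: "U \<in> borel_measurable borel"
    unfolding U_def[abs_def]
    by (rule borel_measurable_continuous_on_indicator) (use continuous_on_subset[OF u(2) ball_\<Omega>] in auto)
  have "bounded (u ` cball p R)"
    by (intro compact_imp_bounded compact_continuous_image continuous_on_subset[OF u(2) \<Omega>(2)]) auto
  then obtain B0 where B0: "\<forall>x\<in>cball p R. \<bar>u x\<bar> \<le> B0" by (auto simp: bounded_iff)
  have B: "\<bar>U x\<bar> \<le> max 0 B0" for x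
    using bspec[OF B0, of x] by (auto simp: U_def indicator_def)
  have UV: "continuous_on (ball p R) U"
    using continuous_on_subset[OF u(2) ball_\<Omega>] by (rule continuous_on_eq) (simp add: U_def)
  let ?L = "weak_laplacian \<Omega> u"
  have "?L absolutely_integrable_on cball p R"
    using weak_laplacian_locally_integrable[OF \<Omega>(1) u(1)] \<Omega>(2) unfolding locally_integrable_def by simp
  then have "?L absolutely_integrable_on ball p R"
    by (rule set_integrable_subset) auto
  then have Lint: "integrable lebesgue (\<lambda>x. ?b x *\<^sub>R ?L x)" by (simp add: set_integrable_def)
  then have "(\<lambda>x. ?b x *\<^sub>R ?L x) \<in> borel_measurable lebesgue" by simp
  from completion_ex_borel_measurable_real[OF this] obtain g where
    gm: "g \<in> borel_measurable lborel" and "AE x in lborel. ?b x *\<^sub>R ?L x = g x" by blast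
  then have gL: "AE x in lebesgue. ?b x *\<^sub>R ?L x = g x" by (intro AE_completion)
  have [measurable]: "g \<in> borel_measurable borel" using gm by simp
  have gl: "g \<in> borel_measurable lebesgue" using gm by (rule measurable_completion)
  have "integrable lebesgue g"
    using Lint gL gl integrable_cong_AE[of "\<lambda>x. ?b x *\<^sub>R ?L x" lebesgue g] by auto
  then have g: "integrable lborel g" using gm by (simp add: integrable_completion)
  have eq: "(LINT y|lborel. U y * laplacian \<psi> y) = (LINT y|lborel. g y * \<psi> y)"
    if \<psi>: "test_function (ball p R) \<psi>" for \<psi>
  proof -
    note [measurable] = test_function_measurable[OF \<psi>] laplacian_test_measurable[OF \<psi>]
    have \<psi>\<Omega>: "test_function \<Omega> \<psi>" by (rule test_function_mono[OF \<psi> ball_\<Omega>])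
    have "(LINT y|lborel. U y * laplacian \<psi> y) = (LINT y|lebesgue. U y * laplacian \<psi> y)"
      by (rule integral_completion[symmetric]) measurable
    also have "\<dots> = (LINT y|lebesgue. indicator \<Omega> y *\<^sub>R (u y * laplacian \<psi> y))"
      using laplacian_test_vanishes[OF \<psi>] ball_\<Omega>
      by (intro Bochner_Integration.integral_cong refl) (auto simp: U_def indicator_def)
    also have "\<dots> = (LINT y|lebesgue_on \<Omega>. u y * laplacian \<psi> y)"
      by (rule integral_restrict_space[OF \<Omega>s, symmetric])
    also have "\<dots> = (LINT y|lebesgue_on \<Omega>. ?L y * \<psi> y)"
      by (rule weak_laplacian_test[OF \<Omega>(1) u(1) \<psi>\<Omega>])
    also have "\<dots> = (LINT y|lebesgue. indicator \<Omega> y *\<^sub>R (?L y * \<psi> y))"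
      by (rule integral_restrict_space[OF \<Omega>s])
    also have "\<dots> = (LINT y|lebesgue. (?b y *\<^sub>R ?L y) * \<psi> y)"
      using test_function_vanishes[OF \<psi>] ball_\<Omega>
      by (intro Bochner_Integration.integral_cong refl) (auto simp: indicator_def)
    also have "\<dots> = (LINT y|lebesgue. g y * \<psi> y)"
    proof (rule integral_cong_AE)
      have [measurable]: "\<psi> \<in> borel_measurable lebesgue"
        using test_function_measurable[OF \<psi>] by (intro measurable_completion) simp
      show "(\<lambda>y. (?b y *\<^sub>R ?L y) * \<psi> y) \<in> borel_measurable lebesgue"
        by (rule borel_measurable_times[OF borel_measurable_integrable[OF Lint]]) measurable
      show "(\<lambda>y. g y * \<psi> y) \<in> borel_measurable lebesgue"
        by (rule borel_measurable_times[OF gl]) measurable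
      show "AE y in lebesgue. (?b y *\<^sub>R ?L y) * \<psi> y = g y * \<psi> y" using gL by eventually_elim simp
    qed
    also have "\<dots> = (LINT y|lborel. g y * \<psi> y)"
      by (rule integral_completion) measurable
    finally show ?thesis .
  qed
  define F where "F x = \<epsilon> * g x - 1 / \<epsilon> * deriv W (U x)" for x
  have [measurable]: "F \<in> borel_measurable borel" unfolding F_def[abs_def] deriv_W by measurable
  let ?M = "willmore_measure \<Omega> \<epsilon> u"
  have dens: "area_density \<Omega> \<epsilon> u \<in> borel_measurable (lebesgue_on \<Omega>)"
    "willmore_density \<Omega> \<epsilon> u \<in> borel_measurable (lebesgue_on \<Omega>)"
    by (rule densities_measurable[OF \<Omega>(1) u(1)])+
  have dens\<Omega>: "(\<lambda>x. ennreal (f x) * indicator \<Omega> x) \<in> borel_measurable lebesgue"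
    if "f \<in> borel_measurable (lebesgue_on \<Omega>)" for f
  proof -
    have "(\<lambda>x. ennreal (f x)) \<in> borel_measurable (lebesgue_on \<Omega>)" using that by measurable
    then show ?thesis by (simp only: borel_measurable_restrict_space_iff_ennreal[OF \<Omega>s])
  qed
  have Fsq: "?c x * (F x)\<^sup>2 = \<epsilon> * c0 * (willmore_density \<Omega> \<epsilon> u x * ?c x)" if "?b x *\<^sub>R ?L x = g x" for x
  proof (cases "x \<in> cball p r")
    case True
    then have "x \<in> ball p R" using cr by blast
    then have "F x = \<epsilon> * ?L x - 1 / \<epsilon> * deriv W (u x)" using that by (simp add: F_def U_def)
    then show ?thesis using True \<epsilon> c0_pos by (simp add: willmore_density_def)
  qed simp
  have wd0: "willmore_density \<Omega> \<epsilon> u x \<ge> 0" for x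
    using \<epsilon> c0_pos by (simp add: willmore_density_def)
  have Fnn: "(\<integral>\<^sup>+x. ennreal (?c x * (F x)\<^sup>2) \<partial>lborel) = ennreal (\<epsilon> * c0) * emeasure ?M (cball p r)"
  proof -
    have "(\<integral>\<^sup>+x. ennreal (?c x * (F x)\<^sup>2) \<partial>lborel) = (\<integral>\<^sup>+x. ennreal (?c x * (F x)\<^sup>2) \<partial>lebesgue)"
      by (rule nn_integral_completion[symmetric])
    also have "\<dots> = (\<integral>\<^sup>+x. ennreal (\<epsilon> * c0) * (ennreal (willmore_density \<Omega> \<epsilon> u x) * indicator (cball p r \<inter> \<Omega>) x) \<partial>lebesgue)"
    proof (rule nn_integral_cong_AE)
      show "AE x in lebesgue. ennreal (?c x * (F x)\<^sup>2) =
          ennreal (\<epsilon> * c0) * (ennreal (willmore_density \<Omega> \<epsilon> u x) * indicator (cball p r \<inter> \<Omega>) x)"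
        using gL
      proof eventually_elim
        case (elim x)
        show ?case unfolding Fsq[OF elim] using \<epsilon> c0_pos wd0[of x] cr ball_\<Omega>
          by (auto simp: indicator_def ennreal_mult)
      qed
    qed
    also have "\<dots> = ennreal (\<epsilon> * c0) * (\<integral>\<^sup>+x. ennreal (willmore_density \<Omega> \<epsilon> u x) * indicator (cball p r \<inter> \<Omega>) x \<partial>lebesgue)"
    proof (rule nn_integral_cmult)
      have "(\<lambda>x. ennreal (willmore_density \<Omega> \<epsilon> u x) * indicator \<Omega> x) \<in> borel_measurable lebesgue"
        by (rule dens\<Omega>[OF dens(2)])
      then have "(\<lambda>x. ennreal (willmore_density \<Omega> \<epsilon> u x) * indicator \<Omega> x * indicator (cball p r) x) \<in> borel_measurable lebesgue"
        by (rule borel_measurable_times_ennreal) (rule borel_measurable_indicator, simp)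
      moreover have "(\<lambda>x. ennreal (willmore_density \<Omega> \<epsilon> u x) * indicator \<Omega> x * indicator (cball p r) x) =
          (\<lambda>x. ennreal (willmore_density \<Omega> \<epsilon> u x) * indicator (cball p r \<inter> \<Omega>) x)"
        by (auto simp: indicator_def)
      ultimately show "(\<lambda>x. ennreal (willmore_density \<Omega> \<epsilon> u x) * indicator (cball p r \<inter> \<Omega>) x) \<in> borel_measurable lebesgue"
        by simp
    qed
    also have "(\<integral>\<^sup>+x. ennreal (willmore_density \<Omega> \<epsilon> u x) * indicator (cball p r \<inter> \<Omega>) x \<partial>lebesgue) = emeasure ?M (cball p r)"
      unfolding willmore_measure_def by (rule emeasure_distr_density_lebesgue_on[OF \<Omega>(1) dens(2), symmetric]) simp
    finally show ?thesis .
  qed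
  have "emeasure ?M (cball p r) \<le> emeasure ?M UNIV" by (rule emeasure_mono) (auto simp: willmore_measure_def)
  then have fin: "emeasure ?M (cball p r) < \<infinity>" using willmore by (rule le_less_trans)
  then have Mm: "emeasure ?M (cball p r) = ennreal (measure ?M (cball p r))"
    by (intro emeasure_eq_ennreal_measure) auto
  have Fnn': "(\<integral>\<^sup>+x. ennreal (?c x * (F x)\<^sup>2) \<partial>lborel) = ennreal (\<epsilon> * (c0 * measure ?M (cball p r)))"
    unfolding Fnn Mm using \<epsilon> c0_pos by (simp add: ennreal_mult[symmetric] mult.assoc)
  have Fm: "(\<lambda>x. ?c x * (F x)\<^sup>2) \<in> borel_measurable borel"
    by (rule borel_measurable_times[OF borel_measurable_indicator]) (simp, measurable)
  have Fint: "integrable lborel (\<lambda>x. ?c x * (F x)\<^sup>2)"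
    by (rule integrableI_bounded) (use Fnn' Fm in auto)
  have Fa: "(LINT x|lborel. ?c x * (F x)\<^sup>2) \<le> \<epsilon> * (c0 * measure ?M (cball p r))"
    using Fnn' Fm \<epsilon> c0_pos by (subst integral_eq_nn_integral) auto
  have Ww: "(LINT x|lborel. ?c x * W (U x)) \<le> \<epsilon> * (c0 * w)"
  proof -
    have [measurable]: "(\<lambda>x. W (U x)) \<in> borel_measurable borel" unfolding W_def by measurable
    have "(\<integral>\<^sup>+x. ennreal (?c x * W (U x)) \<partial>lborel) = (\<integral>\<^sup>+x. ennreal (?c x * W (U x)) \<partial>lebesgue)"
      by (rule nn_integral_completion[symmetric])
    also have "\<dots> \<le> (\<integral>\<^sup>+x. ennreal (\<epsilon> * c0) * (ennreal (area_density \<Omega> \<epsilon> u x) * indicator (UNIV \<inter> \<Omega>) x) \<partial>lebesgue)"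
    proof (rule nn_integral_mono)
      fix x
      show "ennreal (?c x * W (U x)) \<le> ennreal (\<epsilon> * c0) * (ennreal (area_density \<Omega> \<epsilon> u x) * indicator (UNIV \<inter> \<Omega>) x)"
      proof (cases "x \<in> cball p r")
        case True
        then have x: "x \<in> ball p R" "x \<in> \<Omega>" using cr ball_\<Omega> by auto
        have "W (u x) \<le> \<epsilon> * c0 * area_density \<Omega> \<epsilon> u x"
          using \<epsilon> c0_pos by (simp add: area_density_def field_simps)
        then have "ennreal (W (u x)) \<le> ennreal (\<epsilon> * c0 * area_density \<Omega> \<epsilon> u x)" by (rule ennreal_leI)
        also have "\<dots> = ennreal (\<epsilon> * c0) * ennreal (area_density \<Omega> \<epsilon> u x)"
          using \<epsilon> c0_pos W_nonneg[of "u x"] by (intro ennreal_mult) (auto simp: area_density_def)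
        finally show ?thesis using True x by (simp add: U_def)
      qed simp
    qed
    also have "\<dots> = ennreal (\<epsilon> * c0) * (\<integral>\<^sup>+x. ennreal (area_density \<Omega> \<epsilon> u x) * indicator (UNIV \<inter> \<Omega>) x \<partial>lebesgue)"
      using dens\<Omega>[OF dens(1)] by (intro nn_integral_cmult) simp
    also have "\<dots> = ennreal (\<epsilon> * c0) * emeasure (area_measure \<Omega> \<epsilon> u) UNIV"
      unfolding area_measure_def by (subst emeasure_distr_density_lebesgue_on[OF \<Omega>(1) dens(1)]) auto
    also have "\<dots> \<le> ennreal (\<epsilon> * c0) * ennreal w" by (intro mult_left_mono area) auto
    also have "\<dots> = ennreal (\<epsilon> * (c0 * w))" using \<epsilon> c0_pos w by (simp add: ennreal_mult[symmetric] mult.assoc)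
    finally have "(\<integral>\<^sup>+x. ennreal (?c x * W (U x)) \<partial>lborel) \<le> ennreal (\<epsilon> * (c0 * w))" .
    moreover have "(\<lambda>x. ?c x * W (U x)) \<in> borel_measurable borel"
      by (rule borel_measurable_times[OF borel_measurable_indicator]) (simp, measurable)
    ultimately show ?thesis using \<epsilon> c0_pos w W_nonneg
      by (subst integral_eq_nn_integral) (auto intro!: enn2real_leI)
  qed
  have Up: "U p = u p" using r by (simp add: U_def)
  show ?thesis
    using interior_estimate[OF dim r \<epsilon> A _ B UV g eq, of "c0 * measure ?M (cball p r)" "c0 * w"] Fint Fa Ww z
    by (simp add: F_def Up)
qed

section \<open>Concentration of the Willmore measure\<close>

text \<open>
  Mass on a fixed ball survives, up to doubling the radius, in the weak-* limit, even if it is present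
  only along a subsequence: the convergence is tested with a cut-off function between the two balls.
\<close>

lemma weak_star_lower_bound:
  fixes x :: "'a::euclidean_space"
  assumes conv: "weak_star_conv M N" and N: "finite_measure N" "sets N = sets borel"
    and M: "\<And>k. finite_measure (M k)" "\<And>k. sets (M k) = sets borel" and \<rho>: "\<rho> > 0"
    and freq: "\<exists>\<^sub>F k in sequentially. \<theta> \<le> measure (M k) (cball x \<rho>)"
  shows "\<theta> \<le> measure N (cball x (2 * \<rho>))"
proof -
  define f where "f y = max 0 (min 1 (2 - dist x y / \<rho>))" for y
  have cont: "continuous_on UNIV f" unfolding f_def using \<rho> by (intro continuous_intros) auto
  have f01: "0 \<le> f y" "f y \<le> 1" for y by (auto simp: f_def)
  have f1: "f y = 1" if "y \<in> cball x \<rho>" for y using that \<rho> by (simp add: f_def field_simps)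
  have f0: "f y = 0" if "y \<notin> cball x (2 * \<rho>)" for y using that \<rho> by (simp add: f_def field_simps)
  have "closure {y. f y \<noteq> 0} \<subseteq> cball x (2 * \<rho>)"
  proof (rule closure_minimal)
    show "{y. f y \<noteq> 0} \<subseteq> cball x (2 * \<rho>)" using f0 by blast
  qed simp
  then have "compact (closure {y. f y \<noteq> 0})"
    by (auto simp: compact_eq_bounded_closed intro: bounded_subset[OF bounded_cball])
  with conv cont have lim: "(\<lambda>k. LINT y|M k. f y) \<longlonglongrightarrow> (LINT y|N. f y)"
    unfolding weak_star_conv_def by blast
  have fm: "f \<in> borel_measurable P" if "sets P = sets borel" for P
    using borel_measurable_continuous_onI[OF cont] that by (simp cong: measurable_cong_sets)
  have fint: "integrable P f" if "finite_measure P" "sets P = sets borel" for P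
    by (rule finite_measure.integrable_const_bound[OF that(1), of f 1]) (use f01 fm[OF that(2)] in auto)
  have ind: "integrable P (indicator (cball x t) :: 'a \<Rightarrow> real)"
    "(LINT y|P. indicator (cball x t) y) = measure P (cball x t)"
    if "finite_measure P" "sets P = sets borel" for P t
  proof -
    interpret finite_measure P by fact
    have "cball x t \<in> sets P" using that(2) by simp
    then show "integrable P (indicator (cball x t) :: 'a \<Rightarrow> real)"
      "(LINT y|P. indicator (cball x t) y) = measure P (cball x t)"
      by (auto intro!: integrable_real_indicator simp: less_top[symmetric])
  qed
  have "measure (M k) (cball x \<rho>) \<le> (LINT y|M k. f y)" for k
    unfolding ind(2)[OF M, symmetric]
    by (intro integral_mono ind(1) fint M) (use f01 f1 in \<open>auto simp: indicator_def\<close>)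
  then have freq': "\<exists>\<^sub>F k in sequentially. \<theta> \<le> (LINT y|M k. f y)"
    using freq by (auto elim!: frequently_elim1 intro: order.trans)
  have "\<theta> \<le> (LINT y|N. f y)"
  proof (rule ccontr)
    assume "\<not> ?thesis"
    then have "\<forall>\<^sub>F k in sequentially. (LINT y|M k. f y) < \<theta>" using lim by (intro order_tendstoD) auto
    then have "\<forall>\<^sub>F k in sequentially. \<not> \<theta> \<le> (LINT y|M k. f y)" by eventually_elim simp
    then show False using freq' by (simp add: frequently_def)
  qed
  also have "\<dots> \<le> measure N (cball x (2 * \<rho>))"
    unfolding ind(2)[OF N, symmetric]
    by (intro integral_mono ind(1) fint N) (use f01 f0 in \<open>auto simp: indicator_def\<close>)
  finally show ?thesis .
qed

lemma point_mass_lower_bound: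
  fixes x :: "'a::euclidean_space"
  assumes N: "finite_measure N" "sets N = sets borel" and \<rho>0: "\<rho>0 > 0"
    and le: "\<And>\<rho>. 0 < \<rho> \<Longrightarrow> \<rho> < \<rho>0 \<Longrightarrow> \<theta> \<le> measure N (cball x \<rho>)"
  shows "\<theta> \<le> measure N {x}"
proof -
  interpret finite_measure N by fact
  define t where "t n = \<rho>0 / real (n + 2)" for n
  have t: "0 < t n" "t n < \<rho>0" for n
  proof -
    show "0 < t n" using \<rho>0 by (simp add: t_def)
    have "\<rho>0 / real (n + 2) < \<rho>0 / 1" using \<rho>0 by (intro divide_strict_left_mono) auto
    then show "t n < \<rho>0" by (simp add: t_def)
  qed
  have t0: "t \<longlonglongrightarrow> 0"
    unfolding t_def by (rule LIMSEQ_ignore_initial_segment[OF lim_const_over_n])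
  have dec: "decseq (\<lambda>n. cball x (t n))"
    unfolding decseq_def
  proof (intro allI impI subset_cball)
    fix m n :: nat assume "m \<le> n"
    then show "t n \<le> t m"
      unfolding t_def using \<rho>0 by (intro frac_le) simp_all
  qed
  have "range (\<lambda>n. cball x (t n)) \<subseteq> sets N"
    unfolding N(2) by (intro image_subsetI borel_closed closed_cball)
  from finite_Lim_measure_decseq[OF this dec]
  have lim: "(\<lambda>n. measure N (cball x (t n))) \<longlonglongrightarrow> measure N (\<Inter>n. cball x (t n))" .
  have "y = x" if "y \<in> (\<Inter>n. cball x (t n))" for y
  proof -
    have "dist x y \<le> t n" for n using that by simp
    then have "dist x y \<le> 0" by (intro LIMSEQ_le_const[OF t0]) blast
    then show ?thesis by simp
  qed
  moreover have "x \<in> (\<Inter>n. cball x (t n))" using t(1) by (simp add: less_imp_le)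
  ultimately have "(\<Inter>n. cball x (t n)) = {x}" by blast
  with lim have "(\<lambda>n. measure N (cball x (t n))) \<longlonglongrightarrow> measure N {x}" by (simp only:)
  moreover have "\<exists>N0. \<forall>n\<ge>N0. \<theta> \<le> measure N (cball x (t n))" by (intro exI allI impI le t)
  ultimately show ?thesis by (rule LIMSEQ_le_const)
qed

lemma finite_set_of_atoms:
  fixes S :: "'a::euclidean_space set"
  assumes N: "finite_measure N" "sets N = sets borel" and \<theta>: "\<theta> > 0"
    and le: "\<And>x. x \<in> S \<Longrightarrow> \<theta> \<le> measure N {x}"
  shows "finite S"
proof (rule ccontr)
  interpret finite_measure N by fact
  assume "infinite S"
  obtain n :: nat where n: "measure N (space N) / \<theta> < real n" using reals_Archimedean2 by blast
  obtain T where T: "finite T" "card T = n" "T \<subseteq> S"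
    using infinite_arbitrarily_large[OF \<open>infinite S\<close>, of n] by blast
  have "real n * \<theta> = (\<Sum>x\<in>T. \<theta>)" using T by simp
  also have "\<dots> \<le> (\<Sum>x\<in>T. measure N {x})" using T le by (intro sum_mono) auto
  also have "\<dots> = measure N T"
    using N(2) T(1) by (intro finite_measure_eq_sum_singleton[symmetric]) auto
  also have "\<dots> \<le> measure N (space N)" by (rule bounded_measure)
  finally show False using n \<theta> by (simp add: pos_divide_less_eq)
qed

lemma soft_abs_mono: "\<bar>s\<bar> \<le> \<bar>t\<bar> \<Longrightarrow> soft_abs s \<le> soft_abs t"
  by (simp add: soft_abs_def abs_le_square_iff)

lemma soft_abs_pos: "\<bar>t\<bar> > 1 \<Longrightarrow> soft_abs t > 0"
  using abs_square_less_1[of "inverse t"] one_less_power[of "\<bar>t\<bar>" 2] by (simp add: soft_abs_def)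

text \<open>
  For \<open>A = 4800 / z\<close> the term \<open>3 V / (2 A)\<close> of the interior estimate, with \<open>V\<close> the volume of the
  unit ball, is one quarter of \<open>z V / 800\<close>, and the vanishing term is eventually at most one half of it. The
  remaining quarter, divided by \<open>A c0 / 2\<close>, is this number.
\<close>

definition atom_threshold :: "real \<Rightarrow> real" where
  "atom_threshold z = z\<^sup>2 * unit_ball_vol 3 / (7680000 * c0)"

text \<open>
  Every ball around \<open>x\<close> contains points \<open>xs k\<close> with \<open>\<bar>u k (xs k)\<bar> \<ge> 1 + \<tau> / 2\<close> for infinitely
  many \<open>k\<close>, and there the interior estimate forces a fixed amount of Willmore energy. Replacing \<open>\<tau>\<close> by \<open>\<tau> / 2\<close> leaves room for
  the limit superior.
\<close>

lemma overshoot_point_atom: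
  fixes \<Omega> :: "'a::euclidean_space set"
  assumes dim: "DIM('a) = 3" and fam: "phase_field_family \<Omega> eps u u0 \<mu> \<alpha>"
    and \<tau>: "\<tau> > 0" and x: "x \<in> overshoot_points \<Omega> u \<tau>"
  shows "atom_threshold (soft_abs (1 + \<tau> / 2)) \<le> measure \<alpha> {x}"
proof -
  interpret phase_field_family \<Omega> eps u u0 \<mu> \<alpha> by (rule fam)
  let ?M = "\<lambda>k. willmore_measure \<Omega> (eps k) (u k)"
  define V :: real where "V = unit_ball_vol 3"
  define z where "z = soft_abs (1 + \<tau> / 2)"
  define w where "w = measure \<mu> UNIV + 1"
  have V: "V > 0" by (simp add: V_def)
  have z: "z > 0" unfolding z_def using \<tau> by (intro soft_abs_pos) simp
  have w: "w \<ge> 0" by (simp add: w_def add_nonneg_nonneg)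
  interpret \<mu>: finite_measure \<mu> by (rule finite_mu)
  interpret \<alpha>: finite_measure \<alpha> by (rule finite_alpha)
  have area: "emeasure (area_measure \<Omega> (eps k) (u k)) UNIV \<le> ennreal w" for k
    using mass_mu[of k] by (simp add: w_def \<mu>.emeasure_eq_measure ennreal_plus)
  have will: "emeasure (?M k) UNIV < \<infinity>" for k
    using mass_alpha[of k] by (rule le_less_trans) (simp add: \<alpha>.emeasure_eq_measure)
  have fM: "finite_measure (?M k)" and sM: "sets (?M k) = sets borel" for k
    using will[of k] by (auto intro!: finite_measureI simp: willmore_measure_def)
  from x obtain xs where x: "x \<in> \<Omega>" and xs: "xs \<longlonglongrightarrow> x"
    and ls: "limsup (\<lambda>k. ereal \<bar>u k (xs k)\<bar>) \<ge> ereal (1 + \<tau>)"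
    by (auto simp: overshoot_points_def)
  have fr: "\<exists>\<^sub>F k in sequentially. 1 + \<tau> / 2 \<le> \<bar>u k (xs k)\<bar>"
  proof (rule ccontr)
    assume "\<not> ?thesis"
    then have "\<forall>\<^sub>F k in sequentially. ereal \<bar>u k (xs k)\<bar> \<le> ereal (1 + \<tau> / 2)"
      unfolding not_frequently by eventually_elim simp
    then have "limsup (\<lambda>k. ereal \<bar>u k (xs k)\<bar>) \<le> ereal (1 + \<tau> / 2)" by (rule Limsup_bounded)
    with ls have "ereal (1 + \<tau>) \<le> ereal (1 + \<tau> / 2)" by (rule order.trans)
    then show False using \<tau> by simp
  qed
  obtain R0 where R0: "R0 > 0" "cball x R0 \<subseteq> \<Omega>" using open_contains_cball[of \<Omega>] open_domain x by blast
  have near: "\<exists>\<^sub>F k in sequentially. atom_threshold z \<le> measure (?M k) (cball x \<rho>)" if \<rho>: "0 < \<rho>" "\<rho> < R0" for \<rho>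
  proof -
    define r where "r = \<rho> / 4"
    define R where "R = \<rho> / 2"
    have r: "0 < r" "r < R" using \<rho> by (auto simp: r_def R_def)
    define A where "A = 4800 / z"
    have A: "A > 0" using z by (simp add: A_def)
    have "(\<lambda>k. 39 / r\<^sup>2 * (eps k * (c0 * w + 3 * V))) \<longlonglongrightarrow> 39 / r\<^sup>2 * (0 * (c0 * w + 3 * V))"
      by (intro tendsto_intros eps_tendsto)
    then have ev1: "\<forall>\<^sub>F k in sequentially. 39 / r\<^sup>2 * (eps k * (c0 * w + 3 * V)) < z * V / 1600"
      using z V by (intro order_tendstoD(2)) auto
    have ev2: "\<forall>\<^sub>F k in sequentially. dist (xs k) x < r" using xs r(1) by (rule tendstoD)
    show ?thesis
    proof (rule frequently_rev_mp[OF fr])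
      show "\<forall>\<^sub>F k in sequentially. 1 + \<tau> / 2 \<le> \<bar>u k (xs k)\<bar> \<longrightarrow> atom_threshold z \<le> measure (?M k) (cball x \<rho>)"
        using ev1 ev2
      proof eventually_elim
        case (elim k)
        show ?case
        proof
          assume big: "1 + \<tau> / 2 \<le> \<bar>u k (xs k)\<bar>"
          have zk: "z \<le> soft_abs (u k (xs k))" unfolding z_def using big \<tau> by (intro soft_abs_mono) simp
          have sub: "cball (xs k) R \<subseteq> cball x \<rho>" "cball (xs k) r \<subseteq> cball x \<rho>"
            using elim(2) \<rho>(1) by (auto simp: cball_subset_cball_iff r_def R_def dist_commute)
          have sub\<Omega>: "cball (xs k) R \<subseteq> \<Omega>"
            using sub(1) R0(2) subset_cball[of \<rho> R0 x] \<rho>(2) by auto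
          define m where "m = measure (?M k) (cball (xs k) r)"
          have "soft_abs (u k (xs k)) * V / 800 \<le> A * (c0 * m) / 2 + 3 * V / (2 * A) + 39 / r\<^sup>2 * (eps k * (c0 * w + 3 * V))"
            unfolding V_def m_def
            by (rule local_willmore_estimate[OF dim r eps_pos A open_domain sub\<Omega> u_Sobolev u_continuous area w will])
              (use zk z in linarith)
          moreover have "z * V / 800 \<le> soft_abs (u k (xs k)) * V / 800"
            using zk V by (intro divide_right_mono mult_right_mono) auto
          moreover have "3 * V / (2 * A) = z * V / 3200" using z by (simp add: A_def)
          ultimately have "z * V / 3200 \<le> A * (c0 * m) / 2" using elim(1) by linarith
          then have "z * V / 3200 * (z / 2400) \<le> A * (c0 * m) / 2 * (z / 2400)"
            using z by (intro mult_right_mono) auto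
          also have "\<dots> = c0 * m" using z by (simp add: A_def)
          finally have "atom_threshold z \<le> m"
            using c0_pos by (simp add: atom_threshold_def V_def field_simps power2_eq_square)
          also have "m \<le> measure (?M k) (cball x \<rho>)"
            unfolding m_def using sM[of k] by (intro finite_measure.finite_measure_mono[OF fM] sub) auto
          finally show "atom_threshold z \<le> measure (?M k) (cball x \<rho>)" .
        qed
      qed
    qed
  qed
  have "atom_threshold z \<le> measure \<alpha> (cball x \<rho>)" if "0 < \<rho>" "\<rho> < 2 * R0" for \<rho>
    using weak_star_lower_bound[OF conv_alpha finite_alpha sets_alpha fM sM _ near[of "\<rho> / 2"]] that
    by simp
  then show ?thesis
    unfolding z_def[symmetric] using R0(1)
    by (intro point_mass_lower_bound[OF finite_alpha sets_alpha, of "2 * R0"]) auto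
qed

theorem theorem2p11:
  fixes alpha_bar mu_bar \<tau> :: real
  assumes "\<tau> > 0"
  shows "\<exists>theta_bar>0.
    \<forall>(\<Omega> :: (real ^ 3) set) (eps :: nat \<Rightarrow> real) (u :: nat \<Rightarrow> real ^ 3 \<Rightarrow> real)
       (u0 :: real ^ 3 \<Rightarrow> real) (\<mu> :: (real ^ 3) measure) (\<alpha> :: (real ^ 3) measure).
      phase_field_family \<Omega> eps u u0 \<mu> \<alpha> \<and>
      measure \<mu> UNIV = mu_bar \<and> measure \<alpha> UNIV = alpha_bar \<longrightarrow>
        (\<forall>x\<in>overshoot_points \<Omega> u \<tau>. measure \<alpha> {x} \<ge> theta_bar) \<and>
        finite (overshoot_points \<Omega> u \<tau>)"
proof (intro exI[of _ "atom_threshold (soft_abs (1 + \<tau> / 2))"] conjI allI impI)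
  have "soft_abs (1 + \<tau> / 2) > 0" using assms by (intro soft_abs_pos) simp
  then show pos: "atom_threshold (soft_abs (1 + \<tau> / 2)) > 0"
    using c0_pos by (simp add: atom_threshold_def)
  fix \<Omega> :: "(real ^ 3) set" and eps u u0 and \<mu> \<alpha> :: "(real ^ 3) measure"
  assume *: "phase_field_family \<Omega> eps u u0 \<mu> \<alpha> \<and> measure \<mu> UNIV = mu_bar \<and> measure \<alpha> UNIV = alpha_bar"
  then have fam: "phase_field_family \<Omega> eps u u0 \<mu> \<alpha>" by simp
  have atom: "atom_threshold (soft_abs (1 + \<tau> / 2)) \<le> measure \<alpha> {x}" if "x \<in> overshoot_points \<Omega> u \<tau>" for x
    by (rule overshoot_point_atom[OF _ fam assms that]) simp
  then show "\<forall>x\<in>overshoot_points \<Omega> u \<tau>. atom_threshold (soft_abs (1 + \<tau> / 2)) \<le> measure \<alpha> {x}" by blast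
  interpret phase_field_family \<Omega> eps u u0 \<mu> \<alpha> by (rule fam)
  show "finite (overshoot_points \<Omega> u \<tau>)"
    by (rule finite_set_of_atoms[OF finite_alpha sets_alpha pos atom])
qed

end
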